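(* Let $r\ge0$, $s\ge2$, $\rho_h>0$, $d_h\ge0$ ($1\le h\le r$), $\widehat a_*\in\mathbb R$. Let $\boldsymbol\lambda=(\boldsymbol n,\boldsymbol\eta)\in\mathbb N_0^r\times\mathbb N_0^s$ be Laguerre admissible (see context), $R=|\boldsymbol\eta|$, $N=|\boldsymbol n|+R$, and suppose $R>s$ and that the rates $\rho_h$ with $n_h>0$ are pairwise distinct. Write $R=sQ+R_0$, $0\le R_0<s$, and $\kappa=(s-1)(Q-1)+R_0>0$. With the polynomials $\Phi_{j,k}$, the matrix $C$, the rows $U_j^{\mathrm H}$ and the vectors $\boldsymbol r_k(t)$ of the context, $$\operatorname{span}\{\Phi_{j,k}:(j,k)\in\mathcal I_{\boldsymbol\lambda}\}=\mathbb P_{N-\kappa-1},\qquad\operatorname{rank}C=N-\kappa,\qquad\dim\ker C=\kappa.$$ The space of polynomial component vectors $(V_j)_{j=1}^{r+s}$ satisfying $\deg V_j<\lambda_j$ and $\sum_jV_j(t)U_j^{\mathrm H}(t)\equiv0$ has the basis $$\{t^a\boldsymbol r_k(t):0\le k\le s-2,\ 0\le a\le\eta_{k+1}-2\}.$$ Expanding the component polynomials in the Hermite basis identifies this space with $\ker C$.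
   Context: Laguerre admissible: any two entries of $(n_1,\dots,n_r,\eta_1,\dots,\eta_s)$ differ by at most one, and $\boldsymbol\eta$ lies on the ordered $s$-step-line, i.e. $\eta_\ell=Q+1$ for $\ell\le R_0$ and $\eta_\ell=Q$ for $\ell>R_0$. Put $\lambda_h=n_h$, $\lambda_{r+\ell}=\eta_\ell$, $\mathcal I_{\boldsymbol\lambda}=\{(j,k):1\le j\le r+s,\ 0\le k<\lambda_j\}$ (lexicographic order; $N$ elements). $\mathbb P_M$ = polynomials of degree $\le M$. $\phi_a(t)=\pi^{-1/2}\mathrm e^{-(t-a)^2}$; $(K_{\rho,d}f)(t)=\int_0^\infty\frac{\rho^d}{\Gamma(d)}u^{d-1}\mathrm e^{-\rho u}f(t+u)\,\mathrm du$ ($\rho,d>0$), $K_{\rho,0}=I$; $F=K_{\rho_1,d_1}\cdots K_{\rho_r,d_r}\phi_{\widehat a_*}$. Rows: $U_h^{\mathrm H}=K_{\rho_h,1}F$ ($1\le h\le r$), $U_{r+\ell}^{\mathrm H}=F^{(\ell-1)}$ ($1\le\ell\le s$). $L_F(z)=\int_{\mathbb R}\mathrm e^{zt}F(t)\,\mathrm dt=\mathrm e^{\widehat a_*z+z^2/4}\prod_h(\rho_h/(\rho_h+z))^{d_h}$; $\Lambda_h=\frac{\rho_h}{\rho_h+z}L_F$ ($h\le r$), $\Lambda_{r+\ell}=(-z)^{\ell-1}L_F$; $D_{\boldsymbol n}(z)=\prod_h(\rho_h+z)^{n_h}$; monic Hermite polynomials $\mathrm e^{uz-z^2/4}=\sum_\ell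 H_\ell(u)z^\ell/\ell!$; $\Phi_{j,k}=\frac{D_{\boldsymbol n}}{L_F}H_k(\partial_z)\Lambda_j$, polynomials of degree $\le N-1$; $C$ is the $N\times N$ matrix $C_{\nu,(j,k)}=[z^\nu]\Phi_{j,k}$, $0\le\nu\le N-1$. The Hermite-basis identification sends $(V_j)$ with $V_j=\sum_kv_{j,k}H_k$ to the vector $(v_{j,k})_{(j,k)\in\mathcal I_{\boldsymbol\lambda}}$. For $0\le k\le s-2$, $\boldsymbol r_k(t)$ is the vector of coefficients, with respect to $(U_1^{\mathrm H},\dots,U_{r+s}^{\mathrm H})$, of the identity $$F^{(k+1)}+2(t-\widehat a_* )F^{(k)}+2kF^{(k-1)}+2\sum_{h=1}^rd_h\rho_h^{k-1}U_h^{\mathrm H}-2\sum_{h=1}^rd_h\sum_{a=0}^{k-1}\rho_h^{k-a-1}F^{(a)}=0,$$ where the term $kF^{(k-1)}$ and the inner sum are zero when $k=0$. *)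

theory Defs
  imports
    "HOL-Analysis.Analysis"
    "HOL-Library.Function_Algebras"
    "HOL-Computational_Algebra.Polynomial"
    "Jordan_Normal_Form.Matrix_Kernel"
    "Jordan_Normal_Form.DL_Rank"
begin

text \<open>
  All families (\<open>\<rho>\<close>, \<open>d\<close>, \<open>n\<close> on \<open>{1..r}\<close>; \<open>\<eta>\<close> on \<open>{1..s}\<close>; rows and component vectors
  on \<open>{1..r+s}\<close>) are functions on \<open>nat\<close> that are only used at indices in these ranges.
\<close>

definition lam :: "nat \<Rightarrow> (nat \<Rightarrow> nat) \<Rightarrow> (nat \<Rightarrow> nat) \<Rightarrow> nat \<Rightarrow> nat" where
  "lam r n \<eta> j = (if j \<le> r then n j else \<eta> (j - r))"

definition on_step_line :: "nat \<Rightarrow> (nat \<Rightarrow> nat) \<Rightarrow> bool" where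
  "on_step_line s \<eta> \<longleftrightarrow>
     (\<exists>Q R0. R0 < s \<and> (\<forall>l\<in>{1..s}. \<eta> l = (if l \<le> R0 then Q + 1 else Q)))"

definition Laguerre_admissible ::
    "nat \<Rightarrow> nat \<Rightarrow> (nat \<Rightarrow> nat) \<Rightarrow> (nat \<Rightarrow> nat) \<Rightarrow> bool" where
  "Laguerre_admissible r s n \<eta> \<longleftrightarrow>
     (\<forall>i\<in>{1..r+s}. \<forall>j\<in>{1..r+s}. lam r n \<eta> i \<le> lam r n \<eta> j + 1) \<and> on_step_line s \<eta>"

definition lam_total :: "nat \<Rightarrow> nat \<Rightarrow> (nat \<Rightarrow> nat) \<Rightarrow> (nat \<Rightarrow> nat) \<Rightarrow> nat" where
  "lam_total r s n \<eta> = (\<Sum>j=1..r+s. lam r n \<eta> j)"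

text \<open>The index set \<open>{(j,k). 1 \<le> j \<le> r+s, 0 \<le> k < lam j}\<close>, listed in lexicographic order.\<close>

definition lam_indices ::
    "nat \<Rightarrow> nat \<Rightarrow> (nat \<Rightarrow> nat) \<Rightarrow> (nat \<Rightarrow> nat) \<Rightarrow> (nat \<times> nat) list" where
  "lam_indices r s n \<eta> =
     concat (map (\<lambda>j. map (\<lambda>k. (j, k)) [0..<lam r n \<eta> j]) [1..<Suc (r + s)])"

lemma set_lam_indices:
  "set (lam_indices r s n \<eta>) = {(j, k). j \<in> {1..r+s} \<and> k < lam r n \<eta> j}"
  by (auto simp: lam_indices_def)

lemma length_lam_indices: "length (lam_indices r s n \<eta>) = lam_total r s n \<eta>"
  by (simp add: lam_indices_def lam_total_def length_concat o_def interv_sum_list_conv_sum_set_nat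
      atLeastLessThanSuc_atLeastAtMost del: upt_Suc)

definition gauss :: "real \<Rightarrow> real \<Rightarrow> real" where
  "gauss a t = exp (- (t - a)\<^sup>2) / sqrt pi"

definition K_op :: "real \<Rightarrow> real \<Rightarrow> (real \<Rightarrow> real) \<Rightarrow> real \<Rightarrow> real" where
  "K_op \<rho> d f = (if d = 0 then f
     else (\<lambda>t. LBINT u:{0<..}. \<rho> powr d / Gamma d * u powr (d - 1) * exp (- \<rho> * u) * f (t + u)))"

text \<open>\<open>F = K\<^bsub>\<rho>\<^sub>1,d\<^sub>1\<^esub> \<dots> K\<^bsub>\<rho>\<^sub>r,d\<^sub>r\<^esub>\<close> applied to the Gaussian, the rightmost operator acting first.\<close>

definition F_fun :: "nat \<Rightarrow> (nat \<Rightarrow> real) \<Rightarrow> (nat \<Rightarrow> real) \<Rightarrow> real \<Rightarrow> real \<Rightarrow> real" where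
  "F_fun r \<rho> d a = foldr (\<lambda>h. K_op (\<rho> h) (d h)) [1..<Suc r] (gauss a)"

definition U_row ::
    "nat \<Rightarrow> (nat \<Rightarrow> real) \<Rightarrow> (nat \<Rightarrow> real) \<Rightarrow> real \<Rightarrow> nat \<Rightarrow> real \<Rightarrow> real" where
  "U_row r \<rho> d a j =
     (if j \<le> r then K_op (\<rho> j) 1 (F_fun r \<rho> d a)
      else (deriv ^^ (j - r - 1)) (F_fun r \<rho> d a))"

definition monic_hermite :: "nat \<Rightarrow> real poly" where
  "monic_hermite = (THE H. \<forall>u z. (\<lambda>l. poly (H l) u * z ^ l / fact l) sums exp (u * z - z\<^sup>2 / 4))"

lemma monic_hermite_exists:
  "\<exists>H. \<forall>u z::real. (\<lambda>l. poly (H l) u * z ^ l / fact l) sums exp (u * z - z\<^sup>2 / 4)"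
proof -
  define b :: "nat \<Rightarrow> real"
    where "b m = (if even m then (- 1 / 4) ^ (m div 2) / fact (m div 2) else 0)" for m
  define H :: "nat \<Rightarrow> real poly"
    where "H l = (\<Sum>i\<le>l. monom (fact l / fact i * b (l - i)) i)" for l
  have E: "(\<lambda>m. x ^ m / fact m) sums exp x" for x :: real
    using exp_converges[of x] by (simp add: divide_inverse_commute)
  have "(\<lambda>l. poly (H l) u * z ^ l / fact l) sums exp (u * z - z\<^sup>2 / 4)" for u z :: real
  proof -
    have "(\<lambda>m. (- z\<^sup>2 / 4) ^ m / fact m) sums exp (- z\<^sup>2 / 4)"
      by (rule E)
    from sums_if[OF sums_zero this]
    have "(\<lambda>m. if even m then (- z\<^sup>2 / 4) ^ (m div 2) / fact (m div 2) else 0)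
            sums exp (- z\<^sup>2 / 4)" by simp
    moreover have "(if even m then (- z\<^sup>2 / 4) ^ (m div 2) / fact (m div 2) else 0) = b m * z ^ m"
      for m
    proof (cases "even m")
      case True
      then obtain q where q: "m = 2 * q" by (auto elim: evenE)
      have "(- z\<^sup>2 / 4) ^ q = (- 1 / 4) ^ q * z ^ (2 * q)"
        by (simp add: power_mult flip: power_mult_distrib)
      then show ?thesis by (simp add: b_def q)
    qed (simp add: b_def)
    ultimately have B: "(\<lambda>m. b m * z ^ m) sums exp (- z\<^sup>2 / 4)" by simp
    have A: "(\<lambda>i. (u * z) ^ i / fact i) sums exp (u * z)"
      by (rule E)
    have SA: "summable (\<lambda>i. norm ((u * z) ^ i / fact i))"
      using sums_summable[OF E[of "\<bar>u * z\<bar>"]] by (simp add: power_abs)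
    have "summable (\<lambda>m. (z\<^sup>2 / 4) ^ m / fact m)"
      by (rule sums_summable[OF E])
    from sums_summable[OF sums_if[OF sums_zero summable_sums[OF this]]]
    have "summable (\<lambda>m. if even m then (z\<^sup>2 / 4) ^ (m div 2) / fact (m div 2) else 0)" by simp
    moreover have "(if even m then (z\<^sup>2 / 4) ^ (m div 2) / fact (m div 2) else 0)
        = norm (b m * z ^ m)" for m
    proof (cases "even m")
      case True
      then obtain q where q: "m = 2 * q" by (auto elim: evenE)
      have "(z\<^sup>2 / 4) ^ q = (1 / 4) ^ q * z ^ (2 * q)"
        by (simp add: power_mult flip: power_mult_distrib)
      moreover have "\<bar>z ^ (2 * q)\<bar> = z ^ (2 * q)" by simp
      moreover have "\<bar>b (2 * q)\<bar> = (1 / 4) ^ q / fact q" by (simp add: b_def power_abs)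
      ultimately show ?thesis unfolding q by (simp only: real_norm_def abs_mult) simp
    qed (simp add: b_def)
    ultimately have SB: "summable (\<lambda>m. norm (b m * z ^ m))" by simp
    have "(\<lambda>l. \<Sum>i\<le>l. (u * z) ^ i / fact i * (b (l - i) * z ^ (l - i)))
            sums (exp (u * z) * exp (- z\<^sup>2 / 4))"
      using Cauchy_product_sums[OF SA SB] sums_unique[OF A] sums_unique[OF B] by simp
    moreover have "(\<Sum>i\<le>l. (u * z) ^ i / fact i * (b (l - i) * z ^ (l - i)))
        = poly (H l) u * z ^ l / fact l" for l
    proof -
      have "(u * z) ^ i / fact i * (b (l - i) * z ^ (l - i))
          = fact l / fact i * b (l - i) * u ^ i * z ^ l / fact l" if "i \<le> l" for i
        using that by (simp add: power_mult_distrib field_simps flip: power_add)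
      then have "(\<Sum>i\<le>l. (u * z) ^ i / fact i * (b (l - i) * z ^ (l - i)))
          = (\<Sum>i\<le>l. fact l / fact i * b (l - i) * u ^ i * z ^ l / fact l)"
        by (intro sum.cong) simp_all
      then show ?thesis
        by (simp only: H_def poly_sum poly_monom sum_distrib_right sum_divide_distrib)
    qed
    moreover have "exp (u * z) * exp (- z\<^sup>2 / 4) = exp (u * z - z\<^sup>2 / 4)"
      by (simp flip: exp_add)
    ultimately show ?thesis by simp
  qed
  then show ?thesis by blast
qed

lemma monic_hermite_sums:
  "(\<lambda>l. poly (monic_hermite l) u * z ^ l / fact l) sums exp (u * z - z\<^sup>2 / 4)"
proof -
  let ?P = "\<lambda>H :: nat \<Rightarrow> real poly. \<forall>u z. (\<lambda>l. poly (H l) u * z ^ l / fact l) sums exp (u * z - z\<^sup>2 / 4)"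
  obtain H where H: "?P H" using monic_hermite_exists by blast
  have uniq: "G = H" if G: "?P G" for G
  proof (rule ext)
    fix l
    have "poly (G l) u = poly (H l) u" for u
    proof -
      define c where "c m = (poly (G m) u - poly (H m) u) / fact m" for m
      have c: "(\<lambda>m. c m * z ^ m) sums 0" for z
        using sums_diff[OF G[rule_format, of u z] H[rule_format, of u z]]
        by (simp add: c_def diff_divide_distrib left_diff_distrib)
      have "c m = 0" for m
      proof (rule ccontr)
        assume "c m \<noteq> 0"
        define m0 where "m0 = (LEAST m. c m \<noteq> 0)"
        have m0: "c m0 \<noteq> 0" unfolding m0_def using \<open>c m \<noteq> 0\<close> by (rule LeastI)
        have below: "c i = 0" if "i < m0" for i
          using that not_less_Least unfolding m0_def by blast
        have sh: "(\<lambda>i. c (i + m0) * z ^ i) sums 0" if "z \<noteq> 0" for z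
        proof -
          have "(\<lambda>i. c (i + m0) * z ^ (i + m0)) sums 0"
            using sums_split_initial_segment[OF c[of z], of m0] below by simp
          from sums_divide[OF this, of "z ^ m0"] show ?thesis
            using that by (simp add: power_add)
        qed
        have "((\<lambda>z::real. 0::real) \<longlongrightarrow> c (0 + m0)) (at 0)"
          by (rule powser_limit_0_strong[where s = 1 and a = "\<lambda>i. c (i + m0)" and f = "\<lambda>_. 0"]) (use sh in auto)
        then show False using m0 by (simp add: tendsto_const_iff)
      qed
      then show ?thesis by (simp add: c_def)
    qed
    then show "G l = H l" by (simp add: poly_eq_poly_eq_iff[symmetric] fun_eq_iff)
  qed
  have "?P monic_hermite"
    unfolding monic_hermite_def by (rule theI[of ?P, OF H uniq])
  then show ?thesis by blast
qed

definition L_F :: "nat \<Rightarrow> (nat \<Rightarrow> real) \<Rightarrow> (nat \<Rightarrow> real) \<Rightarrow> real \<Rightarrow> real \<Rightarrow> real" where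
  "L_F r \<rho> d a z = (LBINT t. exp (z * t) * F_fun r \<rho> d a t)"

definition Lambda ::
    "nat \<Rightarrow> (nat \<Rightarrow> real) \<Rightarrow> (nat \<Rightarrow> real) \<Rightarrow> real \<Rightarrow> nat \<Rightarrow> real \<Rightarrow> real" where
  "Lambda r \<rho> d a j z =
     (if j \<le> r then \<rho> j / (\<rho> j + z) * L_F r \<rho> d a z
      else (- z) ^ (j - r - 1) * L_F r \<rho> d a z)"

definition D_poly :: "nat \<Rightarrow> (nat \<Rightarrow> real) \<Rightarrow> (nat \<Rightarrow> nat) \<Rightarrow> real \<Rightarrow> real" where
  "D_poly r \<rho> n z = (\<Prod>h=1..r. (\<rho> h + z) ^ n h)"

definition diff_op :: "real poly \<Rightarrow> (real \<Rightarrow> real) \<Rightarrow> real \<Rightarrow> real" where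
  "diff_op p f z = (\<Sum>i\<le>degree p. coeff p i * (deriv ^^ i) f z)"

text \<open>
  The polynomial represented by \<open>D / L_F * H\<^sub>k(\<partial>) \<Lambda>\<^sub>j\<close>. The Laplace integral
  \<open>L_F\<close> is only used on an open half-line on which it converges; the values on that
  half-line determine the polynomial.
\<close>

definition Phi ::
    "nat \<Rightarrow> (nat \<Rightarrow> real) \<Rightarrow> (nat \<Rightarrow> real) \<Rightarrow> real \<Rightarrow> (nat \<Rightarrow> nat) \<Rightarrow> nat \<Rightarrow> nat \<Rightarrow> real poly" where
  "Phi r \<rho> d a n j k = (THE p. \<forall>z. (\<forall>h\<in>{1..r}. 0 < \<rho> h + z) \<longrightarrow>
     poly p z = D_poly r \<rho> n z / L_F r \<rho> d a z * diff_op (monic_hermite k) (Lambda r \<rho> d a j) z)"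

definition C_mat ::
    "nat \<Rightarrow> nat \<Rightarrow> (nat \<Rightarrow> real) \<Rightarrow> (nat \<Rightarrow> real) \<Rightarrow> real \<Rightarrow> (nat \<Rightarrow> nat) \<Rightarrow> (nat \<Rightarrow> nat) \<Rightarrow> real mat" where
  "C_mat r s \<rho> d a n \<eta> = mat (lam_total r s n \<eta>) (lam_total r s n \<eta>)
     (\<lambda>(\<nu>, c). case lam_indices r s n \<eta> ! c of (j, k) \<Rightarrow> coeff (Phi r \<rho> d a n j k) \<nu>)"

interpretation poly_vs: vector_space "Polynomial.smult :: real \<Rightarrow> real poly \<Rightarrow> real poly"
  by unfold_locales (auto simp: smult_add_right smult_add_left)

text \<open>
  Component vectors are functions \<open>nat \<Rightarrow> real poly\<close>, added pointwise; the vectors under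
  consideration vanish outside \<open>{1..r+s}\<close>.
\<close>

definition comp_scale :: "real \<Rightarrow> (nat \<Rightarrow> real poly) \<Rightarrow> nat \<Rightarrow> real poly" where
  "comp_scale c V = (\<lambda>j. Polynomial.smult c (V j))"

interpretation comp_vs: vector_space comp_scale
  by unfold_locales
    (auto simp: comp_scale_def fun_eq_iff smult_add_right smult_add_left)

definition relation_space ::
    "nat \<Rightarrow> nat \<Rightarrow> (nat \<Rightarrow> real) \<Rightarrow> (nat \<Rightarrow> real) \<Rightarrow> real \<Rightarrow> (nat \<Rightarrow> nat) \<Rightarrow> (nat \<Rightarrow> nat)
      \<Rightarrow> (nat \<Rightarrow> real poly) set" where
  "relation_space r s \<rho> d a n \<eta> =
     {V. (\<forall>j. j \<notin> {1..r+s} \<longrightarrow> V j = 0) \<and>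
         (\<forall>j\<in>{1..r+s}. V j = 0 \<or> degree (V j) < lam r n \<eta> j) \<and>
         (\<forall>t. (\<Sum>j=1..r+s. poly (V j) t * U_row r \<rho> d a j t) = 0)}"

definition r_vec ::
    "nat \<Rightarrow> nat \<Rightarrow> (nat \<Rightarrow> real) \<Rightarrow> (nat \<Rightarrow> real) \<Rightarrow> real \<Rightarrow> nat \<Rightarrow> nat \<Rightarrow> real poly" where
  "r_vec r s \<rho> d a k j =
     (if j \<in> {1..r} then [:2 * d j * \<rho> j powi (int k - 1):]
      else if j \<in> {r+1..r+s} then
        (let m = j - r - 1 in
          (if m = k + 1 then 1 else 0)
          + (if m = k then [:- 2 * a, 2:] else 0)
          + (if m + 1 = k then [:2 * real k:] else 0)
          - (if m < k then [:2 * (\<Sum>h=1..r. d h * \<rho> h ^ (k - m - 1)):] else 0))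
      else 0)"

text \<open>\<open>r_vec\<close> lists the coefficients of the following expression in the rows.\<close>

lemma sum_r_vec:
  fixes r s k :: nat and a t :: real and \<rho> d :: "nat \<Rightarrow> real"
  defines "F \<equiv> F_fun r \<rho> d a"
  assumes "k + 2 \<le> s"
  shows "(\<Sum>j=1..r+s. poly (r_vec r s \<rho> d a k j) t * U_row r \<rho> d a j t) =
    (deriv ^^ (k + 1)) F t + 2 * (t - a) * (deriv ^^ k) F t
    + 2 * real k * (deriv ^^ (k - 1)) F t
    + 2 * (\<Sum>h=1..r. d h * \<rho> h powi (int k - 1) * U_row r \<rho> d a h t)
    - 2 * (\<Sum>h=1..r. d h * (\<Sum>b<k. \<rho> h ^ (k - b - 1) * (deriv ^^ b) F t))"
proof -
  let ?f = "\<lambda>j. poly (r_vec r s \<rho> d a k j) t * U_row r \<rho> d a j t"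
  let ?D = "\<lambda>m. (deriv ^^ m) F t"
  have low: "(\<Sum>j=1..r. ?f j) = 2 * (\<Sum>h=1..r. d h * \<rho> h powi (int k - 1) * U_row r \<rho> d a h t)"
    by (simp add: r_vec_def sum_distrib_left mult_ac)
  have split: "(\<Sum>j=1..r+s. ?f j) = (\<Sum>j=1..r. ?f j) + (\<Sum>j=r+1..r+s. ?f j)"
    by (rule sum.ub_add_nat) simp
  have "(\<Sum>j=r+1..r+s. ?f j) = (\<Sum>m<s. ?f (m + (r + 1)))"
    by (rule sum.reindex_bij_witness[of _ "\<lambda>m. m + (r + 1)" "\<lambda>j. j - (r + 1)"]) auto
  also have "\<dots> = (\<Sum>m<s. (if m = k + 1 then ?D m else 0)
      + (if m = k then 2 * (t - a) * ?D m else 0)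
      + (if m + 1 = k then 2 * real k * ?D m else 0)
      - (if m < k then 2 * (\<Sum>h=1..r. d h * \<rho> h ^ (k - m - 1)) * ?D m else 0))"
    by (rule sum.cong) (auto simp: r_vec_def U_row_def F_def algebra_simps)
  also have "\<dots> = (\<Sum>m<s. if m = k + 1 then ?D m else 0)
      + (\<Sum>m<s. if m = k then 2 * (t - a) * ?D m else 0)
      + (\<Sum>m<s. if m + 1 = k then 2 * real k * ?D m else 0)
      - (\<Sum>m<s. if m < k then 2 * (\<Sum>h=1..r. d h * \<rho> h ^ (k - m - 1)) * ?D m else 0)"
    by (simp only: sum.distrib sum_subtractf)
  also have "(\<Sum>m<s. if m = k + 1 then ?D m else 0) = ?D (k + 1)"
    using assms by (simp add: sum.delta)
  also have "(\<Sum>m<s. if m = k then 2 * (t - a) * ?D m else 0) = 2 * (t - a) * ?D k"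
    using assms by (simp add: sum.delta)
  also have "(\<Sum>m<s. if m + 1 = k then 2 * real k * ?D m else 0) = 2 * real k * ?D (k - 1)"
    using assms by (cases k) (simp_all add: sum.delta)
  also have "(\<Sum>m<s. if m < k then 2 * (\<Sum>h=1..r. d h * \<rho> h ^ (k - m - 1)) * ?D m else 0)
      = (\<Sum>m<k. 2 * (\<Sum>h=1..r. d h * \<rho> h ^ (k - m - 1)) * ?D m)"
    using assms by (intro sum.mono_neutral_cong_right) auto
  also have "\<dots> = 2 * (\<Sum>h=1..r. d h * (\<Sum>b<k. \<rho> h ^ (k - b - 1) * ?D b))"
    by (simp add: sum_distrib_left sum_distrib_right mult_ac) (rule sum.swap)
  finally show ?thesis using low split by simp
qed

definition r_shift ::
    "nat \<Rightarrow> nat \<Rightarrow> (nat \<Rightarrow> real) \<Rightarrow> (nat \<Rightarrow> real) \<Rightarrow> real \<Rightarrow> nat \<Rightarrow> nat \<Rightarrow> nat \<Rightarrow> real poly" where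
  "r_shift r s \<rho> d a k b = (\<lambda>j. monom 1 b * r_vec r s \<rho> d a k j)"

text \<open>The coordinate vector \<open>(v\<^sub>j\<^sub>,\<^sub>k)\<close> determined by \<open>V\<^sub>j = (\<Sum>k. v\<^sub>j\<^sub>,\<^sub>k H\<^sub>k)\<close>.\<close>

definition hermite_coords ::
    "nat \<Rightarrow> nat \<Rightarrow> (nat \<Rightarrow> nat) \<Rightarrow> (nat \<Rightarrow> nat) \<Rightarrow> (nat \<Rightarrow> real poly) \<Rightarrow> real vec" where
  "hermite_coords r s n \<eta> V = vec (lam_total r s n \<eta>)
     (\<lambda>c. case lam_indices r s n \<eta> ! c of (j, k) \<Rightarrow>
        poly_vs.representation (range monic_hermite) (V j) (monic_hermite k))"

end

(*
  The relation k = 0 holds for the Gaussian and is preserved by every operator K: these operators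
  commute, and multiplication by t produces one more factor K_{rho,1}, because K_{rho,1} f is the
  only decaying solution of y' = rho (y - f).  Differentiating it gives the relations r_k.

  The Laplace transform sends t^i U_j to the i-th derivative of Lambda_j, and L' = psi L with psi
  rational, so multiplication by D / L turns a component vector V into a polynomial T V that is
  zero whenever V is a relation.  Subtracting multiples of t^a r_k makes all derivative components
  but the last one constant.  On such vectors T is injective: a top coefficient of a component
  h <= r is seen in the pole order at -rho_h, since the leading coefficient there is a product of
  factors d_h + i > 0, and otherwise the degree at infinity decides.  Hence the t^a r_k span both
  the relations and the kernel of T, and the image of T is found by counting dimensions.
*)

theory Submission
  imports Defs "HOL-Real_Asymp.Real_Asymp"
begin

text \<open>No closed form of the transform \<open>L\<close> is needed: its positivity and the
  equation \<open>L' = \<psi> L\<close> suffice. Likewise, commutation and the rule for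
  multiplication by \<open>t\<close> come from uniqueness for a first-order equation, not from
  interchanging integrals. The obstacle to injectivity is cancellation. At infinity the term
  \<open>t^k\<close> in row \<open>r + l\<close> has size \<open>k + l - 1\<close> up to a common
  shift, so different rows collide, and the relations live on these collisions. In a reduced vector
  one term is strictly dominant, either in its pole order or in its degree. The dimension count
  closes because two numbers agree. A reduced vector has \<open>|n| + (s - 1) + Q\<close> free
  coefficients. On the step-line \<open>k + l - 1 \<le> Q + s - 2\<close>, so all image degrees stay
  below the same number. Subtracting it from \<open>N = |n| + s Q + R0\<close> leaves
  \<open>\<kappa> = (s - 1)(Q - 1) + R0\<close>. The assumption \<open>R > s\<close> gives
  \<open>Q \<ge> 1\<close> and \<open>\<eta> 1 \<ge> 2\<close>. Admissibility then makes every
  \<open>n h\<close> positive, so that all rates are distinct and every constant is allowed in the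
  derivative components.\<close>

section \<open>Differentiation under the integral sign\<close>

text \<open>Along a sequence tending to \<open>x0\<close> the mean value theorem bounds the
  difference quotients by \<open>w\<close>, so dominated convergence applies.\<close>

lemma has_real_derivative_integral:
  fixes f f' :: "real \<Rightarrow> 'a \<Rightarrow> real"
  assumes e: "0 < e"
    and int: "\<And>x. \<bar>x - x0\<bar> < e \<Longrightarrow> integrable M (f x)"
    and der: "\<And>x y. \<bar>x - x0\<bar> < e \<Longrightarrow> ((\<lambda>x. f x y) has_real_derivative f' x y) (at x)"
    and bd: "\<And>x y. \<bar>x - x0\<bar> < e \<Longrightarrow> \<bar>f' x y\<bar> \<le> w y"
    and w: "integrable M w"
    and meas: "f' x0 \<in> borel_measurable M"
  shows "((\<lambda>x. integral\<^sup>L M (f x)) has_real_derivative integral\<^sup>L M (f' x0)) (at x0)"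
  unfolding has_field_derivative_iff tendsto_at_iff_sequentially comp_def
proof (intro allI impI)
  fix X :: "nat \<Rightarrow> real"
  assume X0: "\<forall>i. X i \<in> UNIV - {x0}" and lim: "X \<longlonglongrightarrow> x0"
  from lim have "eventually (\<lambda>i. dist (X i) x0 < e) sequentially"
    using e by (rule tendstoD)
  then obtain m where m: "\<And>i. i \<ge> m \<Longrightarrow> \<bar>X i - x0\<bar> < e"
    by (auto simp: eventually_sequentially dist_real_def)
  \<comment> \<open>Dropping the first \<open>m\<close> terms keeps the whole sequence inside the
    neighbourhood where the bound holds.\<close>
  define Y where "Y i = X (i + m)" for i
  have Y: "\<bar>Y i - x0\<bar> < e" "Y i \<noteq> x0" for i using m X0 by (auto simp: Y_def)
  have Yl: "Y \<longlonglongrightarrow> x0" unfolding Y_def using lim by (rule LIMSEQ_ignore_initial_segment)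
  have "(\<lambda>i. integral\<^sup>L M (\<lambda>y. (f (Y i) y - f x0 y) / (Y i - x0))) \<longlonglongrightarrow> integral\<^sup>L M (f' x0)"
  proof (rule integral_dominated_convergence[where w = w])
    show "(\<lambda>y. (f (Y i) y - f x0 y) / (Y i - x0)) \<in> borel_measurable M" for i
      using borel_measurable_integrable[OF int[OF Y(1)[of i]]]
        borel_measurable_integrable[OF int[of x0]] e by simp
    show "AE y in M. (\<lambda>i. (f (Y i) y - f x0 y) / (Y i - x0)) \<longlonglongrightarrow> f' x0 y"
    proof (rule AE_I2)
      fix y
      have "((\<lambda>x. f x y) has_real_derivative f' x0 y) (at x0)" using der[of x0 y] e by simp
      then show "(\<lambda>i. (f (Y i) y - f x0 y) / (Y i - x0)) \<longlonglongrightarrow> f' x0 y"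
        unfolding has_field_derivative_iff tendsto_at_iff_sequentially comp_def
        using Y Yl by simp
    qed
    show "AE y in M. norm ((f (Y i) y - f x0 y) / (Y i - x0)) \<le> w y" for i
    proof (rule AE_I2)
      fix y
      have B: "z \<in> ball x0 e \<longleftrightarrow> \<bar>z - x0\<bar> < e" for z
        by (simp add: dist_real_def abs_minus_commute)
      have "norm (f (Y i) y - f x0 y) \<le> w y * norm (Y i - x0)"
      proof (rule field_differentiable_bound[where S = "ball x0 e" and f' = "\<lambda>x. f' x y"])
        show "((\<lambda>x. f x y) has_real_derivative f' z y) (at z within ball x0 e)"
          if "z \<in> ball x0 e" for z
          using der[of z y] that B by (simp add: has_field_derivative_at_within)
        show "norm (f' z y) \<le> w y" if "z \<in> ball x0 e" for z
          using bd[of z y] that B by simp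
        show "Y i \<in> ball x0 e" "x0 \<in> ball x0 e"
          using Y(1)[of i] e B by simp_all
      qed simp
      then show "norm ((f (Y i) y - f x0 y) / (Y i - x0)) \<le> w y"
        using Y(2)[of i] by (simp add: divide_simps)
    qed
  qed (use meas w in auto)
  moreover have "integral\<^sup>L M (\<lambda>y. (f (Y i) y - f x0 y) / (Y i - x0))
      = (integral\<^sup>L M (f (Y i)) - integral\<^sup>L M (f x0)) / (Y i - x0)" for i
    using int[OF Y(1)[of i]] int[of x0] e by simp
  ultimately have "(\<lambda>i. (integral\<^sup>L M (f (X (i + m))) - integral\<^sup>L M (f x0)) / (X (i + m) - x0))
      \<longlonglongrightarrow> integral\<^sup>L M (f' x0)" unfolding Y_def by (simp only:)
  then show "(\<lambda>i. (integral\<^sup>L M (f (X i)) - integral\<^sup>L M (f x0)) / (X i - x0))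
      \<longlonglongrightarrow> integral\<^sup>L M (f' x0)"
    by (rule LIMSEQ_offset)
qed

text \<open>Strict positivity is asked for on the positive half-line only, because the Gamma kernels
  vanish elsewhere.\<close>

lemma integral_pos_of_pos_on:
  fixes f :: "real \<Rightarrow> real"
  assumes "integrable lborel f" "\<And>x. 0 \<le> f x" "\<And>x. 0 < x \<Longrightarrow> 0 < f x"
  shows "0 < integral\<^sup>L lborel f"
proof -
  have "integral\<^sup>L lborel f \<noteq> 0"
  proof
    assume "integral\<^sup>L lborel f = 0"
    then have "AE x in lborel. f x = 0"
      using integral_nonneg_eq_0_iff_AE[OF assms(1)] assms(2) by simp
    then have "AE x in lborel. x \<notin> {0<..<1::real}"
      by eventually_elim (use assms(3) in force)
    then have "emeasure lborel {0<..<1::real} = 0"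
      by (subst (asm) AE_iff_measurable[where N = "{0<..<1}"]) auto
    then show False by simp
  qed
  moreover have "0 \<le> integral\<^sup>L lborel f" using assms(2) by simp
  ultimately show ?thesis by linarith
qed

section \<open>Exponentially bounded functions\<close>

text \<open>This says that \<open>exp (z * t) * f t\<close> is bounded for each \<open>z\<close> in
  \<open>S\<close>. When \<open>S\<close> is open, neighbouring values of \<open>z\<close> upgrade
  boundedness to exponential decay in both directions, hence to convergence of the Laplace integral
  on \<open>S\<close>.\<close>

definition exp_bounded :: "real set \<Rightarrow> (real \<Rightarrow> real) \<Rightarrow> bool" where
  "exp_bounded S f \<longleftrightarrow> continuous_on UNIV f \<and> (\<forall>z\<in>S. \<exists>c. \<forall>t. \<bar>f t\<bar> \<le> c * exp (- z * t))"

lemma exp_boundedD: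
  assumes "exp_bounded S f" "z \<in> S"
  obtains c where "0 \<le> c" "\<And>t. \<bar>f t\<bar> \<le> c * exp (- z * t)"
proof -
  from assms obtain c where c: "\<And>t. \<bar>f t\<bar> \<le> c * exp (- z * t)"
    unfolding exp_bounded_def by blast
  have "0 \<le> c" using c[of 0] by simp
  with c show ?thesis using that by blast
qed

lemma exp_bounded_measurable [measurable_dest]:
  "exp_bounded S f \<Longrightarrow> f \<in> borel_measurable borel"
  unfolding exp_bounded_def by (auto intro: borel_measurable_continuous_onI)

lemma exp_bounded_add:
  assumes "exp_bounded S f" "exp_bounded S g"
  shows "exp_bounded S (\<lambda>t. f t + g t)"
  unfolding exp_bounded_def
proof (intro conjI ballI)
  fix z assume z: "z \<in> S"
  obtain c where c: "\<And>t. \<bar>f t\<bar> \<le> c * exp (- z * t)" using exp_boundedD[OF assms(1) z] by metis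
  obtain c' where c': "\<And>t. \<bar>g t\<bar> \<le> c' * exp (- z * t)" using exp_boundedD[OF assms(2) z] by metis
  have "\<bar>f t + g t\<bar> \<le> (c + c') * exp (- z * t)" for t
    using c[of t] c'[of t] by (simp add: algebra_simps)
  then show "\<exists>c. \<forall>t. \<bar>f t + g t\<bar> \<le> c * exp (- z * t)" by blast
qed (use assms in \<open>auto simp: exp_bounded_def intro!: continuous_intros\<close>)

lemma exp_bounded_mult_left:
  assumes "exp_bounded S f" shows "exp_bounded S (\<lambda>t. a * f t)"
  unfolding exp_bounded_def
proof (intro conjI ballI)
  fix z assume z: "z \<in> S"
  obtain c where c: "\<And>t. \<bar>f t\<bar> \<le> c * exp (- z * t)" using exp_boundedD[OF assms(1) z] by metis
  have "\<bar>a * f t\<bar> \<le> (\<bar>a\<bar> * c) * exp (- z * t)" for t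
    using mult_left_mono[OF c[of t], of "\<bar>a\<bar>"] by (simp add: abs_mult mult_ac)
  then show "\<exists>c. \<forall>t. \<bar>a * f t\<bar> \<le> c * exp (- z * t)" by blast
qed (use assms in \<open>auto simp: exp_bounded_def intro!: continuous_intros\<close>)

lemma exp_bounded_0: "exp_bounded S (\<lambda>_. 0)"
  unfolding exp_bounded_def by (auto intro!: exI[of _ 0])

lemma exp_bounded_sum:
  "(\<And>i. i \<in> I \<Longrightarrow> exp_bounded S (f i)) \<Longrightarrow> exp_bounded S (\<lambda>t. \<Sum>i\<in>I. f i t)"
  by (induction I rule: infinite_finite_induct) (auto intro: exp_bounded_add exp_bounded_0)

text \<open>The bound at \<open>z + e\<close> is used for \<open>t \<ge> 0\<close> and the bound at
  \<open>z - e\<close> for \<open>t < 0\<close>.\<close>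

lemma exp_bounded_two_sided:
  assumes "exp_bounded S f" "open S" "z \<in> S"
  obtains c e where "0 \<le> c" "0 < e" "\<And>t. \<bar>f t\<bar> \<le> c * exp (- z * t - e * \<bar>t\<bar>)"
proof -
  obtain e' where e': "e' > 0" "ball z e' \<subseteq> S" using assms(2,3) open_contains_ball by blast
  define e where "e = e' / 2"
  have e: "e > 0" "z + e \<in> S" "z - e \<in> S" using e' by (auto simp: e_def dist_real_def subset_iff)
  obtain c where c: "0 \<le> c" "\<And>t. \<bar>f t\<bar> \<le> c * exp (- (z + e) * t)" using exp_boundedD[OF assms(1) e(2)] by metis
  obtain c' where c': "0 \<le> c'" "\<And>t. \<bar>f t\<bar> \<le> c' * exp (- (z - e) * t)" using exp_boundedD[OF assms(1) e(3)] by metis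
  have "\<bar>f t\<bar> \<le> (c + c') * exp (- z * t - e * \<bar>t\<bar>)" for t
  proof (cases "t \<ge> 0")
    case True
    have "\<bar>f t\<bar> \<le> c * exp (- z * t - e * \<bar>t\<bar>)" using c(2)[of t] True
      by (simp add: ring_distribs)
    then show ?thesis using mult_nonneg_nonneg[OF c'(1) exp_ge_zero[of "- z * t - e * \<bar>t\<bar>"]]
      unfolding distrib_right by linarith
  next
    case False
    have "\<bar>f t\<bar> \<le> c' * exp (- z * t - e * \<bar>t\<bar>)" using c'(2)[of t] False
      by (simp add: ring_distribs)
    then show ?thesis using mult_nonneg_nonneg[OF c(1) exp_ge_zero[of "- z * t - e * \<bar>t\<bar>"]]
      unfolding distrib_right by linarith
  qed
  then show ?thesis using that[of "c + c'" e] c c' e by simp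
qed

text \<open>The factor \<open>\<bar>t\<bar>\<close> is absorbed by the spare decay
  \<open>exp (- e * \<bar>t\<bar>)\<close>.\<close>

lemma exp_bounded_mult_self:
  assumes "exp_bounded S f" "open S"
  shows "exp_bounded S (\<lambda>t. t * f t)"
  unfolding exp_bounded_def
proof (intro conjI ballI)
  fix z assume z: "z \<in> S"
  obtain c e where c: "0 \<le> c" "0 < e" "\<And>t. \<bar>f t\<bar> \<le> c * exp (- z * t - e * \<bar>t\<bar>)"
    using exp_bounded_two_sided[OF assms z] by metis
  have "\<bar>t * f t\<bar> \<le> (c / e) * exp (- z * t)" for t
  proof -
    have "e * \<bar>t\<bar> \<le> exp (e * \<bar>t\<bar>)" using exp_ge_add_one_self[of "e * \<bar>t\<bar>"] by linarith
    then have t: "\<bar>t\<bar> \<le> exp (e * \<bar>t\<bar>) / e" using c(2) by (simp add: field_simps)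
    have "\<bar>t * f t\<bar> \<le> (exp (e * \<bar>t\<bar>) / e) * (c * exp (- z * t - e * \<bar>t\<bar>))"
      unfolding abs_mult using t c by (intro mult_mono) auto
    also have "\<dots> = (c / e) * exp (- z * t)"
      by (simp add: field_simps flip: exp_add)
    finally show ?thesis .
  qed
  then show "\<exists>c. \<forall>t. \<bar>t * f t\<bar> \<le> c * exp (- z * t)" by blast
qed (use assms in \<open>auto simp: exp_bounded_def intro!: continuous_intros\<close>)

lemma exp_bounded_power_mult:
  "exp_bounded S f \<Longrightarrow> open S \<Longrightarrow> exp_bounded S (\<lambda>t. t ^ i * f t)"
proof (induction i)
  case (Suc i)
  then show ?case using exp_bounded_mult_self[of S "\<lambda>t. t ^ i * f t"] by (simp add: mult.assoc)
qed simp

text \<open>A function comes with its whole sequence of derivatives as explicit data. An operator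
  that commutes with differentiation then acts on the sequence entrywise, and differentiability of
  the result is part of the conclusion.\<close>

definition decaying :: "real set \<Rightarrow> (nat \<Rightarrow> real \<Rightarrow> real) \<Rightarrow> bool" where
  "decaying S g \<longleftrightarrow> (\<forall>k. exp_bounded S (g k)) \<and>
     (\<forall>k t. (g k has_real_derivative g (Suc k) t) (at t))"

lemma decaying_exp_bounded: "decaying S g \<Longrightarrow> exp_bounded S (g k)"
  by (simp add: decaying_def)

lemma decaying_deriv: "decaying S g \<Longrightarrow> (g k has_real_derivative g (Suc k) t) (at t)"
  by (simp add: decaying_def)

lemma decaying_higher_deriv:
  assumes "decaying S g" shows "(deriv ^^ k) (g m) = g (m + k)"
proof (induction k)
  case (Suc k)
  have "deriv (g (m + k)) = g (Suc (m + k))"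
    using decaying_deriv[OF assms] by (auto intro!: ext DERIV_imp_deriv)
  with Suc show ?case by simp
qed simp

lemma decayingI:
  assumes "\<And>k t. (g k has_real_derivative g (Suc k) t) (at t)"
    and "\<And>k z. z \<in> S \<Longrightarrow> \<exists>c. \<forall>t. \<bar>g k t\<bar> \<le> c * exp (- z * t)"
  shows "decaying S g"
proof -
  have "continuous_on UNIV (g k)" for k
    using assms(1)[of k] by (auto intro!: continuous_at_imp_continuous_on DERIV_isCont)
  with assms show ?thesis by (auto simp: decaying_def exp_bounded_def)
qed

lemma decaying_add:
  assumes "decaying S f" "decaying S g" shows "decaying S (\<lambda>k t. f k t + g k t)"
  using assms by (simp add: decaying_def exp_bounded_add DERIV_add)

lemma decaying_mult_left:
  assumes "decaying S f" shows "decaying S (\<lambda>k t. a * f k t)"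
  using assms by (simp add: decaying_def exp_bounded_mult_left DERIV_cmult)

section \<open>The Gaussian\<close>

lemma abs_poly_le_exp: "\<exists>c. \<forall>x::real. \<bar>poly p x\<bar> \<le> c * exp \<bar>x\<bar>"
proof (intro exI allI)
  fix x :: real
  \<comment> \<open>Up to the factor \<open>fact i\<close>, the left-hand side is a single term of
    the exponential series of \<open>\<bar>x\<bar>\<close>.\<close>
  have *: "\<bar>x\<bar> ^ i \<le> fact i * exp \<bar>x\<bar>" for i
  proof -
    have "(\<lambda>n. \<bar>x\<bar> ^ n / fact n) sums exp \<bar>x\<bar>"
      using exp_converges[of "\<bar>x\<bar>"] by (simp add: divide_inverse_commute)
    then have "(\<Sum>n\<in>{i}. \<bar>x\<bar> ^ n / fact n) \<le> exp \<bar>x\<bar>"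
      by (metis (no_types, lifting) finite.emptyI finite.insertI sum_le_suminf sums_iff
          abs_ge_zero divide_nonneg_nonneg fact_ge_zero zero_le_power)
    then show ?thesis by (simp add: field_simps)
  qed
  have "\<bar>poly p x\<bar> = \<bar>\<Sum>i\<le>degree p. coeff p i * x ^ i\<bar>" by (simp add: poly_altdef)
  also have "\<dots> \<le> (\<Sum>i\<le>degree p. \<bar>coeff p i\<bar> * (fact i * exp \<bar>x\<bar>))"
    by (rule order_trans[OF sum_abs])
      (auto intro!: sum_mono mult_left_mono * simp: abs_mult power_abs)
  also have "\<dots> = (\<Sum>i\<le>degree p. \<bar>coeff p i\<bar> * fact i) * exp \<bar>x\<bar>"
    by (simp add: sum_distrib_left mult_ac)
  finally show "\<bar>poly p x\<bar> \<le> (\<Sum>i\<le>degree p. \<bar>coeff p i\<bar> * fact i) * exp \<bar>x\<bar>" .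
qed

lemma has_real_derivative_gauss:
  "(gauss a has_real_derivative - 2 * (t - a) * gauss a t) (at t)"
  unfolding gauss_def[abs_def]
  by (rule DERIV_cdivide[THEN DERIV_cong, where D1 = "- 2 * (t - a) * exp (- (t - a)\<^sup>2)"])
    (auto intro!: derivative_eq_intros)

lemma gauss_decaying: "\<exists>g. g 0 = gauss a \<and> decaying S g"
proof (intro exI conjI)
  \<comment> \<open>In the variable \<open>x = t - a\<close>, differentiating
    \<open>p(x) exp (- x^2)\<close> replaces \<open>p\<close> by \<open>p' - 2 x p\<close>. Up to
    sign these are the physicists' Hermite polynomials.\<close>
  define P where "P = (\<lambda>k::nat. ((\<lambda>p. pderiv p - [:0, 2:] * p) ^^ k) (1 :: real poly))"
  define g where "g = (\<lambda>(k::nat) t. poly (P k) (t - a) * gauss a t)"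
  show "g 0 = gauss a" by (simp add: g_def P_def)
  show "decaying S g"
  proof (rule decayingI)
    fix k t
    have "P (Suc k) = pderiv (P k) - [:0, 2:] * P k" by (simp add: P_def)
    then have P: "poly (P (Suc k)) x = poly (pderiv (P k)) x - 2 * x * poly (P k) x" for x
      by (simp add: mult_ac)
    have 1: "((\<lambda>t. poly (P k) (t - a)) has_real_derivative poly (pderiv (P k)) (t - a)) (at t)"
      by (rule DERIV_chain2[OF poly_DERIV, THEN DERIV_cong]) (auto intro!: derivative_eq_intros)
    show "(g k has_real_derivative g (Suc k) t) (at t)"
      using DERIV_mult[OF 1 has_real_derivative_gauss] by (simp add: g_def P algebra_simps)
  next
    fix k and z :: real
    obtain c where c: "\<And>x. \<bar>poly (P k) x\<bar> \<le> c * exp \<bar>x\<bar>" using abs_poly_le_exp by blast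
    have c0: "0 \<le> c" using c[of 0] by simp
    \<comment> \<open>The summand 1 pays for the growth \<open>exp \<bar>x\<bar>\<close> of the
      polynomial, and \<open>\<bar>z\<bar>\<close> pays for \<open>exp (z * x)\<close>. Completing
      the square gives \<open>b * \<bar>x\<bar> - x^2 \<le> b^2 / 4\<close>.\<close>
    define b where "b = 1 + \<bar>z\<bar>"
    have "\<bar>g k t\<bar> \<le> c / sqrt pi * exp (b\<^sup>2 / 4 + z * a) * exp (- z * t)" for t
    proof -
      define x where "x = t - a"
      have "0 \<le> (\<bar>x\<bar> - b / 2)\<^sup>2" by simp
      then have "b * \<bar>x\<bar> - x\<^sup>2 \<le> b\<^sup>2 / 4" by (simp add: power2_diff power_divide field_simps)
      moreover have "z * x \<le> \<bar>z\<bar> * \<bar>x\<bar>" by (metis abs_ge_self abs_mult)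
      ultimately have "\<bar>x\<bar> - x\<^sup>2 \<le> b\<^sup>2 / 4 - z * x" by (simp add: b_def algebra_simps)
      then have E: "exp (\<bar>x\<bar> - x\<^sup>2) \<le> exp (b\<^sup>2 / 4 - z * x)" by simp
      have "\<bar>g k t\<bar> \<le> (c * exp \<bar>x\<bar>) * (exp (- x\<^sup>2) / sqrt pi)"
        unfolding g_def gauss_def x_def[symmetric] abs_mult
        using c by (intro mult_mono) (auto simp: c0)
      also have "\<dots> = c / sqrt pi * exp (\<bar>x\<bar> - x\<^sup>2)"
        by (simp add: exp_diff exp_minus field_simps)
      also have "\<dots> \<le> c / sqrt pi * exp (b\<^sup>2 / 4 - z * x)" using E c0 by (intro mult_left_mono) auto
      also have "b\<^sup>2 / 4 - z * x = (b\<^sup>2 / 4 + z * a) + - z * t" by (simp add: x_def algebra_simps)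
      finally show "\<bar>g k t\<bar> \<le> c / sqrt pi * exp (b\<^sup>2 / 4 + z * a) * exp (- z * t)"
        by (simp only: exp_add mult.assoc)
    qed
    then show "\<exists>c. \<forall>t. \<bar>g k t\<bar> \<le> c * exp (- z * t)" by blast
  qed
qed

section \<open>The Gamma kernel operators\<close>

text \<open>A Gamma density of shape \<open>p + 1\<close> without its normalising constant:
  multiplication by \<open>u\<close> and differentiation then merely shift \<open>p\<close>.\<close>

definition gamma_kernel :: "real \<Rightarrow> real \<Rightarrow> real \<Rightarrow> real" where
  "gamma_kernel \<rho> p u = indicator {0<..} u * (u powr p * exp (- \<rho> * u))"

definition gamma_conv :: "real \<Rightarrow> real \<Rightarrow> (real \<Rightarrow> real) \<Rightarrow> real \<Rightarrow> real" where
  "gamma_conv \<rho> p f t = (LBINT u. gamma_kernel \<rho> p u * f (t + u))"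

lemma K_op_eq_gamma_conv:
  "K_op \<rho> d f = (if d = 0 then f else (\<lambda>t. \<rho> powr d / Gamma d * gamma_conv \<rho> (d - 1) f t))"
  unfolding K_op_def gamma_conv_def gamma_kernel_def set_lebesgue_integral_def
  by (auto simp: fun_eq_iff mult_ac simp flip: integral_mult_right_zero)

lemma gamma_kernel_measurable [measurable]: "gamma_kernel \<rho> p \<in> borel_measurable borel"
  unfolding gamma_kernel_def by measurable

lemma gamma_kernel_nonneg: "0 \<le> gamma_kernel \<rho> p u"
  by (simp add: gamma_kernel_def)

lemma gamma_kernel_mult_exp: "gamma_kernel \<rho> p u * exp (- z * u) = gamma_kernel (\<rho> + z) p u"
  by (simp add: gamma_kernel_def ring_distribs exp_add exp_diff exp_minus field_simps)

lemma gamma_kernel_mult_self: "u * gamma_kernel \<rho> p u = gamma_kernel \<rho> (p + 1) u"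
  by (cases "u > 0") (simp_all add: gamma_kernel_def powr_add)

text \<open>Rate 1 is the Gamma integral; a general rate follows by scaling the variable.\<close>

lemma integrable_gamma_kernel:
  assumes "0 < \<rho>" "- 1 < p" shows "integrable lborel (gamma_kernel \<rho> p)"
proof -
  have "integrable lborel (gamma_kernel 1 p)"
  proof (rule integrableI_nonneg)
    have "(\<integral>\<^sup>+u. ennreal (gamma_kernel 1 p u) \<partial>lborel)
        = (\<integral>\<^sup>+t. ennreal (indicator {0..} t * t powr (p + 1 - 1) / exp t) \<partial>lborel)"
      by (rule nn_integral_cong)
        (auto simp: gamma_kernel_def exp_minus field_simps indicator_def)
    also have "\<dots> = ennreal (Gamma (p + 1))"
      using Gamma_conv_nn_integral_real[of "p + 1"] assms by simp
    finally show "(\<integral>\<^sup>+u. ennreal (gamma_kernel 1 p u) \<partial>lborel) < \<infinity>" by simp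
  qed (auto simp: gamma_kernel_nonneg)
  from lborel_integrable_real_affine[OF this, of \<rho> 0] assms
  have "integrable lborel (\<lambda>u. \<rho> powr - p * gamma_kernel 1 p (\<rho> * u))" by simp
  also have "(\<lambda>u. \<rho> powr - p * gamma_kernel 1 p (\<rho> * u)) = gamma_kernel \<rho> p"
    using assms
    by (auto simp: fun_eq_iff gamma_kernel_def indicator_def zero_less_mult_iff powr_mult
        powr_minus)
  finally show ?thesis .
qed

text \<open>The factor \<open>exp (- z * (t + u))\<close> splits, and its \<open>u\<close> part
  moves the rate of the kernel from \<open>\<rho>\<close> to \<open>\<rho> + z\<close>. This is why
  \<open>\<rho> + z > 0\<close> is the convergence condition everywhere below.\<close>

lemma gamma_conv_bound:
  assumes "\<And>t. \<bar>f t\<bar> \<le> c * exp (- z * t)"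
  shows "\<bar>gamma_kernel \<rho> p u * f (t + u)\<bar> \<le> c * exp (- z * t) * gamma_kernel (\<rho> + z) p u"
proof -
  have "\<bar>gamma_kernel \<rho> p u * f (t + u)\<bar> \<le> gamma_kernel \<rho> p u * (c * exp (- z * (t + u)))"
    unfolding abs_mult using assms gamma_kernel_nonneg by (simp add: mult_left_mono)
  also have "\<dots> = c * exp (- z * t) * (gamma_kernel \<rho> p u * exp (- z * u))"
    by (simp add: ring_distribs exp_add mult_ac exp_diff exp_minus field_simps)
  finally show ?thesis by (simp only: gamma_kernel_mult_exp)
qed

locale rate_domain =
  fixes S :: "real set"
  assumes open_S: "open S" and S_nonempty: "S \<noteq> {}"
begin

lemma integrable_gamma_conv:
  assumes "exp_bounded S f" "\<And>z. z \<in> S \<Longrightarrow> 0 < \<rho> + z" "- 1 < p"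
  shows "integrable lborel (\<lambda>u. gamma_kernel \<rho> p u * f (t + u))"
proof -
  obtain z where z: "z \<in> S" using S_nonempty by blast
  obtain c where c: "\<And>t. \<bar>f t\<bar> \<le> c * exp (- z * t)" using exp_boundedD[OF assms(1) z] by metis
  have [measurable]: "f \<in> borel_measurable borel" using assms(1) by (rule exp_bounded_measurable)
  show ?thesis
  proof (rule Bochner_Integration.integrable_bound)
    show "integrable lborel (\<lambda>u. c * exp (- z * t) * gamma_kernel (\<rho> + z) p u)"
      using integrable_gamma_kernel[of "\<rho> + z" p] assms z by simp
    show "AE u in lborel. norm (gamma_kernel \<rho> p u * f (t + u))
        \<le> norm (c * exp (- z * t) * gamma_kernel (\<rho> + z) p u)"
    proof (rule AE_I2)
      fix u
      show "norm (gamma_kernel \<rho> p u * f (t + u)) \<le> norm (c * exp (- z * t) * gamma_kernel (\<rho> + z) p u)"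
        using gamma_conv_bound[OF c, of \<rho> p u t] unfolding real_norm_def by linarith
    qed
  qed simp
qed

lemma gamma_conv_add:
  assumes "exp_bounded S f" "exp_bounded S g" "\<And>z. z \<in> S \<Longrightarrow> 0 < \<rho> + z" "- 1 < p"
  shows "gamma_conv \<rho> p (\<lambda>t. f t + g t) t = gamma_conv \<rho> p f t + gamma_conv \<rho> p g t"
  unfolding gamma_conv_def
  using integrable_gamma_conv[OF assms(1,3,4)] integrable_gamma_conv[OF assms(2,3,4)]
  by (simp add: ring_distribs)

lemma gamma_conv_mult_left: "gamma_conv \<rho> p (\<lambda>t. a * f t) t = a * gamma_conv \<rho> p f t"
  unfolding gamma_conv_def by (simp add: mult.left_commute)

text \<open>Write \<open>t + u - a = (t - a) + u\<close>; the extra \<open>u\<close> raises the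
  exponent of the kernel.\<close>

lemma gamma_conv_mult_self:
  assumes f: "exp_bounded S f" and \<rho>: "\<And>z. z \<in> S \<Longrightarrow> 0 < \<rho> + z" and p: "- 1 < p"
  shows "gamma_conv \<rho> p (\<lambda>t. (t - a) * f t) t = (t - a) * gamma_conv \<rho> p f t + gamma_conv \<rho> (p + 1) f t"
proof -
  have "gamma_kernel \<rho> p u * ((t + u - a) * f (t + u))
      = (t - a) * (gamma_kernel \<rho> p u * f (t + u)) + gamma_kernel \<rho> (p + 1) u * f (t + u)" for u
    unfolding gamma_kernel_mult_self[symmetric] by (simp add: algebra_simps)
  then show ?thesis
    unfolding gamma_conv_def
    using integrable_gamma_conv[OF f \<rho> p] integrable_gamma_conv[OF f \<rho>, of "p + 1"] p by simp
qed

lemma gamma_conv_decaying: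
  assumes g: "decaying S g" and \<rho>: "\<And>z. z \<in> S \<Longrightarrow> 0 < \<rho> + z" and p: "- 1 < p"
  shows "decaying S (\<lambda>k. gamma_conv \<rho> p (g k))"
proof (rule decayingI)
  fix k z assume z: "z \<in> S"
  obtain c where c: "\<And>t. \<bar>g k t\<bar> \<le> c * exp (- z * t)"
    using exp_boundedD[OF decaying_exp_bounded[OF g] z] by metis
  have "\<bar>gamma_conv \<rho> p (g k) t\<bar> \<le> c * (LBINT u. gamma_kernel (\<rho> + z) p u) * exp (- z * t)" for t
  proof -
    have "\<bar>gamma_conv \<rho> p (g k) t\<bar> \<le> (LBINT u. \<bar>gamma_kernel \<rho> p u * g k (t + u)\<bar>)"
      unfolding gamma_conv_def by (rule integral_abs_bound)
    also have "\<dots> \<le> (LBINT u. c * exp (- z * t) * gamma_kernel (\<rho> + z) p u)"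
      using integrable_gamma_conv[OF decaying_exp_bounded[OF g] \<rho> p]
        integrable_gamma_kernel[of "\<rho> + z" p] \<rho>[OF z] p gamma_conv_bound[OF c]
      by (intro integral_mono) simp_all
    finally show ?thesis by (simp add: mult_ac)
  qed
  then show "\<exists>c. \<forall>t. \<bar>gamma_conv \<rho> p (g k) t\<bar> \<le> c * exp (- z * t)" by blast
next
  fix k t0
  obtain z where z: "z \<in> S" using S_nonempty by blast
  obtain c where c0: "0 \<le> c" and c: "\<And>t. \<bar>g (Suc k) t\<bar> \<le> c * exp (- z * t)"
    using exp_boundedD[OF decaying_exp_bounded[OF g] z] by metis
  have [measurable]: "g k \<in> borel_measurable borel" for k
    using decaying_exp_bounded[OF g] by (rule exp_bounded_measurable)
  show "(gamma_conv \<rho> p (g k) has_real_derivative gamma_conv \<rho> p (g (Suc k)) t0) (at t0)"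
    unfolding gamma_conv_def[abs_def]
  \<comment> \<open>For \<open>\<bar>x - t0\<bar> < 1\<close> the factor
    \<open>exp (- z * x)\<close> is at most \<open>exp (\<bar>z\<bar> - z * t0)\<close>, which makes
    the dominating function independent of \<open>x\<close>.\<close>
  proof (rule has_real_derivative_integral[of 1 _ _ _ "\<lambda>t u. gamma_kernel \<rho> p u * g (Suc k) (t + u)"
        "\<lambda>u. c * exp (\<bar>z\<bar> - z * t0) * gamma_kernel (\<rho> + z) p u"])
    show "integrable lborel (\<lambda>u. gamma_kernel \<rho> p u * g k (x + u))" for x
      by (rule integrable_gamma_conv[OF decaying_exp_bounded[OF g] \<rho> p])
    show "integrable lborel (\<lambda>u. c * exp (\<bar>z\<bar> - z * t0) * gamma_kernel (\<rho> + z) p u)"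
      using integrable_gamma_kernel[of "\<rho> + z" p] \<rho>[OF z] p by simp
    show "((\<lambda>x. gamma_kernel \<rho> p u * g k (x + u)) has_real_derivative
        gamma_kernel \<rho> p u * g (Suc k) (x + u)) (at x)" for x u
      by (rule DERIV_cmult, rule DERIV_chain2[OF decaying_deriv[OF g], THEN DERIV_cong])
        (auto intro!: derivative_eq_intros)
    show "\<bar>gamma_kernel \<rho> p u * g (Suc k) (x + u)\<bar>
        \<le> c * exp (\<bar>z\<bar> - z * t0) * gamma_kernel (\<rho> + z) p u" if "\<bar>x - t0\<bar> < 1" for x u
    proof -
      have "- z * (x - t0) \<le> \<bar>z\<bar>"
        using that abs_ge_self[of "- z * (x - t0)"] mult_left_le[of "\<bar>x - t0\<bar>" "\<bar>z\<bar>"]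
        by (simp add: abs_mult)
      then have "exp (- z * x) \<le> exp (\<bar>z\<bar> - z * t0)" by (simp add: ring_distribs)
      then have "c * exp (- z * x) * gamma_kernel (\<rho> + z) p u
          \<le> c * exp (\<bar>z\<bar> - z * t0) * gamma_kernel (\<rho> + z) p u"
        using c0 gamma_kernel_nonneg by (intro mult_right_mono mult_left_mono) auto
      with gamma_conv_bound[OF c, of \<rho> p u x] show ?thesis by linarith
    qed
  qed simp_all
qed

text \<open>Integration by parts. The boundary term at \<open>u = 0\<close> survives only for
  \<open>p = 0\<close>; for \<open>p > 0\<close> the power \<open>u powr p\<close> vanishes there
  and its derivative contributes the kernel of exponent \<open>p - 1\<close> instead.\<close>

lemma gamma_conv_deriv:
  assumes g: "decaying S g" and \<rho>: "\<And>z. z \<in> S \<Longrightarrow> 0 < \<rho> + z" and p: "0 \<le> p"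
  shows "gamma_conv \<rho> p (g (Suc k)) t = \<rho> * gamma_conv \<rho> p (g k) t
    - (if p = 0 then g k t else p * gamma_conv \<rho> (p - 1) (g k) t)"
proof -
  obtain z where z: "z \<in> S" using S_nonempty by blast
  obtain c where c0: "0 \<le> c" and c: "\<And>t. \<bar>g k t\<bar> \<le> c * exp (- z * t)"
    using exp_boundedD[OF decaying_exp_bounded[OF g] z] by metis
  define h where "h u = u powr p * exp (- \<rho> * u) * g k (t + u)" for u
  define h' where "h' u = u powr p * exp (- \<rho> * u) * g (Suc k) (t + u)
    - \<rho> * (u powr p * exp (- \<rho> * u) * g k (t + u))
    + p * (u powr (p - 1) * exp (- \<rho> * u) * g k (t + u))" for u
  have gd: "((\<lambda>u. g m (t + u)) has_real_derivative g (Suc m) (t + u)) (at u)" for m u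
    by (rule DERIV_chain2[OF decaying_deriv[OF g], THEN DERIV_cong])
        (auto intro!: derivative_eq_intros)
  have gc: "isCont (\<lambda>u. g m (t + u)) u" for m u
    using gd by (rule DERIV_isCont)
  have wd: "((\<lambda>u. u powr p * exp (- \<rho> * u)) has_real_derivative
      p * (u powr (p - 1) * exp (- \<rho> * u)) - \<rho> * (u powr p * exp (- \<rho> * u))) (at u)"
    if "0 < u" for u
    using that by (auto intro!: derivative_eq_intros simp: algebra_simps)
  have hd: "(h has_real_derivative h' u) (at u)" if "0 < u" for u
    unfolding h_def[abs_def] h'_def
    by (rule DERIV_mult[OF wd[OF that] gd, THEN DERIV_cong]) (simp add: algebra_simps)
  have hc: "isCont h' u" if "0 < u" for u
    unfolding h'_def[abs_def] using that by (intro continuous_intros gc) auto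
  have int: "integrable lborel (\<lambda>u. gamma_kernel \<rho> q u * g m (t + u))" if "- 1 < q" for q m
    by (rule integrable_gamma_conv[OF decaying_exp_bounded[OF g] \<rho> that])
  \<comment> \<open>The factor \<open>p\<close> stays inside: for \<open>p = 0\<close> the kernel of
    exponent \<open>-1\<close> is not integrable, but it is multiplied by zero.\<close>
  have int': "integrable lborel (\<lambda>u. p * (gamma_kernel \<rho> (p - 1) u * g k (t + u)))"
    using int[of "p - 1" k] p by (cases "p = 0") auto
  have h'_eq: "indicator {0<..} u * h' u = gamma_kernel \<rho> p u * g (Suc k) (t + u)
      - \<rho> * (gamma_kernel \<rho> p u * g k (t + u)) + p * (gamma_kernel \<rho> (p - 1) u * g k (t + u))" for u
    by (simp add: gamma_kernel_def h'_def algebra_simps)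
  have "(LBINT u=ereal 0..\<infinity>. h' u) = 0 - (if p = 0 then g k t else 0)"
  proof (rule interval_integral_FTC_integrable)
    show "set_integrable lborel (einterval (ereal 0) \<infinity>) h'"
      using int[of p "Suc k"] int[of p k] int' p by (simp add: set_integrable_def h'_eq)
    show "((h \<circ> real_of_ereal) \<longlongrightarrow> (if p = 0 then g k t else 0)) (at_right (ereal 0))"
    proof -
      have "((\<lambda>u. u powr p) \<longlongrightarrow> (if p = 0 then 1 else 0)) (at_right 0)"
      proof (cases "p = 0")
        case True
        have "eventually (\<lambda>u::real. 1 = u powr p) (at_right 0)"
          by (rule eventually_at_rightI[of 0 1]) (simp_all add: True)
        then show ?thesis using True by (simp add: tendsto_eventually eventually_mono)
      next
        case False
        with p have "p > 0" by simp
        then show ?thesis using False by real_asymp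
      qed
      moreover have "((\<lambda>u. exp (- \<rho> * u) * g k (t + u)) \<longlongrightarrow> exp (- \<rho> * 0) * g k (t + 0)) (at 0)"
        using gc[where u = 0, unfolded isCont_def] by (intro tendsto_intros)
      then have "((\<lambda>u. exp (- \<rho> * u) * g k (t + u)) \<longlongrightarrow> g k t) (at_right 0)"
        by (auto intro: tendsto_within_subset)
      ultimately have "((\<lambda>u. u powr p * (exp (- \<rho> * u) * g k (t + u)))
          \<longlongrightarrow> (if p = 0 then 1 else 0) * g k t) (at_right 0)"
        by (rule tendsto_mult)
      then have "(h \<longlongrightarrow> (if p = 0 then g k t else 0)) (at_right 0)"
        by (simp add: h_def[abs_def] mult.assoc if_distrib[of "\<lambda>x. x * g k t"] cong: if_cong)
      then show ?thesis by (simp add: ereal_tendsto_simps1)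
    qed
    show "((h \<circ> real_of_ereal) \<longlongrightarrow> 0) (at_left \<infinity>)"
    proof -
      have b: "\<rho> + z > 0" using \<rho>[OF z] .
      have "((\<lambda>u. c * exp (- z * t) * (u powr p * exp (- (\<rho> + z) * u))) \<longlongrightarrow> 0) at_top"
        using b by real_asymp
      moreover have "eventually (\<lambda>u. norm (h u) \<le> c * exp (- z * t) * (u powr p * exp (- (\<rho> + z) * u))) at_top"
      proof (rule eventually_at_top_linorderI)
        fix u :: real assume "u \<ge> 1"
        then show "norm (h u) \<le> c * exp (- z * t) * (u powr p * exp (- (\<rho> + z) * u))"
          using gamma_conv_bound[OF c, of \<rho> p u t] by (simp add: gamma_kernel_def h_def)
      qed
      ultimately have "(h \<longlongrightarrow> 0) at_top" by (rule Lim_null_comparison[rotated])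
      then show ?thesis by (simp add: ereal_tendsto_simps1)
    qed
  qed (use hd hc in \<open>auto simp: has_real_derivative_iff_has_vector_derivative[symmetric]\<close>)
  then have "(LBINT u. indicator {0<..} u * h' u) = - (if p = 0 then g k t else 0)"
    by (simp add: interval_lebesgue_integral_def set_lebesgue_integral_def)
  then show ?thesis
    unfolding h'_eq gamma_conv_def using int[of p "Suc k"] int[of p k] int' p
    by (simp split: if_splits)
qed

end

section \<open>Algebra of the normalised operators \<open>K_op\<close>\<close>

context rate_domain
begin

lemma K_op_add:
  assumes "exp_bounded S f" "exp_bounded S g" "\<And>z. z \<in> S \<Longrightarrow> 0 < \<rho> + z" "0 \<le> d"
  shows "K_op \<rho> d (\<lambda>t. f t + g t) t = K_op \<rho> d f t + K_op \<rho> d g t"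
  using gamma_conv_add[OF assms(1-3), of "d - 1"] assms(4)
  by (simp add: K_op_eq_gamma_conv ring_distribs)

lemma K_op_mult_left: "K_op \<rho> d (\<lambda>t. c * f t) t = c * K_op \<rho> d f t"
  by (simp add: K_op_eq_gamma_conv gamma_conv_mult_left)

lemma K_op_0: "K_op \<rho> d (\<lambda>t. 0) t = 0"
  by (simp add: K_op_eq_gamma_conv gamma_conv_def)

lemma K_op_sum_list:
  assumes "\<And>h. h \<in> set hs \<Longrightarrow> exp_bounded S (f h)" "\<And>z. z \<in> S \<Longrightarrow> 0 < \<rho> + z" "0 \<le> d"
  shows "exp_bounded S (\<lambda>t. \<Sum>h\<leftarrow>hs. c h * f h t) \<and>
    K_op \<rho> d (\<lambda>t. \<Sum>h\<leftarrow>hs. c h * f h t) t = (\<Sum>h\<leftarrow>hs. c h * K_op \<rho> d (f h) t)"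
  using assms(1)
proof (induction hs)
  case (Cons h hs)
  have 1: "exp_bounded S (\<lambda>t. c h * f h t)" using Cons.prems by (auto intro: exp_bounded_mult_left)
  from Cons have 2: "exp_bounded S (\<lambda>t. \<Sum>h\<leftarrow>hs. c h * f h t)"
    and 3: "K_op \<rho> d (\<lambda>t. \<Sum>h\<leftarrow>hs. c h * f h t) t = (\<Sum>h\<leftarrow>hs. c h * K_op \<rho> d (f h) t)" by auto
  from K_op_add[OF 1 2 assms(2,3), of t] exp_bounded_add[OF 1 2] 3 show ?case
    by (simp add: K_op_mult_left)
qed (simp add: K_op_0 exp_bounded_0)

lemma K_op_decaying:
  assumes "decaying S g" "\<And>z. z \<in> S \<Longrightarrow> 0 < \<rho> + z" "0 \<le> d"
  shows "decaying S (\<lambda>k. K_op \<rho> d (g k))"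
proof (cases "d = 0")
  case False
  have "decaying S (\<lambda>k t. \<rho> powr d / Gamma d * gamma_conv \<rho> (d - 1) (g k) t)"
    using gamma_conv_decaying[OF assms(1,2), of "d - 1"] assms(3) False
    by (intro decaying_mult_left) simp
  then show ?thesis using False by (simp add: K_op_eq_gamma_conv)
qed (use assms(1) in \<open>simp add: K_op_def\<close>)

text \<open>The case \<open>p = 0\<close> of the integration by parts. It is the differential
  equation \<open>y' = \<rho> (y - f)\<close> that characterises
  \<open>K_op \<rho> 1 f\<close>.\<close>

lemma K_op_1_deriv:
  assumes "decaying S g" "\<And>z. z \<in> S \<Longrightarrow> 0 < \<rho> + z" "0 < \<rho>"
  shows "K_op \<rho> 1 (g (Suc k)) t = \<rho> * (K_op \<rho> 1 (g k) t - g k t)"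
proof -
  have "gamma_conv \<rho> 0 (g (Suc k)) t = \<rho> * gamma_conv \<rho> 0 (g k) t - g k t"
    using gamma_conv_deriv[OF assms(1,2), of 0 k t] by simp
  then show ?thesis using assms(3) by (simp add: K_op_eq_gamma_conv)
qed

text \<open>The solutions of \<open>y' = \<rho> (y - f)\<close> differ by multiples of \<open>exp (\<rho> t)\<close>, and only the zero
  multiple is \<open>O(exp (- z t))\<close> for some \<open>z > - \<rho>\<close> as \<open>t\<close> tends to infinity.\<close>

lemma K_op_1_unique:
  assumes y: "decaying S y" and g: "decaying S g"
    and \<rho>: "\<And>z. z \<in> S \<Longrightarrow> 0 < \<rho> + z" "0 < \<rho>"
    and ode: "\<And>t. y 1 t = \<rho> * (y 0 t - g 0 t)"
  shows "y 0 = K_op \<rho> 1 (g 0)"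
proof -
  define w where "w k t = y k t + - 1 * K_op \<rho> 1 (g k) t" for k t
  have w: "decaying S w"
    unfolding w_def[abs_def]
    using y K_op_decaying[OF g \<rho>(1), of 1] by (intro decaying_add decaying_mult_left) simp_all
  have w1: "w 1 t = \<rho> * w 0 t" for t
    using K_op_1_deriv[OF g \<rho>, of 0 t] ode[of t] by (simp add: w_def algebra_simps)
  have D: "((\<lambda>t. exp (- \<rho> * t) * w 0 t) has_real_derivative 0) (at t)" for t
  proof -
    have "((\<lambda>t. exp (- \<rho> * t)) has_real_derivative - \<rho> * exp (- \<rho> * t)) (at t)"
      by (auto intro!: derivative_eq_intros)
    from DERIV_mult[OF this decaying_deriv[OF w, of 0 t]] w1[of t]
    show ?thesis by (simp add: algebra_simps)
  qed
  define b where "b = w 0 0"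
  have b: "exp (- \<rho> * t) * w 0 t = b" for t
    using DERIV_isconst_all[OF allI[OF D], of t 0] by (simp add: b_def)
  obtain z where z: "z \<in> S" using S_nonempty by blast
  obtain c where c: "\<And>t. \<bar>w 0 t\<bar> \<le> c * exp (- z * t)"
    using exp_boundedD[OF decaying_exp_bounded[OF w] z] by metis
  have "\<bar>b\<bar> \<le> c * exp (- (\<rho> + z) * t)" for t
  proof -
    have "\<bar>b\<bar> = exp (- \<rho> * t) * \<bar>w 0 t\<bar>" unfolding b[of t, symmetric] abs_mult by simp
    also have "\<dots> \<le> exp (- \<rho> * t) * (c * exp (- z * t))" using c by (simp add: mult_left_mono)
    also have "\<dots> = c * exp (- (\<rho> + z) * t)"
      by (simp add: ring_distribs exp_add exp_diff exp_minus field_simps)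
    finally show ?thesis .
  qed
  moreover have "((\<lambda>t. c * exp (- (\<rho> + z) * t)) \<longlongrightarrow> 0) at_top"
    using \<rho>(1)[OF z] by real_asymp
  ultimately have "\<bar>b\<bar> \<le> 0"
    by (intro tendsto_lowerbound[of "\<lambda>t. c * exp (- (\<rho> + z) * t)" 0 at_top]) auto
  then have "w 0 t = 0" for t using b[of t] by simp
  then show ?thesis by (auto simp: w_def fun_eq_iff)
qed

text \<open>Applying \<open>K_op \<rho> d\<close> to the equation satisfied by
  \<open>K_op \<rho>' 1 (g 0)\<close> gives the equation that defines the right-hand side, and its
  decaying solution is unique.\<close>

lemma K_op_commute:
  assumes g: "decaying S g"
    and \<rho>: "\<And>z. z \<in> S \<Longrightarrow> 0 < \<rho> + z" "0 \<le> d"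
    and \<rho>': "\<And>z. z \<in> S \<Longrightarrow> 0 < \<rho>' + z" "0 < \<rho>'"
  shows "K_op \<rho> d (K_op \<rho>' 1 (g 0)) = K_op \<rho>' 1 (K_op \<rho> d (g 0))"
proof (rule K_op_1_unique[where y = "\<lambda>k. K_op \<rho> d (K_op \<rho>' 1 (g k))" and g = "\<lambda>k. K_op \<rho> d (g k)"])
  have U: "decaying S (\<lambda>k. K_op \<rho>' 1 (g k))" by (rule K_op_decaying[OF g \<rho>'(1)]) simp_all
  then show "decaying S (\<lambda>k. K_op \<rho> d (K_op \<rho>' 1 (g k)))" by (rule K_op_decaying[OF _ \<rho>])
  show "decaying S (\<lambda>k. K_op \<rho> d (g k))" by (rule K_op_decaying[OF g \<rho>])
  fix t
  have "K_op \<rho>' 1 (g 1) = (\<lambda>t. \<rho>' * (K_op \<rho>' 1 (g 0) t + - 1 * g 0 t))"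
    using K_op_1_deriv[OF g \<rho>', of 0] by (auto simp: fun_eq_iff)
  then have "K_op \<rho> d (K_op \<rho>' 1 (g 1)) t = \<rho>' * K_op \<rho> d (\<lambda>t. K_op \<rho>' 1 (g 0) t + - 1 * g 0 t) t"
    by (simp only: K_op_mult_left)
  also have "\<dots> = \<rho>' * (K_op \<rho> d (K_op \<rho>' 1 (g 0)) t + K_op \<rho> d (\<lambda>t. - 1 * g 0 t) t)"
    by (subst K_op_add[OF decaying_exp_bounded[OF U]
          exp_bounded_mult_left[OF decaying_exp_bounded[OF g]] \<rho>]) simp_all
  also have "\<dots> = \<rho>' * (K_op \<rho> d (K_op \<rho>' 1 (g 0)) t - K_op \<rho> d (g 0) t)"
    by (simp only: K_op_mult_left) simp
  finally show "K_op \<rho> d (K_op \<rho>' 1 (g 1)) t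
      = \<rho>' * (K_op \<rho> d (K_op \<rho>' 1 (g 0)) t - K_op \<rho> d (g 0) t)" .
qed (use \<rho>' in auto)

text \<open>\<open>u\<close> times the Gamma density of shape \<open>d\<close> is
  \<open>d / \<rho>\<close> times the density of shape \<open>d + 1\<close>, that is, of the
  composition of \<open>K_op \<rho> 1\<close> with \<open>K_op \<rho> d\<close>.\<close>

lemma K_op_mult_self:
  assumes g: "decaying S g" and \<rho>: "\<And>z. z \<in> S \<Longrightarrow> 0 < \<rho> + z" "0 < \<rho>" and d: "0 \<le> d"
  shows "K_op \<rho> d (\<lambda>t. (t - a) * g 0 t) t
    = (t - a) * K_op \<rho> d (g 0) t + d / \<rho> * K_op \<rho> 1 (K_op \<rho> d (g 0)) t"
proof (cases "d = 0")
  case False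
  with d have d: "d > 0" by simp
  define q where "q = \<rho> powr d / Gamma d"
  \<comment> \<open>The composition is recognised through its differential equation, which is
    \<open>gamma_conv_deriv\<close> at \<open>p = d\<close>.\<close>
  have "(\<lambda>t. q * gamma_conv \<rho> d (g 0) t) = K_op \<rho> 1 (\<lambda>t. d / \<rho> * K_op \<rho> d (g 0) t)"
  proof (rule K_op_1_unique[where y = "\<lambda>k t. q * gamma_conv \<rho> d (g k) t"
        and g = "\<lambda>k t. d / \<rho> * K_op \<rho> d (g k) t"])
    show "decaying S (\<lambda>k t. q * gamma_conv \<rho> d (g k) t)"
      using gamma_conv_decaying[OF g \<rho>(1), of d] d by (intro decaying_mult_left) simp
    show "decaying S (\<lambda>k t. d / \<rho> * K_op \<rho> d (g k) t)"
      using K_op_decaying[OF g \<rho>(1), of d] d by (intro decaying_mult_left) simp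
    show "q * gamma_conv \<rho> d (g 1) t
        = \<rho> * (q * gamma_conv \<rho> d (g 0) t - d / \<rho> * K_op \<rho> d (g 0) t)" for t
    proof -
      have 1: "gamma_conv \<rho> d (g 1) t = \<rho> * gamma_conv \<rho> d (g 0) t - d * gamma_conv \<rho> (d - 1) (g 0) t"
        using gamma_conv_deriv[OF g \<rho>(1), of d 0 t] d by simp
      have 2: "K_op \<rho> d (g 0) t = q * gamma_conv \<rho> (d - 1) (g 0) t"
        using d by (simp add: K_op_eq_gamma_conv q_def)
      show ?thesis using \<rho>(2) unfolding 1 2 by (simp add: field_simps)
    qed
  qed (use \<rho> in auto)
  then have "q * gamma_conv \<rho> d (g 0) t = d / \<rho> * K_op \<rho> 1 (K_op \<rho> d (g 0)) t"
    by (metis K_op_mult_left)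
  moreover have K: "K_op \<rho> d f t = q * gamma_conv \<rho> (d - 1) f t" for f
    using d by (simp add: K_op_eq_gamma_conv q_def)
  have "gamma_conv \<rho> (d - 1) (\<lambda>t. (t - a) * g 0 t) t
      = (t - a) * gamma_conv \<rho> (d - 1) (g 0) t + gamma_conv \<rho> d (g 0) t"
    using gamma_conv_mult_self[OF decaying_exp_bounded[OF g] \<rho>(1), of "d - 1" a 0 t] d by simp
  then have "K_op \<rho> d (\<lambda>t. (t - a) * g 0 t) t = (t - a) * K_op \<rho> d (g 0) t + q * gamma_conv \<rho> d (g 0) t"
    unfolding K by (simp add: ring_distribs mult_ac)
  ultimately show ?thesis by simp
qed (simp add: K_op_def)

lemma K_op_pos:
  assumes f: "exp_bounded S f" "\<And>t. 0 < f t"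
    and \<rho>: "\<And>z. z \<in> S \<Longrightarrow> 0 < \<rho> + z" "0 < \<rho>" and d: "0 \<le> d"
  shows "0 < K_op \<rho> d f t"
proof (cases "d = 0")
  case False
  with d have d: "d > 0" by simp
  have "0 < gamma_conv \<rho> (d - 1) f t"
    unfolding gamma_conv_def
  proof (rule integral_pos_of_pos_on)
    show "integrable lborel (\<lambda>u. gamma_kernel \<rho> (d - 1) u * f (t + u))"
      by (rule integrable_gamma_conv[OF f(1) \<rho>(1)]) (use d in auto)
    show "0 \<le> gamma_kernel \<rho> (d - 1) u * f (t + u)" for u
      using gamma_kernel_nonneg f(2)[of "t + u"] by (simp add: less_imp_le)
    show "0 < gamma_kernel \<rho> (d - 1) u * f (t + u)" if "0 < u" for u
      using that f(2)[of "t + u"] by (simp add: gamma_kernel_def)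
  qed
  then show ?thesis using d \<rho>(2) by (simp add: K_op_eq_gamma_conv Gamma_real_pos)
qed (use f in \<open>simp add: K_op_def\<close>)

section \<open>The first-order relation of the weight function\<close>

text \<open>Induction along \<open>foldr\<close>, one operator being applied to the whole relation
  at each step. Decay is carried along because uniqueness needs it, and positivity because it later
  makes \<open>L\<close> nonzero.\<close>

lemma foldr_K_op_gauss:
  assumes "\<And>h z. h \<in> set hs \<Longrightarrow> z \<in> S \<Longrightarrow> 0 < \<rho> h + z"
    and "\<And>h. h \<in> set hs \<Longrightarrow> 0 < \<rho> h" "\<And>h. h \<in> set hs \<Longrightarrow> 0 \<le> d h"
  shows "\<exists>g. decaying S g \<and> g 0 = foldr (\<lambda>h. K_op (\<rho> h) (d h)) hs (gauss a) \<and> (\<forall>t. 0 < g 0 t) \<and>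
    (\<forall>t. g 1 t + 2 * (t - a) * g 0 t + 2 * (\<Sum>h\<leftarrow>hs. d h / \<rho> h * K_op (\<rho> h) 1 (g 0) t) = 0)"
  using assms
proof (induction hs)
  case Nil
  obtain g where g: "g 0 = gauss a" "decaying S g" using gauss_decaying by blast
  have "g 1 t = - 2 * (t - a) * gauss a t" for t
    using DERIV_unique[OF decaying_deriv[OF g(2), of 0 t]] g(1) has_real_derivative_gauss by simp
  then have "\<forall>t. g 1 t + 2 * (t - a) * g 0 t = 0" using g(1) by (simp add: algebra_simps)
  moreover have "0 < g 0 t" for t using g(1) by (simp add: gauss_def)
  ultimately show ?case using g by (intro exI[of _ g]) simp
next
  case (Cons i hs)
  from Cons obtain g where g: "decaying S g" "g 0 = foldr (\<lambda>h. K_op (\<rho> h) (d h)) hs (gauss a)"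
    "\<And>t. 0 < g 0 t"
    and ode: "\<And>t. g 1 t + 2 * (t - a) * g 0 t
      + 2 * (\<Sum>h\<leftarrow>hs. d h / \<rho> h * K_op (\<rho> h) 1 (g 0) t) = 0"
    by auto
  have i: "\<And>z. z \<in> S \<Longrightarrow> 0 < \<rho> i + z" "0 < \<rho> i" "0 \<le> d i" using Cons.prems by auto
  let ?K = "K_op (\<rho> i) (d i)"
  have Kg: "decaying S (\<lambda>k. ?K (g k))" by (rule K_op_decaying[OF g(1) i(1,3)])
  have U: "exp_bounded S (K_op (\<rho> h) 1 (g 0))" if "h \<in> set hs" for h
    using decaying_exp_bounded[OF K_op_decaying[OF g(1), of "\<rho> h" 1], of 0] Cons.prems(1) that by simp
  have "?K (g 1) t + 2 * (t - a) * ?K (g 0) t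
      + 2 * (\<Sum>h\<leftarrow>i # hs. d h / \<rho> h * K_op (\<rho> h) 1 (?K (g 0)) t) = 0" for t
  proof -
    let ?f1 = "\<lambda>t. (t - a) * g 0 t" and ?f2 = "\<lambda>t. \<Sum>h\<leftarrow>hs. d h / \<rho> h * K_op (\<rho> h) 1 (g 0) t"
    have b0: "exp_bounded S (g k)" for k using g(1) by (rule decaying_exp_bounded)
    have b1: "exp_bounded S ?f1"
      using exp_bounded_add[OF exp_bounded_mult_self[OF b0 open_S] exp_bounded_mult_left[OF b0, where a = "- a"]]
      by (simp add: algebra_simps)
    have b2K2: "exp_bounded S ?f2 \<and> ?K ?f2 t = (\<Sum>h\<leftarrow>hs. d h / \<rho> h * ?K (K_op (\<rho> h) 1 (g 0)) t)"
      by (rule K_op_sum_list[where f = "\<lambda>h. K_op (\<rho> h) 1 (g 0)" and c = "\<lambda>h. d h / \<rho> h"])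
        (use U i in auto)
    note b2 = b2K2[THEN conjunct1] and K2 = b2K2[THEN conjunct2]
    have C: "?K (K_op (\<rho> h) 1 (g 0)) = K_op (\<rho> h) 1 (?K (g 0))" if "h \<in> set hs" for h
      by (rule K_op_commute[OF g(1) i(1,3)]) (use Cons.prems that in auto)
    have C': "(\<Sum>h\<leftarrow>hs. d h / \<rho> h * ?K (K_op (\<rho> h) 1 (g 0)) t)
        = (\<Sum>h\<leftarrow>hs. d h / \<rho> h * K_op (\<rho> h) 1 (?K (g 0)) t)"
      by (rule arg_cong[where f = sum_list], rule map_cong) (use C in auto)
    have "(\<lambda>t. (g 1 t + 2 * ?f1 t) + 2 * ?f2 t) = (\<lambda>t. 0)"
      using ode by (intro ext) (simp only: mult.assoc)
    then have "0 = ?K (\<lambda>t. (g 1 t + 2 * ?f1 t) + 2 * ?f2 t) t" by (simp only: K_op_0)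
    also have "\<dots> = ?K (\<lambda>t. g 1 t + 2 * ?f1 t) t + ?K (\<lambda>t. 2 * ?f2 t) t"
      by (rule K_op_add[OF exp_bounded_add[OF b0 exp_bounded_mult_left[OF b1]]
            exp_bounded_mult_left[OF b2] i(1,3)])
    also have "?K (\<lambda>t. g 1 t + 2 * ?f1 t) t = ?K (g 1) t + ?K (\<lambda>t. 2 * ?f1 t) t"
      by (rule K_op_add[OF b0 exp_bounded_mult_left[OF b1] i(1,3)])
    finally have E: "0 = ?K (g 1) t + 2 * ?K ?f1 t + 2 * ?K ?f2 t" by (simp only: K_op_mult_left)
    \<comment> \<open>The last term is the summand of the new index \<open>i\<close>; the old
      summands only change by commutation.\<close>
    have M: "?K ?f1 t = (t - a) * ?K (g 0) t + d i / \<rho> i * K_op (\<rho> i) 1 (?K (g 0)) t"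
      by (rule K_op_mult_self[OF g(1) i])
    from E show ?thesis unfolding M K2 C' by (simp add: algebra_simps)
  qed
  moreover have "0 < ?K (g 0) t" for t
    by (rule K_op_pos[OF decaying_exp_bounded[OF g(1)] g(3) i])
  ultimately show ?case using Kg g(2) by (intro exI[of _ "\<lambda>k. ?K (g k)"]) simp
qed

end

section \<open>Two-sided Laplace transforms\<close>

definition laplace :: "(real \<Rightarrow> real) \<Rightarrow> real \<Rightarrow> real" where
  "laplace f z = (LBINT t. exp (z * t) * f t)"

lemma integrable_exp_minus_abs:
  assumes "0 < e" shows "integrable lborel (\<lambda>t::real. exp (- e * \<bar>t\<bar>))"
proof -
  have 1: "integrable lborel (gamma_kernel e 0)" using integrable_gamma_kernel[OF assms] by simp
  have 2: "integrable lborel (\<lambda>t. gamma_kernel e 0 (- t))"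
    using lborel_integrable_real_affine[OF 1, of "- 1" 0] by simp
  \<comment> \<open>Both kernels vanish at \<open>t = 0\<close>; the indicator of the single point
    restores the value 1 there.\<close>
  have "integrable lborel (\<lambda>t. (gamma_kernel e 0 t + gamma_kernel e 0 (- t)) + indicator {0..0::real} t)"
    using 1 2 by (intro Bochner_Integration.integrable_add) auto
  also have "(\<lambda>t. (gamma_kernel e 0 t + gamma_kernel e 0 (- t)) + indicator {0..0::real} t)
      = (\<lambda>t. exp (- e * \<bar>t\<bar>))"
    by (auto simp: gamma_kernel_def fun_eq_iff indicator_def)
  finally show ?thesis .
qed

context rate_domain
begin

lemma integrable_laplace:
  assumes "exp_bounded S f" "z \<in> S"
  shows "integrable lborel (\<lambda>t. exp (z * t) * f t)"
proof -
  obtain c e where c: "0 \<le> c" "0 < e" "\<And>t. \<bar>f t\<bar> \<le> c * exp (- z * t - e * \<bar>t\<bar>)"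
    using exp_bounded_two_sided[OF assms(1) open_S assms(2)] by metis
  have [measurable]: "f \<in> borel_measurable borel" using assms(1) by (rule exp_bounded_measurable)
  show ?thesis
  proof (rule Bochner_Integration.integrable_bound)
    show "integrable lborel (\<lambda>t. c * exp (- e * \<bar>t\<bar>))"
      using integrable_exp_minus_abs[OF c(2)] by simp
    show "AE t in lborel. norm (exp (z * t) * f t) \<le> norm (c * exp (- e * \<bar>t\<bar>))"
    proof (rule AE_I2)
      fix t
      have "norm (exp (z * t) * f t) \<le> exp (z * t) * (c * exp (- z * t - e * \<bar>t\<bar>))"
        using c(3)[of t] by (simp add: abs_mult mult_left_mono)
      also have "\<dots> = c * exp (- e * \<bar>t\<bar>)" by (simp add: exp_diff exp_minus field_simps)
      finally show "norm (exp (z * t) * f t) \<le> norm (c * exp (- e * \<bar>t\<bar>))" using c(1) by simp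
    qed
  qed simp
qed

lemma laplace_add:
  "exp_bounded S f \<Longrightarrow> exp_bounded S g \<Longrightarrow> z \<in> S \<Longrightarrow>
    laplace (\<lambda>t. f t + g t) z = laplace f z + laplace g z"
  unfolding laplace_def by (simp add: ring_distribs integrable_laplace)

lemma laplace_mult_left: "laplace (\<lambda>t. c * f t) z = c * laplace f z"
  unfolding laplace_def by (simp add: mult.left_commute)

lemma laplace_0: "laplace (\<lambda>t. 0) z = 0"
  by (simp add: laplace_def)

lemma laplace_sum:
  assumes "\<And>i. i \<in> I \<Longrightarrow> exp_bounded S (f i)" "z \<in> S"
  shows "laplace (\<lambda>t. \<Sum>i\<in>I. f i t) z = (\<Sum>i\<in>I. laplace (f i) z)"
  using assms(1)
proof (induction I rule: infinite_finite_induct)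
  case (insert i I)
  then show ?case using laplace_add[OF _ exp_bounded_sum assms(2), of "f i" I f] by auto
qed (simp_all add: laplace_0)

lemma has_real_derivative_laplace:
  assumes f: "exp_bounded S f" and z: "z \<in> S"
  shows "(laplace f has_real_derivative laplace (\<lambda>t. t * f t) z) (at z)"
proof -
  have tf: "exp_bounded S (\<lambda>t. t * f t)" using f open_S by (rule exp_bounded_mult_self)
  obtain c e where c: "0 \<le> c" "0 < e" "\<And>t. \<bar>t * f t\<bar> \<le> c * exp (- z * t - e * \<bar>t\<bar>)"
    using exp_bounded_two_sided[OF tf open_S z] by metis
  obtain e' where e': "0 < e'" "ball z e' \<subseteq> S" using open_S z open_contains_ball by blast
  \<comment> \<open>Moving \<open>z\<close> by at most \<open>e / 2\<close> costs half of the decay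
    \<open>exp (- e * \<bar>t\<bar>)\<close>, and the other half still dominates.\<close>
  define e2 where "e2 = min e' (e / 2)"
  have e2: "0 < e2" "e2 \<le> e'" "e2 \<le> e / 2" using c(2) e'(1) by (auto simp: e2_def)
  have [measurable]: "f \<in> borel_measurable borel" using f by (rule exp_bounded_measurable)
  show ?thesis
    unfolding laplace_def[abs_def]
  proof (rule has_real_derivative_integral[of e2 _ _ _ "\<lambda>z t. exp (z * t) * (t * f t)"
        "\<lambda>t. c * exp (- (e / 2) * \<bar>t\<bar>)"])
    show "integrable lborel (\<lambda>t. exp (x * t) * f t)" if "\<bar>x - z\<bar> < e2" for x
    proof (rule integrable_laplace[OF f])
      have "x \<in> ball z e'" using that e2(2) by (simp add: dist_real_def abs_minus_commute)
      then show "x \<in> S" using e'(2) by blast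
    qed
    show "integrable lborel (\<lambda>t. c * exp (- (e / 2) * \<bar>t\<bar>))"
      using integrable_exp_minus_abs[of "e / 2"] c(2) by simp
    show "((\<lambda>x. exp (x * t) * f t) has_real_derivative exp (x * t) * (t * f t)) (at x)" for x t
      by (auto intro!: derivative_eq_intros)
    show "\<bar>exp (x * t) * (t * f t)\<bar> \<le> c * exp (- (e / 2) * \<bar>t\<bar>)" if "\<bar>x - z\<bar> < e2" for x t
    proof -
      have "(x - z) * t \<le> \<bar>x - z\<bar> * \<bar>t\<bar>" by (metis abs_ge_self abs_mult)
      also have "\<dots> \<le> e / 2 * \<bar>t\<bar>" using that e2(3) by (intro mult_right_mono) auto
      finally have "x * t + (- z * t - e * \<bar>t\<bar>) \<le> - (e / 2) * \<bar>t\<bar>" by (simp add: algebra_simps)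
      then have le: "exp (x * t) * exp (- z * t - e * \<bar>t\<bar>) \<le> exp (- (e / 2) * \<bar>t\<bar>)"
        by (simp flip: exp_add)
      have "\<bar>exp (x * t) * (t * f t)\<bar> \<le> exp (x * t) * (c * exp (- z * t - e * \<bar>t\<bar>))"
        using c(3)[of t] by (simp add: abs_mult mult_left_mono)
      also have "\<dots> = c * (exp (x * t) * exp (- z * t - e * \<bar>t\<bar>))" by simp
      also have "\<dots> \<le> c * exp (- (e / 2) * \<bar>t\<bar>)" using le c(1) by (rule mult_left_mono)
      finally show ?thesis .
    qed
  qed (use e2 in simp_all)
qed

text \<open>Integration by parts over the line; the two-sided decay removes both boundary
  terms.\<close>

lemma laplace_deriv:
  assumes g: "decaying S g" and z: "z \<in> S"
  shows "laplace (g (Suc k)) z = - z * laplace (g k) z"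
proof -
  have b: "exp_bounded S (g k)" for k using g by (rule decaying_exp_bounded)
  obtain c e where c: "0 \<le> c" "0 < e" "\<And>t. \<bar>g k t\<bar> \<le> c * exp (- z * t - e * \<bar>t\<bar>)"
    using exp_bounded_two_sided[OF b open_S z] by metis
  let ?h = "\<lambda>t. exp (z * t) * g k t"
  let ?h' = "\<lambda>t. exp (z * t) * g (Suc k) t + z * (exp (z * t) * g k t)"
  have bd: "norm (?h t) \<le> c * exp (- e * \<bar>t\<bar>)" for t
  proof -
    have "norm (exp (z * t) * g k t) \<le> exp (z * t) * (c * exp (- z * t - e * \<bar>t\<bar>))"
      using c(3)[of t] by (simp add: abs_mult mult_left_mono)
    also have "\<dots> = c * exp (- e * \<bar>t\<bar>)" by (simp add: exp_diff exp_minus field_simps)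
    finally show ?thesis .
  qed
  have cont: "isCont (g k) t" for k t using decaying_deriv[OF g] by (rule DERIV_isCont)
  have int: "integrable lborel (\<lambda>t. exp (z * t) * g k t)" for k by (rule integrable_laplace[OF b z])
  have "(LBINT t=-\<infinity>..\<infinity>. ?h' t) = 0 - 0"
  proof (rule interval_integral_FTC_integrable)
    show "(?h has_vector_derivative ?h' t) (at t)" for t
    proof -
      have "((\<lambda>t. exp (z * t)) has_real_derivative z * exp (z * t)) (at t)"
        by (auto intro!: derivative_eq_intros)
      from DERIV_mult[OF this decaying_deriv[OF g]]
      show ?thesis by (simp add: has_real_derivative_iff_has_vector_derivative[symmetric] mult_ac add_ac)
    qed
    show "isCont ?h' t" for t by (intro continuous_intros cont)
    show "set_integrable lborel (einterval (- \<infinity>) \<infinity>) ?h'"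
      using int[of k] int[of "Suc k"] by (simp add: set_integrable_def)
    have "((\<lambda>t. c * exp (- e * \<bar>t\<bar>)) \<longlongrightarrow> 0) at_bot" using c(2) by real_asymp
    then have "(?h \<longlongrightarrow> 0) at_bot" using bd by (intro Lim_null_comparison[of ?h]) auto
    then show "((?h \<circ> real_of_ereal) \<longlongrightarrow> 0) (at_right (- \<infinity>))"
      by (simp add: ereal_tendsto_simps1)
    have "((\<lambda>t. c * exp (- e * \<bar>t\<bar>)) \<longlongrightarrow> 0) at_top" using c(2) by real_asymp
    then have "(?h \<longlongrightarrow> 0) at_top" using bd by (intro Lim_null_comparison[of ?h]) auto
    then show "((?h \<circ> real_of_ereal) \<longlongrightarrow> 0) (at_left \<infinity>)"
      by (simp add: ereal_tendsto_simps1)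
  qed simp
  then have "integral\<^sup>L lborel ?h' = 0"
    by (simp add: interval_lebesgue_integral_def set_lebesgue_integral_def)
  then show ?thesis unfolding laplace_def using int[of k] int[of "Suc k"] by simp
qed

lemma laplace_pos:
  assumes "exp_bounded S f" "z \<in> S" "\<And>t. 0 < f t"
  shows "0 < laplace f z"
  unfolding laplace_def using integrable_laplace[OF assms(1,2)] assms(3)
  by (intro integral_pos_of_pos_on) (auto simp: less_imp_le)

end

section \<open>The weight function and its relations\<close>

text \<open>The half-line on which \<open>Phi\<close> is specified (all of the line for
  \<open>r = 0\<close>). With positive rates it contains \<open>[0, \<infinity>)\<close>, so a
  polynomial is determined by its values there.\<close>

definition rate_half_line :: "nat \<Rightarrow> (nat \<Rightarrow> real) \<Rightarrow> real set" where
  "rate_half_line r \<rho> = {z. \<forall>h\<in>{1..r}. 0 < \<rho> h + z}"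

lemma rate_half_line_pos: "z \<in> rate_half_line r \<rho> \<Longrightarrow> h \<in> {1..r} \<Longrightarrow> 0 < \<rho> h + z"
  by (simp add: rate_half_line_def)

locale gamma_weight =
  fixes r :: nat and \<rho> d :: "nat \<Rightarrow> real" and a :: real
  assumes rho_pos: "\<And>h. h \<in> {1..r} \<Longrightarrow> 0 < \<rho> h"
    and d_nonneg: "\<And>h. h \<in> {1..r} \<Longrightarrow> 0 \<le> d h"
begin

abbreviation F where "F \<equiv> F_fun r \<rho> d a"
abbreviation U where "U \<equiv> U_row r \<rho> d a"
abbreviation S where "S \<equiv> rate_half_line r \<rho>"

sublocale rate_domain S
proof
  have "S = (\<Inter>h\<in>{1..r}. {0 - \<rho> h<..})" by (auto simp: rate_half_line_def less_diff_eq diff_less_eq add.commute simp del: diff_0)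
  then show "open S" by (simp add: open_INT)
  have "0 \<in> S" using rho_pos by (simp add: rate_half_line_def)
  then show "S \<noteq> {}" by blast
qed

lemma F_properties:
  shows F_decaying: "decaying S (\<lambda>k. (deriv ^^ k) F)"
    and F_pos: "0 < F t"
    and F_ode: "deriv F t + 2 * (t - a) * F t + 2 * (\<Sum>h=1..r. d h / \<rho> h * U h t) = 0"
proof -
  have "\<exists>g. decaying S g \<and> g 0 = F \<and> (\<forall>t. 0 < g 0 t) \<and> (\<forall>t. g 1 t + 2 * (t - a) * g 0 t
      + 2 * (\<Sum>h\<leftarrow>[1..<Suc r]. d h / \<rho> h * K_op (\<rho> h) 1 (g 0) t) = 0)"
    unfolding F_fun_def
    by (rule foldr_K_op_gauss) (auto simp: rate_half_line_pos rho_pos d_nonneg)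
  then obtain g where g: "decaying S g" "g 0 = F" "\<And>t. 0 < g 0 t"
    and ode: "\<And>t. g 1 t + 2 * (t - a) * g 0 t
      + 2 * (\<Sum>h\<leftarrow>[1..<Suc r]. d h / \<rho> h * K_op (\<rho> h) 1 (g 0) t) = 0"
    by blast
  have gk: "(deriv ^^ k) F = g k" for k using decaying_higher_deriv[OF g(1), of k 0] g(2) by simp
  show "decaying S (\<lambda>k. (deriv ^^ k) F)" unfolding gk by (rule g(1))
  show "0 < F t" using g(2,3) by metis
  have "(\<Sum>h\<leftarrow>[1..<Suc r]. d h / \<rho> h * K_op (\<rho> h) 1 (g 0) t) = (\<Sum>h=1..r. d h / \<rho> h * U h t)"
    unfolding interv_sum_list_conv_sum_set_nat g(2)
    by (intro sum.cong) (auto simp: U_row_def)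
  with ode[of t] gk[of 1] g(2) show "deriv F t + 2 * (t - a) * F t + 2 * (\<Sum>h=1..r. d h / \<rho> h * U h t) = 0"
    by simp
qed

lemma U_low: "h \<in> {1..r} \<Longrightarrow> U h = K_op (\<rho> h) 1 F"
  by (simp add: U_row_def fun_eq_iff)

lemma U_high: "r < j \<Longrightarrow> U j = (deriv ^^ (j - r - 1)) F"
  by (simp add: U_row_def fun_eq_iff)

lemma U_low_decaying: "h \<in> {1..r} \<Longrightarrow> decaying S (\<lambda>k. K_op (\<rho> h) 1 ((deriv ^^ k) F))"
  using K_op_decaying[OF F_decaying, of "\<rho> h" 1] rate_half_line_pos by simp

lemma U_low_deriv:
  assumes "h \<in> {1..r}" shows "K_op (\<rho> h) 1 (deriv F) t = \<rho> h * (U h t - F t)"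
  using K_op_1_deriv[OF F_decaying, of "\<rho> h" 0 t] rate_half_line_pos rho_pos assms
  by (simp add: U_low)

lemma has_real_derivative_U_low:
  assumes "h \<in> {1..r}" shows "(U h has_real_derivative \<rho> h * (U h t - F t)) (at t)"
  using decaying_deriv[OF U_low_decaying[OF assms], of 0 t] U_low_deriv[OF assms, of t]
  by (simp add: U_low[OF assms])

lemma U_exp_bounded: "1 \<le> j \<Longrightarrow> exp_bounded S (U j)"
  using decaying_exp_bounded[OF U_low_decaying[of j], of 0] decaying_exp_bounded[OF F_decaying]
  by (cases "j \<le> r") (simp_all add: U_low U_high)

text \<open>Repeated differentiation of \<open>F_ode\<close>: each step turns \<open>U h\<close>
  into \<open>\<rho> h * (U h - F)\<close>, which raises the power of \<open>\<rho> h\<close> by one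
  and adds one term to the inner sum. The integer power serves \<open>k = 0\<close>, where the
  coefficient is \<open>d h / \<rho> h\<close>.\<close>

lemma derived_relation:
  "(deriv ^^ (k + 1)) F t + 2 * (t - a) * (deriv ^^ k) F t + 2 * real k * (deriv ^^ (k - 1)) F t
    + 2 * (\<Sum>h=1..r. d h * (\<rho> h powi (int k - 1) * U h t
        - (\<Sum>b<k. \<rho> h ^ (k - b - 1) * (deriv ^^ b) F t))) = 0"
proof (induction k arbitrary: t)
  case 0
  have "(\<Sum>h=1..r. d h / \<rho> h * U h t) = (\<Sum>h=1..r. d h * (\<rho> h powi - 1 * U h t))"
    by (intro sum.cong) (auto simp: power_int_minus field_simps)
  with F_ode[of t] show ?case by simp
next
  case (Suc k)
  let ?D = "\<lambda>k. (deriv ^^ k) F"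
  have D: "(?D k has_real_derivative ?D (Suc k) t) (at t)" for k t by (rule decaying_deriv[OF F_decaying])
  let ?H = "\<lambda>k h t. \<rho> h powi (int k - 1) * U h t - (\<Sum>b<k. \<rho> h ^ (k - b - 1) * ?D b t)"
  have H: "(?H k h has_real_derivative ?H (Suc k) h t) (at t)" if h: "h \<in> {1..r}" for h
  proof (rule DERIV_cong)
    show "(?H k h has_real_derivative \<rho> h powi (int k - 1) * (\<rho> h * (U h t - F t))
        - (\<Sum>b<k. \<rho> h ^ (k - b - 1) * ?D (Suc b) t)) (at t)"
      by (intro DERIV_diff DERIV_cmult DERIV_sum has_real_derivative_U_low h D)
    have "\<rho> h powi (int k - 1) * \<rho> h = \<rho> h ^ k"
      using rho_pos[OF h] by (simp add: power_int_diff)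
    moreover have "\<rho> h powi (int k - 1) * (\<rho> h * (U h t - F t))
        = (\<rho> h powi (int k - 1) * \<rho> h) * (U h t - F t)" by simp
    moreover have "(\<Sum>b<Suc k. \<rho> h ^ (Suc k - b - 1) * ?D b t)
        = \<rho> h ^ k * F t + (\<Sum>b<k. \<rho> h ^ (k - b - 1) * ?D (Suc b) t)"
      by (subst sum.lessThan_Suc_shift) simp
    ultimately show "\<rho> h powi (int k - 1) * (\<rho> h * (U h t - F t))
        - (\<Sum>b<k. \<rho> h ^ (k - b - 1) * ?D (Suc b) t) = ?H (Suc k) h t"
      by (simp add: right_diff_distrib)
  qed
  let ?E = "\<lambda>t. ?D (k + 1) t + 2 * (t - a) * ?D k t + 2 * real k * ?D (k - 1) t
    + 2 * (\<Sum>h=1..r. d h * ?H k h t)"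
  have "((\<lambda>t. 2 * (t - a)) has_real_derivative 2) (at t)" by (auto intro!: derivative_eq_intros)
  from DERIV_mult[OF this D[of k t]]
  have 1: "((\<lambda>t. 2 * (t - a) * ?D k t) has_real_derivative 2 * ?D k t + ?D (Suc k) t * (2 * (t - a))) (at t)" .
  \<comment> \<open>At \<open>k = 0\<close> the truncated index \<open>k - 1\<close> is harmless
    because of the factor \<open>real k\<close>.\<close>
  have 2: "((\<lambda>t. 2 * real k * ?D (k - 1) t) has_real_derivative 2 * real k * ?D k t) (at t)"
    using DERIV_cmult[OF D[of "k - 1" t], of "2 * real k"] by (cases k) auto
  have 3: "(?E has_real_derivative ?D (Suc (k + 1)) t
      + (2 * ?D k t + ?D (Suc k) t * (2 * (t - a))) + 2 * real k * ?D k t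
      + 2 * (\<Sum>h=1..r. d h * ?H (Suc k) h t)) (at t)"
    by (intro DERIV_add 1 2 D DERIV_cmult DERIV_sum H)
  have "?E = (\<lambda>t. 0)" by (rule ext) (rule Suc.IH)
  from 3[unfolded this] DERIV_const
  have "?D (Suc (k + 1)) t
      + (2 * ?D k t + ?D (Suc k) t * (2 * (t - a))) + 2 * real k * ?D k t
      + 2 * (\<Sum>h=1..r. d h * ?H (Suc k) h t) = 0"
    by (rule DERIV_unique)
  then show ?case by (simp add: algebra_simps)
qed

lemma sum_r_vec_eq_0:
  assumes "k + 2 \<le> s"
  shows "(\<Sum>j=1..r+s. poly (r_vec r s \<rho> d a k j) t * U j t) = 0"
  unfolding sum_r_vec[OF assms]
  using derived_relation[of k t]
  by (simp add: right_diff_distrib sum_subtractf mult.assoc)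

section \<open>Laplace transforms of the rows\<close>

abbreviation L where "L \<equiv> L_F r \<rho> d a"
abbreviation \<Lambda> where "\<Lambda> \<equiv> Lambda r \<rho> d a"

lemma L_eq_laplace: "L = laplace F"
  by (simp add: fun_eq_iff L_F_def laplace_def)

lemma L_pos: "z \<in> S \<Longrightarrow> 0 < L z"
  unfolding L_eq_laplace using laplace_pos[of F] decaying_exp_bounded[OF F_decaying, of 0] F_pos by simp

text \<open>For \<open>j \<le> r\<close> the transform of the derivative of \<open>U j\<close> is
  computed twice, as \<open>- z\<close> times the transform and from
  \<open>U j' = \<rho> j (U j - F)\<close>; the resulting linear equation is solved.\<close>

lemma laplace_U:
  assumes z: "z \<in> S" and j: "1 \<le> j" shows "laplace (U j) z = \<Lambda> j z"
proof (cases "j \<le> r")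
  case True
  then have h: "j \<in> {1..r}" using j by simp
  have "laplace (K_op (\<rho> j) 1 (deriv F)) z = - z * laplace (U j) z"
    using laplace_deriv[OF U_low_decaying[OF h] z, of 0] by (simp add: U_low[OF h])
  moreover have "laplace (K_op (\<rho> j) 1 (deriv F)) z = \<rho> j * laplace (U j) z - \<rho> j * L z"
  proof -
    have "K_op (\<rho> j) 1 (deriv F) = (\<lambda>t. \<rho> j * U j t + - \<rho> j * F t)"
      using U_low_deriv[OF h] by (simp add: fun_eq_iff right_diff_distrib)
    moreover have "exp_bounded S F" using decaying_exp_bounded[OF F_decaying, of 0] by simp
    ultimately have "laplace (K_op (\<rho> j) 1 (deriv F)) z
        = laplace (\<lambda>t. \<rho> j * U j t) z + laplace (\<lambda>t. - \<rho> j * F t) z"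
      using laplace_add[OF exp_bounded_mult_left[OF U_exp_bounded[OF j]] exp_bounded_mult_left z]
      by (simp only:)
    then show ?thesis unfolding laplace_mult_left L_eq_laplace by (simp only: mult_minus_left minus_mult_left[symmetric] diff_conv_add_uminus)
  qed
  ultimately have "(\<rho> j + z) * laplace (U j) z = \<rho> j * L z" by (simp add: algebra_simps)
  then show ?thesis using True rate_half_line_pos[OF z h] by (simp add: Lambda_def field_simps)
next
  case False
  have "laplace ((deriv ^^ k) F) z = (- z) ^ k * L z" for k
    by (induction k) (use laplace_deriv[OF F_decaying z] in \<open>simp_all add: L_eq_laplace\<close>)
  then show ?thesis using False by (simp add: U_high Lambda_def)
qed

lemma deriv_eq_on_S:
  assumes "\<And>z. z \<in> S \<Longrightarrow> f z = g z" "z \<in> S" "(g has_real_derivative g') (at z)"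
  shows "(f has_real_derivative g') (at z)"
  by (rule has_field_derivative_transform_within_open[OF assms(3) open_S assms(2)])
    (use assms(1) in auto)

lemma higher_deriv_Lambda:
  assumes j: "1 \<le> j" and z: "z \<in> S"
  shows "(deriv ^^ i) (\<Lambda> j) z = laplace (\<lambda>t. t ^ i * U j t) z"
  using z
proof (induction i arbitrary: z)
  case 0
  then show ?case using laplace_U[OF _ j] by simp
next
  case (Suc i)
  have "((deriv ^^ i) (\<Lambda> j) has_real_derivative laplace (\<lambda>t. t * (t ^ i * U j t)) z) (at z)"
    using deriv_eq_on_S[OF Suc.IH Suc.prems has_real_derivative_laplace[OF
          exp_bounded_power_mult[OF U_exp_bounded[OF j] open_S] Suc.prems]] .
  then show ?case by (simp add: DERIV_imp_deriv mult.assoc)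
qed

text \<open>The transform of \<open>F_ode\<close>, with \<open>t\<close> turned into differentiation
  and the derivative of \<open>F\<close> into multiplication by \<open>- z\<close>. Solving for
  \<open>L'\<close> gives the rational logarithmic derivative.\<close>

lemma has_real_derivative_L:
  assumes z: "z \<in> S"
  shows "(L has_real_derivative (a + z / 2 - (\<Sum>h=1..r. d h / (\<rho> h + z))) * L z) (at z)"
proof -
  have b: "exp_bounded S ((deriv ^^ k) F)" for k by (rule decaying_exp_bounded[OF F_decaying])
  from b[of 0] b[of 1] have b0: "exp_bounded S F" and b1: "exp_bounded S (deriv F)" by simp_all
  have bt: "exp_bounded S (\<lambda>t. t * F t)" using b0 open_S by (rule exp_bounded_mult_self)
  let ?s = "\<lambda>t. \<Sum>h=1..r. d h / \<rho> h * U h t"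
  have bs: "exp_bounded S ?s" by (intro exp_bounded_sum exp_bounded_mult_left U_exp_bounded) simp
  have "(\<lambda>t. (deriv F t + 2 * (t * F t)) + (- 2 * a * F t + 2 * ?s t)) = (\<lambda>t. 0)"
    using F_ode by (intro ext) (simp add: algebra_simps)
  then have "0 = laplace (\<lambda>t. (deriv F t + 2 * (t * F t)) + (- 2 * a * F t + 2 * ?s t)) z"
    by (simp only: laplace_0)
  also have "\<dots> = laplace (\<lambda>t. deriv F t + 2 * (t * F t)) z + laplace (\<lambda>t. - 2 * a * F t + 2 * ?s t) z"
    by (intro laplace_add exp_bounded_add exp_bounded_mult_left b0 b1 bt bs z)
  also have "laplace (\<lambda>t. deriv F t + 2 * (t * F t)) z = laplace (deriv F) z + 2 * laplace (\<lambda>t. t * F t) z"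
    by (simp add: laplace_add[OF b1 exp_bounded_mult_left[OF bt] z] laplace_mult_left)
  also have "laplace (\<lambda>t. - 2 * a * F t + 2 * ?s t) z = - 2 * a * laplace F z + 2 * laplace ?s z"
    using laplace_add[OF exp_bounded_mult_left[OF b0] exp_bounded_mult_left[OF bs] z]
    by (simp only: laplace_mult_left)
  also have "laplace ?s z = (\<Sum>h=1..r. d h / \<rho> h * laplace (U h) z)"
    by (subst laplace_sum[OF exp_bounded_mult_left[OF U_exp_bounded] z])
      (auto simp only: laplace_mult_left atLeastAtMost_iff)
  also have "\<dots> = (\<Sum>h=1..r. d h / (\<rho> h + z)) * L z"
    unfolding sum_distrib_right
  proof (rule sum.cong)
    fix h assume h: "h \<in> {1..r}"
    then show "d h / \<rho> h * laplace (U h) z = d h / (\<rho> h + z) * L z"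
      using laplace_U[OF z, of h] rho_pos[OF h] by (simp add: Lambda_def)
  qed simp
  also have "laplace (deriv F) z = - z * L z"
    using laplace_deriv[OF F_decaying z, of 0] by (simp add: L_eq_laplace)
  finally have "laplace (\<lambda>t. t * F t) z = (a + z / 2 - (\<Sum>h=1..r. d h / (\<rho> h + z))) * L z"
    unfolding L_eq_laplace by (simp add: algebra_simps)
  with has_real_derivative_laplace[OF b0 z] show ?thesis by (simp add: L_eq_laplace)
qed

end

section \<open>The polynomials representing derivatives of the Laplace transforms\<close>

lemma coeff_mult_top:
  fixes p q :: "'a :: comm_semiring_0 poly"
  assumes "degree p \<le> m" "degree q \<le> n"
  shows "coeff (p * q) (m + n) = coeff p m * coeff q n"
proof -
  have "coeff (p * q) (m + n) = (\<Sum>i\<le>m + n. coeff p i * coeff q (m + n - i))"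
    by (rule coeff_mult)
  also have "\<dots> = (\<Sum>i\<in>{m}. coeff p i * coeff q (m + n - i))"
  proof (rule sum.mono_neutral_right)
    show "\<forall>i\<in>{..m + n} - {m}. coeff p i * coeff q (m + n - i) = 0"
    proof
      fix i assume i: "i \<in> {..m + n} - {m}"
      show "coeff p i * coeff q (m + n - i) = 0"
      proof (cases "i < m")
        case True
        then have "coeff q (m + n - i) = 0" using assms(2) by (intro coeff_eq_0) auto
        then show ?thesis by simp
      next
        case False
        then have "coeff p i = 0" using i assms(1) by (intro coeff_eq_0) auto
        then show ?thesis by simp
      qed
    qed
  qed auto
  finally show ?thesis by simp
qed

lemma degree_prod_linear_power:
  fixes \<rho> :: "nat \<Rightarrow> real"
  shows "degree (\<Prod>i\<in>I. [:\<rho> i, 1:] ^ e i) = sum e I"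
    and "coeff (\<Prod>i\<in>I. [:\<rho> i, 1:] ^ e i) (sum e I) = 1"
proof -
  show deg: "degree (\<Prod>i\<in>I. [:\<rho> i, 1:] ^ e i) = sum e I"
    by (subst degree_prod_sum_eq) (auto simp: degree_power_eq)
  have "lead_coeff (\<Prod>i\<in>I. [:\<rho> i, 1:] ^ e i) = 1"
    by (simp add: lead_coeff_prod lead_coeff_power)
  then show "coeff (\<Prod>i\<in>I. [:\<rho> i, 1:] ^ e i) (sum e I) = 1" by (simp add: deg)
qed

context gamma_weight
begin

definition rate_prod :: "real poly" where
  "rate_prod = (\<Prod>i\<in>{1..r}. [:\<rho> i, 1:])"

definition rate_cofactor :: "nat \<Rightarrow> real poly" where
  "rate_cofactor h = (\<Prod>i\<in>{1..r} - {h}. [:\<rho> i, 1:])"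

text \<open>\<open>rate_prod\<close> times the logarithmic derivative of the Laplace transform of the weight.\<close>

definition log_deriv_num :: "real poly" where
  "log_deriv_num = rate_prod * [:a, 1 / 2:] - (\<Sum>h=1..r. Polynomial.smult (d h) (rate_cofactor h))"

definition row_den :: "nat \<Rightarrow> real poly" where
  "row_den j = (if j \<le> r then [:\<rho> j, 1:] else 1)"

text \<open>Numerator of the \<open>k\<close>-th derivative of the transform of row \<open>j\<close>, divided by the transform of
  the weight, over the denominator \<open>rate_prod ^ k * row_den j\<close>.\<close>

fun deriv_num :: "nat \<Rightarrow> nat \<Rightarrow> real poly" where
  "deriv_num j 0 = (if j \<le> r then [:\<rho> j:] else [:0, -1:] ^ (j - r - 1))"
| "deriv_num j (Suc k) = pderiv (deriv_num j k) * rate_prod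
    - deriv_num j k * (Polynomial.smult (real k) (pderiv rate_prod) + (if j \<le> r then rate_cofactor j else 0))
    + deriv_num j k * log_deriv_num"

lemma rate_prod_split: "h \<in> {1..r} \<Longrightarrow> rate_prod = [:\<rho> h, 1:] * rate_cofactor h"
  unfolding rate_prod_def rate_cofactor_def by (subst prod.remove[of _ h]) auto

lemma rate_prod_nonzero: "z \<in> S \<Longrightarrow> poly rate_prod z \<noteq> 0"
  using rate_half_line_pos[of z r \<rho>] by (fastforce simp: rate_prod_def poly_prod)

lemma log_deriv_num_eq:
  assumes z: "z \<in> S"
  shows "poly log_deriv_num z = poly rate_prod z * (a + z / 2 - (\<Sum>h=1..r. d h / (\<rho> h + z)))"
proof -
  have "d h * poly (rate_cofactor h) z = poly rate_prod z * (d h / (\<rho> h + z))" if "h \<in> {1..r}" for h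
    using rate_half_line_pos[OF z that] by (simp add: rate_prod_split[OF that] field_simps)
  then have "(\<Sum>h=1..r. d h * poly (rate_cofactor h) z) = poly rate_prod z * (\<Sum>h=1..r. d h / (\<rho> h + z))"
    by (simp add: sum_distrib_left)
  then show ?thesis
    by (simp add: log_deriv_num_def poly_sum algebra_simps)
qed

lemma higher_deriv_Lambda_eq:
  assumes j: "1 \<le> j" and z: "z \<in> S"
  shows "(deriv ^^ k) (\<Lambda> j) z = poly (deriv_num j k) z / (poly rate_prod z ^ k * poly (row_den j) z) * L z"
  using z
proof (induction k arbitrary: z)
  case 0
  then show ?case by (simp add: Lambda_def row_den_def poly_power)
next
  case (Suc k)
  note z = Suc.prems
  let ?N = "deriv_num j k" and ?D = rate_prod and ?E = "row_den j"
  have D: "poly ?D z \<noteq> 0" using rate_prod_nonzero[OF z] .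
  have E: "poly ?E z \<noteq> 0" using rate_half_line_pos[OF z, of j] j by (auto simp: row_den_def)
  \<comment> \<open>Multiplied by \<open>rate_prod\<close>, the logarithmic derivative of the row
    denominator becomes a polynomial, the cofactor in the recursion.\<close>
  have DE: "poly ?D z * poly (pderiv ?E) z
      = poly (if j \<le> r then rate_cofactor j else 0) z * poly ?E z"
    using j by (auto simp: row_den_def rate_prod_split pderiv_pCons algebra_simps)
  define \<psi> where "\<psi> = a + z / 2 - (\<Sum>h=1..r. d h / (\<rho> h + z))"
  have P: "poly log_deriv_num z = poly ?D z * \<psi>" unfolding \<psi>_def by (rule log_deriv_num_eq[OF z])
  \<comment> \<open>The quotient \<open>x ^ k / x\<close> replaces \<open>x ^ (k - 1)\<close>, so
    that \<open>k = 0\<close> needs no separate treatment afterwards.\<close>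
  have "((\<lambda>z. poly ?D z ^ k) has_real_derivative
      real k * (poly ?D z ^ k / poly ?D z) * poly (pderiv ?D) z) (at z)"
    by (rule DERIV_cong[OF DERIV_power[OF poly_DERIV]]) (use D in \<open>cases k; simp\<close>)
  then have "((\<lambda>z. poly ?D z ^ k * poly ?E z) has_real_derivative
      real k * (poly ?D z ^ k / poly ?D z) * poly (pderiv ?D) z * poly ?E z
        + poly (pderiv ?E) z * poly ?D z ^ k) (at z)"
    by (rule DERIV_mult[OF _ poly_DERIV])
  then have "((\<lambda>z. poly ?D z ^ k * poly ?E z) has_real_derivative
      poly ?D z ^ k * poly (pderiv ?E) z + real k * (poly ?D z ^ k / poly ?D z) * poly (pderiv ?D) z * poly ?E z) (at z)"
    by (simp only: add.commute mult.commute)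
  from DERIV_mult[OF DERIV_divide[OF poly_DERIV this] has_real_derivative_L[OF z]] D E
  have "((\<lambda>z. poly ?N z / (poly ?D z ^ k * poly ?E z) * L z) has_real_derivative
      (poly (pderiv ?N) z * (poly ?D z ^ k * poly ?E z) - poly ?N z *
        (poly ?D z ^ k * poly (pderiv ?E) z + real k * (poly ?D z ^ k / poly ?D z) * poly (pderiv ?D) z * poly ?E z))
      / ((poly ?D z ^ k * poly ?E z) * (poly ?D z ^ k * poly ?E z)) * L z
      + \<psi> * L z * (poly ?N z / (poly ?D z ^ k * poly ?E z))) (at z)"
    by (simp only: \<psi>_def[symmetric] mult_eq_0_iff power_eq_0_iff simp_thms)
  from deriv_eq_on_S[OF Suc.IH z this, THEN DERIV_imp_deriv]
  have "(deriv ^^ Suc k) (\<Lambda> j) z =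
      (poly (pderiv ?N) z * (poly ?D z ^ k * poly ?E z) - poly ?N z *
        (poly ?D z ^ k * poly (pderiv ?E) z + real k * (poly ?D z ^ k / poly ?D z) * poly (pderiv ?D) z * poly ?E z))
      / ((poly ?D z ^ k * poly ?E z) * (poly ?D z ^ k * poly ?E z)) * L z
      + \<psi> * L z * (poly ?N z / (poly ?D z ^ k * poly ?E z))"
    by simp
  also have "\<dots> = (poly (pderiv ?N) z * poly ?D z
      - poly ?N z * (real k * poly (pderiv ?D) z + poly ?D z * poly (pderiv ?E) z / poly ?E z)
      + poly ?N z * (poly ?D z * \<psi>)) / (poly ?D z ^ Suc k * poly ?E z) * L z"
  proof -
    define x y where "x = poly ?D z" and "y = poly ?D z ^ k"
    have "x \<noteq> 0" "y \<noteq> 0" using D by (simp_all add: x_def y_def)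
    then show ?thesis using E
      by (simp add: x_def[symmetric] y_def[symmetric]) (simp add: field_simps)
  qed
  also have "poly ?D z * poly (pderiv ?E) z / poly ?E z = poly (if j \<le> r then rate_cofactor j else 0) z"
    unfolding DE using E by simp
  finally show ?case by (simp add: P del: power_Suc)
qed

lemma rate_prod_top: "degree rate_prod \<le> r" "coeff rate_prod r = 1"
  using degree_prod_linear_power[of \<rho> "\<lambda>_. 1" "{1..r}"] by (simp_all add: rate_prod_def)

lemma degree_rate_cofactor: "degree (rate_cofactor h) \<le> r"
proof -
  have "degree (rate_cofactor h) = card ({1..r} - {h})"
    using degree_prod_linear_power(1)[of \<rho> "\<lambda>_. 1" "{1..r} - {h}"] by (simp add: rate_cofactor_def)
  also have "\<dots> \<le> r" using card_mono[of "{1..r}" "{1..r} - {h}"] by simp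
  finally show ?thesis .
qed

lemma log_deriv_num_top: "degree log_deriv_num \<le> r + 1" "coeff log_deriv_num (r + 1) = 1 / 2"
proof -
  have s: "degree (\<Sum>h=1..r. Polynomial.smult (d h) (rate_cofactor h)) \<le> r"
    by (rule degree_sum_le) (auto intro: order_trans[OF degree_smult_le] simp: degree_rate_cofactor)
  have "degree (rate_prod * [:a, 1 / 2:]) \<le> r + 1"
    using rate_prod_top(1) by (intro order_trans[OF degree_mult_le]) auto
  with s show "degree log_deriv_num \<le> r + 1" unfolding log_deriv_num_def
    by (intro degree_diff_le) auto
  have "coeff (rate_prod * [:a, 1 / 2:]) (r + 1) = 1 / 2"
    using coeff_mult_top[of rate_prod r "[:a, 1 / 2:]" 1] rate_prod_top by simp
  with s show "coeff log_deriv_num (r + 1) = 1 / 2"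
    unfolding log_deriv_num_def coeff_diff by (simp add: coeff_eq_0)
qed

text \<open>The degree of \<open>deriv_num j 0\<close>.\<close>

definition row_order :: "nat \<Rightarrow> nat" where
  "row_order j = (if j \<le> r then 0 else j - r - 1)"

text \<open>Only the summand with \<open>log_deriv_num\<close> raises the degree bound by
  \<open>r + 1\<close>, the others by at most \<open>r\<close>; its top coefficient 1/2 comes from
  \<open>z / 2\<close> in the logarithmic derivative of \<open>L\<close>.\<close>

lemma deriv_num_top:
  "degree (deriv_num j k) \<le> row_order j + k * (r + 1)"
  "coeff (deriv_num j k) (row_order j + k * (r + 1)) = (if j \<le> r then \<rho> j else (- 1) ^ row_order j) / 2 ^ k"
proof (induction k)
  case 0
  have "degree ([:0, -1:] ^ m :: real poly) = m" for m by (simp add: degree_power_eq)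
  moreover from this have "coeff ([:0, -1:] ^ m :: real poly) m = (-1) ^ m" for m
    using lead_coeff_power[of "[:0, -1:] :: real poly" m] by simp
  ultimately show "degree (deriv_num j 0) \<le> row_order j + 0 * (r + 1)"
    "coeff (deriv_num j 0) (row_order j + 0 * (r + 1)) = (if j \<le> r then \<rho> j else (- 1) ^ row_order j) / 2 ^ 0"
    by (simp_all add: row_order_def)
next
  case (Suc k)
  define m where "m = row_order j + k * (r + 1)"
  have m: "row_order j + Suc k * (r + 1) = m + (r + 1)" by (simp add: m_def)
  have IH: "degree (deriv_num j k) \<le> m"
    "coeff (deriv_num j k) m = (if j \<le> r then \<rho> j else (- 1) ^ row_order j) / 2 ^ k"
    using Suc by (simp_all add: m_def)
  have 1: "degree (pderiv (deriv_num j k) * rate_prod) \<le> m + r"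
    using IH(1) rate_prod_top(1) degree_pderiv[of "deriv_num j k"]
    by (intro order_trans[OF degree_mult_le]) auto
  have "degree (Polynomial.smult (real k) (pderiv rate_prod) + (if j \<le> r then rate_cofactor j else 0)) \<le> r"
    using rate_prod_top(1) degree_pderiv[of rate_prod] degree_rate_cofactor[of j]
    by (intro degree_add_le) (auto intro: order_trans[OF degree_smult_le])
  then have 2: "degree (deriv_num j k * (Polynomial.smult (real k) (pderiv rate_prod)
      + (if j \<le> r then rate_cofactor j else 0))) \<le> m + r"
    using IH(1) by (intro order_trans[OF degree_mult_le]) auto
  have 3: "degree (deriv_num j k * log_deriv_num) \<le> m + (r + 1)"
    using IH(1) log_deriv_num_top(1) by (intro order_trans[OF degree_mult_le]) auto
  show "degree (deriv_num j (Suc k)) \<le> row_order j + Suc k * (r + 1)"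
    unfolding m deriv_num.simps using 1 2 3 by (intro degree_add_le degree_diff_le) auto
  have "coeff (deriv_num j k * log_deriv_num) (m + (r + 1)) = coeff (deriv_num j k) m / 2"
    using coeff_mult_top[OF IH(1) log_deriv_num_top(1)] log_deriv_num_top(2) by simp
  then show "coeff (deriv_num j (Suc k)) (row_order j + Suc k * (r + 1))
      = (if j \<le> r then \<rho> j else (- 1) ^ row_order j) / 2 ^ Suc k"
    unfolding m deriv_num.simps coeff_add coeff_diff using 1 2 IH(2)
    by (simp add: coeff_eq_0)
qed

text \<open>At \<open>- \<rho> h\<close> the recursion collapses: \<open>rate_prod\<close> vanishes,
  while its derivative and the cofactor share a nonzero value \<open>\<delta>\<close>. Each step
  multiplies by \<open>- (k + 1 + d h) * \<delta>\<close>, which is nonzero because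
  \<open>d h \<ge> 0\<close>.\<close>

lemma deriv_num_root:
  assumes h: "h \<in> {1..r}" and inj: "inj_on \<rho> {1..r}"
  shows "poly (deriv_num h k) (- \<rho> h) \<noteq> 0"
proof -
  define \<delta> where "\<delta> = poly (rate_cofactor h) (- \<rho> h)"
  have "\<rho> i - \<rho> h \<noteq> 0" if "i \<in> {1..r} - {h}" for i
    using that h inj_onD[OF inj, of i h] by auto
  then have \<delta>: "\<delta> \<noteq> 0" by (simp add: \<delta>_def rate_cofactor_def poly_prod)
  have D: "poly rate_prod (- \<rho> h) = 0" by (simp add: rate_prod_split[OF h])
  have D': "poly (pderiv rate_prod) (- \<rho> h) = \<delta>"
    unfolding rate_prod_split[OF h] pderiv_mult by (simp add: pderiv_pCons \<delta>_def)
  have "poly (rate_cofactor i) (- \<rho> h) = 0" if "i \<noteq> h" for i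
    unfolding rate_cofactor_def poly_prod
    using h that by (intro prod_zero) (auto intro!: bexI[of _ h])
  then have "(\<Sum>i=1..r. d i * poly (rate_cofactor i) (- \<rho> h)) = (\<Sum>i=1..r. if i = h then d h * \<delta> else 0)"
    by (intro sum.cong) (auto simp: \<delta>_def)
  then have P: "poly log_deriv_num (- \<rho> h) = - d h * \<delta>"
    using h D by (simp add: log_deriv_num_def poly_sum)
  show ?thesis
  proof (induction k)
    case 0
    show ?case using h rho_pos[OF h] by simp
  next
    case (Suc k)
    have "poly (deriv_num h (Suc k)) (- \<rho> h) = - (real k + 1 + d h) * \<delta> * poly (deriv_num h k) (- \<rho> h)"
      using h by (simp add: D D' P \<delta>_def[symmetric] algebra_simps)
    then show ?case using Suc \<delta> d_nonneg[OF h] by auto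
  qed
qed

end

section \<open>Clearing the denominators for an admissible index\<close>

locale admissible_weight = gamma_weight +
  fixes s Q R0 :: nat and n \<eta> :: "nat \<Rightarrow> nat"
  assumes s_ge_2: "2 \<le> s" and R0_less: "R0 < s" and Q_pos: "1 \<le> Q"
    and eta_eq: "\<And>l. l \<in> {1..s} \<Longrightarrow> \<eta> l = (if l \<le> R0 then Q + 1 else Q)"
    and near: "\<And>i j. i \<in> {1..r+s} \<Longrightarrow> j \<in> {1..r+s} \<Longrightarrow> lam r n \<eta> i \<le> lam r n \<eta> j + 1"
    and inj_rho: "inj_on \<rho> {1..r}"
begin

abbreviation lm where "lm \<equiv> lam r n \<eta>"

lemma lm_low: "j \<in> {1..r} \<Longrightarrow> lm j = n j"
  by (simp add: lam_def)

lemma lm_high: "l \<in> {1..s} \<Longrightarrow> lm (r + l) = \<eta> l"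
  by (simp add: lam_def)

text \<open>Admissibility enters here: the pole of the \<open>k\<close>-th derivative of
  \<open>\<Lambda> j\<close> at \<open>- \<rho> i\<close> has order at most \<open>n i\<close>, so
  \<open>D_poly\<close> clears it.\<close>

lemma order_le_n:
  assumes "j \<in> {1..r+s}" "k < lm j" "i \<in> {1..r}"
  shows "k + (if i = j then 1 else 0) \<le> n i"
proof (cases "i = j")
  case True
  then show ?thesis using assms lm_low[of j] by simp
next
  case False
  have "lm j \<le> lm i + 1" using assms by (intro near) auto
  then show ?thesis using assms(2) lm_low[OF assms(3)] False by simp
qed

definition n_total where "n_total = (\<Sum>i=1..r. n i)"

text \<open>The exponent of \<open>\<rho> i + z\<close> that remains in \<open>D_poly\<close> after
  the denominator has been cleared; by \<open>order_le_n\<close> the subtraction is exact for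
  admissible \<open>(j, k)\<close>.\<close>

definition pole_excess :: "nat \<Rightarrow> nat \<Rightarrow> nat \<Rightarrow> nat" where
  "pole_excess j k i = n i - (k + (if i = j then 1 else 0))"

text \<open>The polynomial \<open>D / L * \<partial>\<^sup>k \<Lambda>\<^sub>j\<close>.\<close>

definition Psi :: "nat \<Rightarrow> nat \<Rightarrow> real poly" where
  "Psi j k = deriv_num j k * (\<Prod>i\<in>{1..r}. [:\<rho> i, 1:] ^ pole_excess j k i)"

lemma D_poly_split:
  assumes "j \<in> {1..r+s}" "k < lm j"
  shows "D_poly r \<rho> n z = poly rate_prod z ^ k * poly (row_den j) z
    * poly (\<Prod>i\<in>{1..r}. [:\<rho> i, 1:] ^ pole_excess j k i) z"
proof -
  have "(\<rho> i + z) ^ n i = (\<rho> i + z) ^ k * (if i = j then \<rho> i + z else 1) * (\<rho> i + z) ^ pole_excess j k i"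
    if "i \<in> {1..r}" for i
  proof -
    have "n i = k + (if i = j then 1 else 0) + pole_excess j k i"
      using order_le_n[OF assms that] by (simp add: pole_excess_def)
    then have "(\<rho> i + z) ^ n i = (\<rho> i + z) ^ (k + (if i = j then 1 else 0) + pole_excess j k i)"
      by (rule arg_cong)
    then show ?thesis unfolding power_add by (cases "i = j") simp_all
  qed
  then have "D_poly r \<rho> n z = (\<Prod>i=1..r. (\<rho> i + z) ^ k * (if i = j then \<rho> i + z else 1) * (\<rho> i + z) ^ pole_excess j k i)"
    unfolding D_poly_def by (intro prod.cong refl)
  also have "\<dots> = (\<Prod>i=1..r. \<rho> i + z) ^ k * (\<Prod>i=1..r. if i = j then \<rho> i + z else 1)
      * (\<Prod>i=1..r. (\<rho> i + z) ^ pole_excess j k i)"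
    by (simp only: prod.distrib prod_power_distrib)
  also have "(\<Prod>i=1..r. if i = j then \<rho> i + z else 1) = poly (row_den j) z"
    using assms(1) by (simp add: row_den_def prod.delta)
  finally show ?thesis by (simp add: rate_prod_def poly_prod)
qed

lemma poly_Psi:
  assumes "j \<in> {1..r+s}" "k < lm j" "z \<in> S"
  shows "poly (Psi j k) z = D_poly r \<rho> n z / L z * (deriv ^^ k) (\<Lambda> j) z"
proof -
  have "poly rate_prod z \<noteq> 0" by (rule rate_prod_nonzero[OF assms(3)])
  moreover have "poly (row_den j) z \<noteq> 0"
    using rate_half_line_pos[OF assms(3), of j] assms(1) by (auto simp: row_den_def)
  ultimately show ?thesis
    using L_pos[OF assms(3)] assms(1)
    by (simp add: D_poly_split[OF assms(1,2)] higher_deriv_Lambda_eq[OF _ assms(3)] Psi_def)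
qed

lemma n_total_split:
  assumes "j \<in> {1..r+s}" "k < lm j"
  shows "n_total = r * k + (if j \<le> r then 1 else 0) + (\<Sum>i=1..r. pole_excess j k i)"
proof -
  have "n_total = (\<Sum>i=1..r. k + (if i = j then 1 else 0) + pole_excess j k i)"
    unfolding n_total_def using order_le_n[OF assms]
    by (intro sum.cong refl) (simp add: pole_excess_def)
  also have "\<dots> = r * k + (\<Sum>i=1..r. if i = j then 1 else 0) + (\<Sum>i=1..r. pole_excess j k i)"
    by (simp add: sum.distrib)
  finally show ?thesis using assms(1) by (simp add: sum.delta)
qed

text \<open>Rows \<open>j \<le> r\<close> lose one degree to their own denominator. The equation for
  \<open>M\<close> adds this 1 on the left instead of subtracting it.\<close>

lemma Psi_top:
  assumes "j \<in> {1..r+s}" "k < lm j"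
    and M: "M + (if j \<le> r then 1 else 0) = n_total + k + row_order j"
  shows "degree (Psi j k) \<le> M" "coeff (Psi j k) M \<noteq> 0"
proof -
  let ?q = "\<Prod>i\<in>{1..r}. [:\<rho> i, 1:] ^ pole_excess j k i"
  have q: "degree ?q = (\<Sum>i=1..r. pole_excess j k i)" "coeff ?q (\<Sum>i=1..r. pole_excess j k i) = 1"
    by (rule degree_prod_linear_power)+
  have M: "M = row_order j + k * (r + 1) + (\<Sum>i=1..r. pole_excess j k i)"
    using M n_total_split[OF assms(1,2)] by (simp split: if_splits)
  show "degree (Psi j k) \<le> M"
    unfolding Psi_def M using deriv_num_top(1)[of j k] q(1)
    by (intro order_trans[OF degree_mult_le]) auto
  have "coeff (Psi j k) M = (if j \<le> r then \<rho> j else (- 1) ^ row_order j) / 2 ^ k"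
    unfolding Psi_def M
    by (subst coeff_mult_top[OF deriv_num_top(1)]) (use q deriv_num_top(2) in auto)
  then show "coeff (Psi j k) M \<noteq> 0" using rho_pos[of j] assms(1) by auto
qed

section \<open>The linear map on component vectors\<close>

definition comp_space :: "(nat \<Rightarrow> real poly) set" where
  "comp_space = {V. (\<forall>j. j \<notin> {1..r+s} \<longrightarrow> V j = 0) \<and> (\<forall>j\<in>{1..r+s}. V j = 0 \<or> degree (V j) < lm j)}"

text \<open>Coefficients are read off up to \<open>lm j\<close>, which makes the map linear on all
  component vectors. On \<open>comp_space\<close> it is \<open>D / L\<close> times the transform of
  the combination of the rows, by \<open>poly_lap_map\<close>.\<close>

definition lap_map :: "(nat \<Rightarrow> real poly) \<Rightarrow> real poly" where
  "lap_map V = (\<Sum>(j, k)\<in>Sigma {1..r+s} (\<lambda>j. {..<lm j}). Polynomial.smult (coeff (V j) k) (Psi j k))"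

lemma comp_space_coeff: "V \<in> comp_space \<Longrightarrow> lm j \<le> k \<Longrightarrow> coeff (V j) k = 0"
  unfolding comp_space_def mem_Collect_eq
  by (metis coeff_0 coeff_eq_0 order.strict_trans2)

lemma comp_spaceI:
  assumes "\<And>j. j \<notin> {1..r+s} \<Longrightarrow> V j = 0" "\<And>j k. j \<in> {1..r+s} \<Longrightarrow> lm j \<le> k \<Longrightarrow> coeff (V j) k = 0"
  shows "V \<in> comp_space"
proof -
  have "degree (V j) < lm j" if "j \<in> {1..r+s}" "V j \<noteq> 0" for j
    using assms(2)[OF that(1), of "degree (V j)"] that(2) by (cases "lm j \<le> degree (V j)") auto
  then show ?thesis unfolding comp_space_def using assms(1) by blast
qed

lemma subspace_comp_space: "comp_vs.subspace comp_space"
  by (rule comp_vs.subspaceI)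
    (auto intro!: comp_spaceI simp: comp_space_coeff comp_scale_def, auto simp: comp_space_def)

lemma lap_map_diff: "lap_map (V - V') = lap_map V - lap_map V'"
  unfolding lap_map_def by (simp add: smult_diff_left sum_subtractf case_prod_unfold)

lemma poly_lap_map:
  assumes V: "V \<in> comp_space" and z: "z \<in> S"
  shows "poly (lap_map V) z = D_poly r \<rho> n z / L z * laplace (\<lambda>t. \<Sum>j=1..r+s. poly (V j) t * U j t) z"
proof -
  have V': "poly (V j) t = (\<Sum>k<lm j. coeff (V j) k * t ^ k)" for j t
  proof -
    have "poly (V j) t = (\<Sum>k\<le>degree (V j). coeff (V j) k * t ^ k)" by (rule poly_altdef)
    also have "\<dots> = (\<Sum>k\<in>{..<lm j} \<union> {..degree (V j)}. coeff (V j) k * t ^ k)"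
      by (rule sum.mono_neutral_left) (auto intro!: coeff_eq_0)
    also have "\<dots> = (\<Sum>k<lm j. coeff (V j) k * t ^ k)"
      by (rule sum.mono_neutral_right) (auto simp: comp_space_coeff[OF V])
    finally show ?thesis .
  qed
  have b: "exp_bounded S (\<lambda>t. coeff (V j) k * (t ^ k * U j t))" if "1 \<le> j" for j k
    by (intro exp_bounded_mult_left exp_bounded_power_mult U_exp_bounded that open_S)
  have lap: "laplace (\<lambda>t. \<Sum>j=1..r+s. poly (V j) t * U j t) z
      = (\<Sum>j=1..r+s. \<Sum>k<lm j. coeff (V j) k * (deriv ^^ k) (\<Lambda> j) z)"
  proof -
    have "laplace (\<lambda>t. \<Sum>j=1..r+s. poly (V j) t * U j t) z
      = laplace (\<lambda>t. \<Sum>j=1..r+s. \<Sum>k<lm j. coeff (V j) k * (t ^ k * U j t)) z"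
    unfolding V' by (simp add: sum_distrib_right mult.assoc)
  also have "\<dots> = (\<Sum>j=1..r+s. laplace (\<lambda>t. \<Sum>k<lm j. coeff (V j) k * (t ^ k * U j t)) z)"
    by (intro laplace_sum exp_bounded_sum b z) auto
  also have "\<dots> = (\<Sum>j=1..r+s. \<Sum>k<lm j. laplace (\<lambda>t. coeff (V j) k * (t ^ k * U j t)) z)"
    by (intro sum.cong laplace_sum b z refl) auto
  also have "\<dots> = (\<Sum>j=1..r+s. \<Sum>k<lm j. coeff (V j) k * (deriv ^^ k) (\<Lambda> j) z)"
    by (intro sum.cong refl) (simp add: laplace_mult_left higher_deriv_Lambda[OF _ z])
    finally show ?thesis .
  qed
  have "D_poly r \<rho> n z / L z * laplace (\<lambda>t. \<Sum>j=1..r+s. poly (V j) t * U j t) z = (\<Sum>j=1..r+s. \<Sum>k<lm j. coeff (V j) k * poly (Psi j k) z)"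
    unfolding lap sum_distrib_left by (intro sum.cong refl) (simp add: poly_Psi[OF _ _ z])
  also have "\<dots> = poly (lap_map V) z"
    unfolding lap_map_def poly_sum by (subst sum.Sigma) (auto intro!: sum.cong)
  finally show ?thesis by simp
qed

lemma poly_eq_on_S:
  assumes "\<And>z. z \<in> S \<Longrightarrow> poly p z = poly q z" shows "p = q"
proof (rule ccontr)
  assume "p \<noteq> q"
  then have "finite {z. poly (p - q) z = 0}" by (intro poly_roots_finite) simp
  moreover have "{0..} \<subseteq> {z. poly (p - q) z = 0}"
    using assms rho_pos by (auto simp: rate_half_line_def add_pos_nonneg)
  ultimately show False using infinite_Ici finite_subset by blast
qed

lemma lap_map_eq_0:
  assumes "V \<in> relation_space r s \<rho> d a n \<eta>" shows "lap_map V = 0"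
proof (rule poly_eq_on_S)
  fix z assume z: "z \<in> S"
  have V: "V \<in> comp_space" using assms by (simp add: relation_space_def comp_space_def)
  show "poly (lap_map V) z = poly 0 z"
    unfolding poly_lap_map[OF V z] using assms by (simp add: relation_space_def laplace_0)
qed

lemma Psi_dvd:
  assumes "h \<in> {1..r}" "e \<le> pole_excess j k h" shows "[:\<rho> h, 1:] ^ e dvd Psi j k"
proof -
  have "[:\<rho> h, 1:] ^ e dvd [:\<rho> h, 1:] ^ pole_excess j k h" using assms(2) by (rule le_imp_power_dvd)
  also have "\<dots> dvd (\<Prod>i\<in>{1..r}. [:\<rho> i, 1:] ^ pole_excess j k i)"
    using assms(1) by (intro dvd_prodI) auto
  finally show ?thesis unfolding Psi_def by (rule dvd_mult)
qed

text \<open>With \<open>Psi_dvd\<close> this fixes the order of vanishing at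
  \<open>- \<rho> h\<close> exactly: neither \<open>deriv_num\<close> nor the factors of the other,
  distinct rates vanish there.\<close>

lemma not_Psi_dvd:
  assumes h: "h \<in> {1..r}" shows "\<not> [:\<rho> h, 1:] ^ Suc (pole_excess h k h) dvd Psi h k"
proof
  let ?X = "[:\<rho> h, 1:]" and ?e = "pole_excess h k"
  let ?q = "deriv_num h k * (\<Prod>i\<in>{1..r} - {h}. [:\<rho> i, 1:] ^ ?e i)"
  assume "?X ^ Suc (?e h) dvd Psi h k"
  moreover have "Psi h k = ?X ^ ?e h * ?q"
    unfolding Psi_def by (subst prod.remove[OF _ h]) (simp_all add: mult_ac)
  ultimately have "?X ^ ?e h * ?X dvd ?X ^ ?e h * ?q" by (simp add: mult.commute)
  then have "?X dvd ?q" by (subst (asm) dvd_times_left_cancel_iff) auto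
  then have "poly ?q (- \<rho> h) = 0" using poly_eq_0_iff_dvd[of ?q "- \<rho> h"] by simp
  moreover have "\<rho> i - \<rho> h \<noteq> 0" if "i \<in> {1..r} - {h}" for i
    using that h inj_onD[OF inj_rho, of i h] by auto
  ultimately show False
    using deriv_num_root[OF h inj_rho, of k] by (simp add: poly_prod poly_power)
qed

text \<open>Comparison of the pole orders at \<open>- \<rho>\<^sub>h\<close>: the coefficient of highest degree in
  the \<open>h\<close>-th component contributes the strictly largest one.\<close>

lemma lap_map_nonzero_pole:
  assumes V: "V \<in> comp_space" and h: "h \<in> {1..r}" "V h \<noteq> 0"
    and max: "\<And>j. j \<in> {1..r+s} \<Longrightarrow> degree (V j) \<le> degree (V h)"
  shows "lap_map V \<noteq> 0"
proof
  define m where "m = degree (V h)"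
  let ?I = "Sigma {1..r+s} (\<lambda>j. {..<lm j})"
  let ?f = "\<lambda>(j, k). Polynomial.smult (coeff (V j) k) (Psi j k)"
  have m: "m < n h" "m < lm h" using V h lm_low[of h] by (auto simp: comp_space_def m_def)
  have c: "coeff (V h) m \<noteq> 0" using h(2) by (simp add: m_def)
  assume "lap_map V = 0"
  then have "0 = sum ?f ?I" by (simp add: lap_map_def)
  also have "\<dots> = ?f (h, m) + sum ?f (?I - {(h, m)})"
    using h(1) m(2) by (intro sum.remove) auto
  finally have "?f (h, m) = - sum ?f (?I - {(h, m)})" by (simp add: eq_neg_iff_add_eq_0)
  moreover have "[:\<rho> h, 1:] ^ Suc (pole_excess h m h) dvd sum ?f (?I - {(h, m)})"
  proof (rule dvd_sum)
    fix x assume "x \<in> ?I - {(h, m)}"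
    moreover obtain j k where "x = (j, k)" by (cases x)
    ultimately have x: "x = (j, k)" "j \<in> {1..r+s}" "k < lm j" "(j, k) \<noteq> (h, m)" by auto
    show "[:\<rho> h, 1:] ^ Suc (pole_excess h m h) dvd ?f x"
    proof (cases "k \<le> degree (V j)")
      case True
      then have "k \<le> m" using max[OF x(2)] by (simp add: m_def)
      \<comment> \<open>Either \<open>j = h\<close> and \<open>k < m\<close>, or \<open>j\<close>
        differs from \<open>h\<close> and the extra pole of row \<open>h\<close> is missing. Since
        \<open>m < n h\<close>, no subtraction is truncated.\<close>
      then have "Suc (pole_excess h m h) \<le> pole_excess j k h"
        using x(4) m(1) by (auto simp: pole_excess_def)
      from Psi_dvd[OF h(1) this] show ?thesis by (simp add: x(1) dvd_smult)
    next
      case False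
      then show ?thesis by (simp add: x(1) coeff_eq_0)
    qed
  qed
  ultimately have "[:\<rho> h, 1:] ^ Suc (pole_excess h m h) dvd Polynomial.smult (coeff (V h) m) (Psi h m)"
    by (simp only: dvd_minus_iff prod.case)
  then have "[:\<rho> h, 1:] ^ Suc (pole_excess h m h) dvd Psi h m"
    using c by (rule dvd_smult_cancel)
  then show False using not_Psi_dvd[OF h(1)] by simp
qed

text \<open>The comparison at infinity: the leading term of component \<open>r + l\<close> alone
  reaches degree \<open>M\<close>. A row \<open>h \<le> r\<close> has degree at most
  \<open>n_total + k - 1\<close>, hence the bound \<open>degree + l\<close> imposed on it
  too.\<close>

lemma lap_map_nonzero_degree:
  assumes V: "V \<in> comp_space" and l: "l \<in> {1..s}" "V (r + l) \<noteq> 0"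
    and low: "\<And>h. h \<in> {1..r} \<Longrightarrow> V h \<noteq> 0 \<Longrightarrow> degree (V h) < degree (V (r + l)) + l"
    and high: "\<And>l'. l' \<in> {1..s} \<Longrightarrow> l' \<noteq> l \<Longrightarrow> V (r + l') \<noteq> 0 \<Longrightarrow>
      degree (V (r + l')) + l' < degree (V (r + l)) + l"
  shows "lap_map V \<noteq> 0"
proof
  define m where "m = degree (V (r + l))"
  define M where "M = n_total + m + (l - 1)"
  let ?I = "Sigma {1..r+s} (\<lambda>j. {..<lm j})"
  let ?f = "\<lambda>(j, k). Polynomial.smult (coeff (V j) k) (Psi j k)"
  have I: "r + l \<in> {1..r+s}" "m < lm (r + l)" using V l by (auto simp: comp_space_def m_def)
  have c: "coeff (V (r + l)) m \<noteq> 0" using l(2) by (simp add: m_def)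
  have "coeff (sum ?f (?I - {(r + l, m)})) M = (\<Sum>x\<in>?I - {(r + l, m)}. 0)"
    unfolding coeff_sum
  proof (rule sum.cong)
    fix x assume "x \<in> ?I - {(r + l, m)}"
    moreover obtain j k where "x = (j, k)" by (cases x)
    ultimately have x: "x = (j, k)" "j \<in> {1..r+s}" "k < lm j" "(j, k) \<noteq> (r + l, m)" by auto
    show "coeff (?f x) M = 0"
    proof (cases "coeff (V j) k = 0")
      case False
      then have Vj: "V j \<noteq> 0" and k: "k \<le> degree (V j)" by (auto intro: le_degree)
      have "degree (Psi j k) < M"
      proof (cases "j \<le> r")
        case True
        then have k': "k < m + l" using low[of j] Vj k x(2) by (simp add: m_def)
        have nt: "1 \<le> n_total" using n_total_split[OF x(2,3)] True by simp
        have "degree (Psi j k) \<le> n_total + k - 1"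
          using nt True by (intro Psi_top(1)[OF x(2,3)]) (simp add: row_order_def)
        also have "\<dots> < M" using k' l(1) nt by (auto simp: M_def)
        finally show ?thesis .
      next
        case False
        define l' where "l' = j - r"
        have j: "j = r + l'" "l' \<in> {1..s}" using False x(2) by (auto simp: l'_def)
        have "k + l' < m + l"
        proof (cases "l' = l")
          case True
          then show ?thesis using x(4) j k by (auto simp: m_def)
        next
          case False
          then show ?thesis using high[of l'] Vj k j by (auto simp: m_def)
        qed
        moreover have "degree (Psi j k) \<le> n_total + k + (l' - 1)"
          using False by (intro Psi_top(1)[OF x(2,3)]) (simp add: row_order_def l'_def)
        ultimately show ?thesis using j(2) l(1) by (auto simp: M_def)
      qed
      then show ?thesis by (simp add: x(1) coeff_eq_0)
    qed (simp add: x(1))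
  qed simp
  moreover have "sum ?f ?I = ?f (r + l, m) + sum ?f (?I - {(r + l, m)})"
    using I by (intro sum.remove) auto
  ultimately have "coeff (sum ?f ?I) M = coeff (V (r + l)) m * coeff (Psi (r + l) m) M"
    by (simp only: coeff_add coeff_smult prod.case add_0_right sum.neutral_const)
  moreover have "coeff (Psi (r + l) m) M \<noteq> 0"
    using l(1) by (intro Psi_top(2)[OF I]) (auto simp: row_order_def M_def)
  moreover assume "lap_map V = 0"
  ultimately show False using c by (simp add: lap_map_def)
qed

text \<open>A complement of the relation space in the space of component vectors.\<close>

definition reduced_space :: "(nat \<Rightarrow> real poly) set" where
  "reduced_space = {V \<in> comp_space. \<forall>l\<in>{1..<s}. degree (V (r + l)) = 0}"

text \<open>If some component \<open>h \<le> r\<close> has degree at least that of the last one, one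
  of maximal degree wins by pole order. Otherwise the last component, if nonzero, wins by degree. If
  it is zero, only constants in derivative rows remain, and the highest row wins.\<close>

lemma lap_map_inj_reduced:
  assumes V: "V \<in> reduced_space" and T: "lap_map V = 0"
  shows "V = 0"
proof -
  have Vc: "V \<in> comp_space" and const: "\<And>l. l \<in> {1..<s} \<Longrightarrow> degree (V (r + l)) = 0"
    using V by (auto simp: reduced_space_def)
  have high: "degree (V j) \<le> degree (V (r + s))" if "j \<in> {1..r+s}" "r < j" for j
  proof (cases "j = r + s")
    case False
    then have "j - r \<in> {1..<s}" using that by auto
    then show ?thesis using const[of "j - r"] that(2) by simp
  qed simp
  let ?H = "{h \<in> {1..r}. V h \<noteq> 0}"
  have A: "degree (V h) < degree (V (r + s))" if h: "h \<in> ?H" for h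
  proof (rule ccontr)
    assume "\<not> ?thesis"
    moreover obtain g where g: "g \<in> ?H" "\<And>i. i \<in> ?H \<Longrightarrow> degree (V i) \<le> degree (V g)"
    proof -
      have "Max ((\<lambda>i. degree (V i)) ` ?H) \<in> (\<lambda>i. degree (V i)) ` ?H" using h by (intro Max_in) auto
      then obtain g where "g \<in> ?H" "degree (V g) = Max ((\<lambda>i. degree (V i)) ` ?H)" by auto
      then show ?thesis by (intro that[of g]) auto
    qed
    ultimately have ge: "degree (V (r + s)) \<le> degree (V g)" using g(2)[OF h] by linarith
    have "degree (V j) \<le> degree (V g)" if "j \<in> {1..r+s}" for j
    proof (cases "j \<le> r")
      case True
      then show ?thesis using that g(2)[of j] by (cases "V j = 0") auto
    qed (use high[OF that] ge in auto)
    then show False using lap_map_nonzero_pole[OF Vc, of g] g(1) T by auto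
  qed
  have top: "V (r + s) = 0"
  proof (rule ccontr)
    assume nz: "V (r + s) \<noteq> 0"
    have "lap_map V \<noteq> 0"
    proof (rule lap_map_nonzero_degree[OF Vc _ nz])
      show "degree (V h) < degree (V (r + s)) + s" if "h \<in> {1..r}" "V h \<noteq> 0" for h
        using A[of h] that by auto
      show "degree (V (r + l')) + l' < degree (V (r + s)) + s" if "l' \<in> {1..s}" "l' \<noteq> s" for l'
        using const[of l'] that by auto
    qed (use s_ge_2 in auto)
    with T show False by simp
  qed
  \<comment> \<open>The zero polynomial has degree 0, so \<open>A\<close> now asks for a degree
    below 0.\<close>
  then have low: "V h = 0" if "h \<in> {1..r}" for h using A[of h] that by auto
  have mid: "V (r + l) = 0" if "l \<in> {1..s}" for l
  proof (rule ccontr)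
    assume "V (r + l) \<noteq> 0"
    define l0 where "l0 = Max {l \<in> {1..s}. V (r + l) \<noteq> 0}"
    have "l0 \<in> {l \<in> {1..s}. V (r + l) \<noteq> 0}"
      unfolding l0_def using that \<open>V (r + l) \<noteq> 0\<close> by (intro Max_in) auto
    then have l0: "l0 \<in> {1..s}" "V (r + l0) \<noteq> 0" by auto
    have le: "l' \<le> l0" if "l' \<in> {1..s}" "V (r + l') \<noteq> 0" for l'
      unfolding l0_def using that by (intro Max_ge) auto
    have d0: "degree (V (r + l')) = 0" if "l' \<in> {1..s}" for l'
      using const[of l'] top that by (cases "l' = s") auto
    have "lap_map V \<noteq> 0"
    proof (rule lap_map_nonzero_degree[OF Vc l0])
      show "degree (V (r + l')) + l' < degree (V (r + l0)) + l0"
        if "l' \<in> {1..s}" "l' \<noteq> l0" "V (r + l') \<noteq> 0" for l'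
        using le[OF that(1,3)] that(2) d0[OF that(1)] d0[OF l0(1)] by simp
    qed (use low in auto)
    with T show False by simp
  qed
  show "V = 0"
  proof
    fix j
    consider "j \<notin> {1..r+s}" | "j \<in> {1..r}" | l where "j = r + l" "l \<in> {1..s}"
    proof (cases "r < j \<and> j \<le> r + s")
      case True
      then have "j = r + (j - r)" "j - r \<in> {1..s}" by auto
      then show ?thesis by (rule that(3))
    qed (use that in force)
    then show "V j = 0 j"
      using Vc low mid by cases (auto simp: comp_space_def)
  qed
qed

end

section \<open>Hermite polynomials\<close>

text \<open>Evaluation at 0 gives the first coefficient; termwise differentiation reduces every
  other one to it.\<close>

lemma power_series_zero_coeffs:
  fixes c :: "nat \<Rightarrow> real"
  assumes "\<And>z. (\<lambda>m. c m * z ^ m) sums 0" shows "c m = 0"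
  using assms
proof (induction m arbitrary: c)
  case 0
  from powser_sums_zero[of c] 0[of 0] show ?case by (simp add: sums_iff)
next
  case (Suc m)
  have "(\<lambda>i. diffs c i * z ^ i) sums 0" for z
    by (rule termdiffs_sums_strong[of "\<bar>z\<bar> + 1" c "\<lambda>_. 0"]) (use Suc.prems in auto)
  then have "diffs c m = 0" by (rule Suc.IH)
  then show ?case by (simp add: diffs_def)
qed

lemma monic_hermite_0: "monic_hermite 0 = 1"
proof -
  have "poly (monic_hermite 0) u = 1" for u
    using powser_sums_zero[of "\<lambda>l. poly (monic_hermite l) u / fact l"] monic_hermite_sums[of u 0]
    by (simp add: sums_iff)
  then show ?thesis by (simp add: poly_eq_poly_eq_iff[symmetric] fun_eq_iff)
qed

text \<open>The generating function satisfies \<open>e' = (u - z / 2) e\<close>; comparing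
  coefficients gives the three-term recurrence.\<close>

lemma monic_hermite_Suc:
  "monic_hermite (Suc l) = [:0, 1:] * monic_hermite l - Polynomial.smult (real l / 2) (monic_hermite (l - 1))"
proof -
  have "poly (monic_hermite (Suc l)) u = u * poly (monic_hermite l) u - real l / 2 * poly (monic_hermite (l - 1)) u" for u
  proof -
    define c where "c l = poly (monic_hermite l) u / fact l" for l
    let ?e = "\<lambda>z. exp (u * z - z\<^sup>2 / 4)"
    have c: "(\<lambda>l. c l * z ^ l) sums ?e z" for z
      using monic_hermite_sums[of u z] by (simp add: c_def field_simps)
    have 1: "(\<lambda>l. diffs c l * z ^ l) sums ((u - z / 2) * ?e z)" for z
    proof (rule termdiffs_sums_strong[of "\<bar>z\<bar> + 1" c ?e])
      show "(?e has_field_derivative (u - z / 2) * ?e z) (at z)"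
        by (auto intro!: derivative_eq_intros simp: field_simps)
    qed (use c in auto)
    \<comment> \<open>These are the coefficients of \<open>z / 2\<close> times the generating
      function, hence the index shift.\<close>
    define b where "b l = (if l = 0 then 0 else c (l - 1) / 2)" for l
    have 2: "(\<lambda>l. b l * z ^ l) sums (z / 2 * ?e z)" for z
    proof -
      have "(\<lambda>l. z / 2 * (c l * z ^ l)) sums (z / 2 * ?e z)" by (rule sums_mult[OF c])
      then have "(\<lambda>l. b (Suc l) * z ^ Suc l) sums (z / 2 * ?e z)" by (simp add: b_def mult_ac)
      then show ?thesis by (subst (asm) sums_Suc_iff) (simp add: b_def)
    qed
    have "(\<lambda>l. (diffs c l - (u * c l - b l)) * z ^ l) sums 0" for z
      using sums_diff[OF 1[of z] sums_diff[OF sums_mult[OF c[of z], of u] 2[of z]]]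
      by (simp add: algebra_simps)
    then have "diffs c l - (u * c l - b l) = 0" by (rule power_series_zero_coeffs)
    moreover have "diffs c l = poly (monic_hermite (Suc l)) u / fact l"
      by (simp add: diffs_def c_def del: of_nat_Suc)
    moreover have "b l = real l / 2 * poly (monic_hermite (l - 1)) u / fact l"
      by (cases l) (simp_all add: b_def c_def field_simps del: of_nat_Suc)
    ultimately show ?thesis by (simp add: c_def field_simps)
  qed
  then show ?thesis by (simp add: poly_eq_poly_eq_iff[symmetric] fun_eq_iff)
qed

lemma monic_hermite_monic: "degree (monic_hermite l) = l \<and> coeff (monic_hermite l) l = 1"
proof (induction l rule: less_induct)
  case (less l)
  show ?case
  proof (cases l)
    case 0
    then show ?thesis by (simp add: monic_hermite_0)
  next
    case (Suc m)
    let ?p = "[:0, 1:] * monic_hermite m" and ?q = "Polynomial.smult (real m / 2) (monic_hermite (m - 1))"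
    have m: "degree (monic_hermite m) = m" "coeff (monic_hermite m) m = 1" using less[of m] Suc by auto
    then have "monic_hermite m \<noteq> 0" by auto
    then have p: "degree ?p = Suc m" "coeff ?p (Suc m) = 1" using m by simp_all
    have "degree (monic_hermite (m - 1)) = m - 1" using less[of "m - 1"] Suc by simp
    then have q: "degree ?q < Suc m" using degree_smult_le[of "real m / 2" "monic_hermite (m - 1)"] by linarith
    have "monic_hermite (Suc m) = ?p + - ?q" using monic_hermite_Suc[of m] by simp
    moreover have "degree (?p + - ?q) = Suc m" using p q by (subst degree_add_eq_left) simp_all
    moreover have "coeff (?p + - ?q) (Suc m) = 1"
      using p(2) coeff_eq_0[OF q] by (simp only: coeff_add coeff_minus)
    ultimately show ?thesis using Suc by simp
  qed
qed

lemmas degree_monic_hermite = monic_hermite_monic[THEN conjunct1]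
  and coeff_monic_hermite = monic_hermite_monic[THEN conjunct2]

lemma hermite_expansion_exists:
  assumes "\<And>k. m \<le> k \<Longrightarrow> coeff p k = 0"
  shows "\<exists>c. p = (\<Sum>k<m. Polynomial.smult (c k) (monic_hermite k))"
  using assms
proof (induction m arbitrary: p)
  case 0
  then show ?case by (simp add: poly_eq_iff)
next
  case (Suc m)
  define q where "q = p - Polynomial.smult (coeff p m) (monic_hermite m)"
  have "coeff q k = 0" if "m \<le> k" for k
  proof (cases "k = m")
    case False
    then have "degree (monic_hermite m) < k" using that by (simp add: degree_monic_hermite)
    then show ?thesis using Suc.prems[of k] that False by (simp add: q_def coeff_eq_0)
  qed (simp add: q_def coeff_monic_hermite)
  from Suc.IH[OF this] obtain c where c: "q = (\<Sum>k<m. Polynomial.smult (c k) (monic_hermite k))" by blast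
  have "p = q + Polynomial.smult (coeff p m) (monic_hermite m)" by (simp add: q_def)
  also have "\<dots> = (\<Sum>k<Suc m. Polynomial.smult ((c(m := coeff p m)) k) (monic_hermite k))"
    by (simp add: c)
  finally show ?case by blast
qed

lemma hermite_sum_eq_0:
  assumes "(\<Sum>k<m. Polynomial.smult (c k) (monic_hermite k)) = 0" "k < m"
  shows "c k = 0"
proof (rule ccontr)
  assume "c k \<noteq> 0"
  define i where "i = Max {k \<in> {..<m}. c k \<noteq> 0}"
  have i: "i \<in> {k \<in> {..<m}. c k \<noteq> 0}"
    unfolding i_def using assms(2) \<open>c k \<noteq> 0\<close> by (intro Max_in) auto
  have le: "c k = 0" if "i < k" "k < m" for k
  proof (rule ccontr)
    assume "c k \<noteq> 0"
    then have "k \<le> i" unfolding i_def using that by (intro Max_ge) auto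
    then show False using that by simp
  qed
  have "0 = coeff (\<Sum>k<m. Polynomial.smult (c k) (monic_hermite k)) i" by (simp add: assms(1))
  also have "\<dots> = (\<Sum>k<m. c k * coeff (monic_hermite k) i)" by (simp add: coeff_sum)
  also have "\<dots> = (\<Sum>k<m. if k = i then c i else 0)"
  proof (rule sum.cong)
    fix k assume "k \<in> {..<m}"
    then show "c k * coeff (monic_hermite k) i = (if k = i then c i else 0)"
      using le[of k] by (cases k i rule: linorder_cases)
        (simp_all add: coeff_eq_0 degree_monic_hermite coeff_monic_hermite)
  qed simp
  also have "\<dots> = c i" using i by simp
  finally show False using i by simp
qed

lemma inj_monic_hermite: "inj monic_hermite"
  by (rule injI) (metis degree_monic_hermite)

section \<open>Finite families in a vector space\<close>

context vector_space
begin

text \<open>Coefficients are indexed by \<open>I\<close> rather than by vectors, so repetitions are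
  excluded too and the size of the image is known.\<close>

lemma independent_family:
  assumes "finite I"
    and zero: "\<And>c. (\<Sum>i\<in>I. scale (c i) (v i)) = 0 \<Longrightarrow> \<forall>i\<in>I. c i = 0"
  shows "inj_on v I" "independent (v ` I)"
proof -
  show inj: "inj_on v I"
  proof (rule inj_onI, rule ccontr)
    fix i j assume ij: "i \<in> I" "j \<in> I" "v i = v j" "i \<noteq> j"
    define c where "c k = (if k = i then 1 else if k = j then - 1 else (0 :: 'a))" for k
    have "(\<Sum>k\<in>I. scale (c k) (v k)) = (\<Sum>k\<in>{i, j}. scale (c k) (v k))"
      using ij assms(1) by (intro sum.mono_neutral_right) (auto simp: c_def)
    also have "\<dots> = 0" using ij by (simp add: c_def)
    finally have "c i = 0" using zero[of c] ij(1) by blast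
    then show False by (simp add: c_def)
  qed
  show "independent (v ` I)"
  proof (rule independent_if_scalars_zero)
    fix f x assume "(\<Sum>x\<in>v ` I. scale (f x) x) = 0" and x: "x \<in> v ` I"
    then have "(\<Sum>i\<in>I. scale (f (v i)) (v i)) = 0" by (simp add: sum.reindex[OF inj])
    from zero[OF this] x show "f x = 0" by auto
  qed (use assms(1) in simp)
qed

text \<open>A vector outside the span of \<open>A\<close> would extend \<open>A\<close> to an
  independent set larger than the spanning set \<open>T\<close>.\<close>

lemma independent_spans:
  assumes "finite T" "independent A" "A \<subseteq> span T" "card T \<le> card A"
  shows "span T \<subseteq> span A"
proof (rule ccontr)
  assume "\<not> ?thesis"
  then obtain x where x: "x \<in> span T" "x \<notin> span A" by blast
  then have 1: "independent (insert x A)" using assms(2) by (simp add: independent_insert)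
  have 2: "insert x A \<subseteq> span T" using x assms(3) by simp
  have "x \<notin> A" using x(2) span_base by blast
  then show False using independent_span_bound[OF assms(1) 1 2] assms(4) by auto
qed

end

lemma hermite_independent: "poly_vs.independent (range monic_hermite)"
proof
  assume "poly_vs.dependent (range monic_hermite)"
  then obtain T u v where T: "finite T" "T \<subseteq> range monic_hermite"
      "(\<Sum>p\<in>T. Polynomial.smult (u p) p) = 0" "v \<in> T" "u v \<noteq> 0"
    unfolding poly_vs.dependent_explicit by blast
  from finite_subset_image[OF T(1,2)] obtain K where K: "finite K" "T = monic_hermite ` K" by blast
  then obtain m where "K \<subseteq> {..<m}" using finite_nat_iff_bounded by blast
  then have "T \<subseteq> monic_hermite ` {..<m}" using K(2) by blast
  moreover have "poly_vs.independent (monic_hermite ` {..<m})"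
    using hermite_sum_eq_0 by (intro poly_vs.independent_family(2)) auto
  ultimately show False using poly_vs.independentD[OF _ T(1) _ T(3,4)] T(5) by blast
qed

definition hermite_coeff :: "real poly \<Rightarrow> nat \<Rightarrow> real" where
  "hermite_coeff p k = poly_vs.representation (range monic_hermite) p (monic_hermite k)"

lemma hermite_span: "poly_vs.span (range monic_hermite) = UNIV"
proof -
  have "p \<in> poly_vs.span (range monic_hermite)" for p
  proof -
    have "\<exists>c. p = (\<Sum>k<degree p + 1. Polynomial.smult (c k) (monic_hermite k))"
      by (rule hermite_expansion_exists) (simp add: coeff_eq_0)
    then obtain c where c: "p = (\<Sum>k<degree p + 1. Polynomial.smult (c k) (monic_hermite k))" by blast
    show ?thesis
      by (subst c) (intro poly_vs.span_sum poly_vs.span_scale poly_vs.span_base rangeI)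
  qed
  then show ?thesis by blast
qed

lemma hermite_coeff_add: "hermite_coeff (p + q) k = hermite_coeff p k + hermite_coeff q k"
  unfolding hermite_coeff_def
  by (subst poly_vs.representation_add[OF hermite_independent]) (simp_all add: hermite_span)

lemma hermite_coeff_smult: "hermite_coeff (Polynomial.smult c p) k = c * hermite_coeff p k"
  unfolding hermite_coeff_def
  by (subst poly_vs.representation_scale[OF hermite_independent]) (simp_all add: hermite_span)

lemma hermite_coeff_sum:
  "hermite_coeff (\<Sum>i<m. Polynomial.smult (c i) (monic_hermite i)) k = (if k < m then c k else 0)"
proof -
  have "hermite_coeff (monic_hermite i) k = (if i = k then 1 else 0)" for i
    unfolding hermite_coeff_def
    using inj_monic_hermite
    by (subst poly_vs.representation_basis[OF hermite_independent]) (auto dest: injD)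
  moreover have "hermite_coeff 0 k = 0"
    by (simp add: hermite_coeff_def poly_vs.representation_zero)
  ultimately show ?thesis
    by (induction m) (auto simp: hermite_coeff_add hermite_coeff_smult less_Suc_eq)
qed

lemma hermite_expansion:
  assumes "\<And>k. m \<le> k \<Longrightarrow> coeff p k = 0"
  shows "p = (\<Sum>k<m. Polynomial.smult (hermite_coeff p k) (monic_hermite k))"
proof -
  obtain c where c: "p = (\<Sum>k<m. Polynomial.smult (c k) (monic_hermite k))"
    using hermite_expansion_exists[of m p] assms by blast
  have "hermite_coeff p k = c k" if "k < m" for k
    using hermite_coeff_sum[of c m k] that unfolding c[symmetric] by simp
  then show ?thesis by (subst c) (intro sum.cong, auto)
qed

lemma fun_sum_apply: "(\<Sum>x\<in>A. f x) j = (\<Sum>x\<in>A. f x j)"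
  by (induction A rule: infinite_finite_induct) auto

context admissible_weight
begin

section \<open>The relation space\<close>

abbreviation rv where "rv \<equiv> r_vec r s \<rho> d a"
abbreviation rs where "rs \<equiv> r_shift r s \<rho> d a"
abbreviation W where "W \<equiv> relation_space r s \<rho> d a n \<eta>"

text \<open>\<open>b + 2 \<le> \<eta> (k + 1)\<close> expresses
  \<open>b \<le> \<eta> (k + 1) - 2\<close> without truncated subtraction.\<close>

definition shift_indices :: "(nat \<times> nat) set" where
  "shift_indices = {(k, b). k \<le> s - 2 \<and> b + 2 \<le> \<eta> (k + 1)}"

text \<open>The only nonconstant entry of \<open>rv k\<close> is \<open>2 (t - a)\<close>, in the
  position of the \<open>k\<close>-th derivative of \<open>F\<close>. Independence and reduction
  both rest on this.\<close>

lemma coeff_rv: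
  assumes "k + 1 \<le> s" "1 \<le> i"
  shows "coeff (rv k j) i = (if j = r + k + 1 \<and> i = 1 then 2 else 0)"
proof -
  have c: "coeff [:x:] i = 0" for x :: real using assms(2) by (cases i) auto
  have "coeff [:- 2 * a, 2:] i = (if i = 1 then 2 else 0)"
    using assms(2) by (auto simp: coeff_pCons split: nat.splits)
  moreover have "coeff 1 i = (0::real)" using assms(2) by simp
  ultimately show ?thesis using assms(1) c
    by (auto simp: r_vec_def Let_def simp del: coeff_pCons_Suc coeff_pCons_0)
qed

lemma coeff_rs:
  assumes "k + 1 \<le> s" "b + 1 \<le> i"
  shows "coeff (rs k b j) i = (if j = r + k + 1 \<and> i = b + 1 then 2 else 0)"
  using coeff_rv[OF assms(1), of "i - b" j] assms(2)
  by (auto simp: r_shift_def coeff_monom_mult)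

text \<open>The entry at \<open>r + k + 1\<close> has degree \<open>b + 1\<close>, all others at
  most \<open>b\<close>; they fit because entries of the index differ by at most one.\<close>

lemma rs_comp_space:
  assumes "(k, b) \<in> shift_indices" shows "rs k b \<in> comp_space"
proof (rule comp_spaceI)
  from assms have k: "k + 2 \<le> s" "b + 2 \<le> \<eta> (k + 1)" using s_ge_2 by (auto simp: shift_indices_def)
  have e: "lm (r + (k + 1)) = \<eta> (k + 1)" using k by (intro lm_high) auto
  show "rs k b j = 0" if "j \<notin> {1..r+s}" for j using that by (auto simp: r_shift_def r_vec_def)
  show "coeff (rs k b j) i = 0" if j: "j \<in> {1..r+s}" and i: "lm j \<le> i" for j i
  proof -
    have "lm (r + (k + 1)) \<le> lm j + 1" using j k by (intro near) auto
    then have "b + 1 \<le> i" using e k i by simp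
    moreover have "\<not> (j = r + k + 1 \<and> i = b + 1)" using e k i by auto
    ultimately show ?thesis using coeff_rs[of k b i j] k by auto
  qed
qed

lemma relation_space_eq:
  "W = {V \<in> comp_space. \<forall>t. (\<Sum>j=1..r+s. poly (V j) t * U j t) = 0}"
  unfolding relation_space_def comp_space_def by auto

lemma rs_relation:
  assumes "(k, b) \<in> shift_indices" shows "rs k b \<in> W"
proof -
  have "k + 2 \<le> s" using assms s_ge_2 by (auto simp: shift_indices_def)
  from sum_r_vec_eq_0[OF this]
  have "(\<Sum>j=1..r+s. poly (rs k b j) t * U j t) = 0" for t
    by (simp add: r_shift_def mult.assoc flip: sum_distrib_left)
  then show ?thesis using rs_comp_space[OF assms] by (simp add: relation_space_eq)
qed

lemma subspace_W: "comp_vs.subspace W"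
proof (rule comp_vs.subspaceI)
  show "0 \<in> W" using comp_vs.subspace_0[OF subspace_comp_space] by (simp add: relation_space_eq)
  show "V + V' \<in> W" if "V \<in> W" "V' \<in> W" for V V'
    using that comp_vs.subspace_add[OF subspace_comp_space, of V V']
    by (simp add: relation_space_eq ring_distribs sum.distrib)
  show "comp_scale c V \<in> W" if "V \<in> W" for c V
    using that comp_vs.subspace_scale[OF subspace_comp_space, of V c]
    by (simp add: relation_space_eq comp_scale_def mult.assoc flip: sum_distrib_left)
qed

definition B where "B = (\<lambda>(k, b). rs k b) ` shift_indices"

lemma finite_shift_indices: "finite shift_indices"
proof (rule finite_subset)
  show "shift_indices \<subseteq> {..s} \<times> {..Q + 1}"
  proof
    fix x assume "x \<in> shift_indices"
    then obtain k b where x: "x = (k, b)" "k \<le> s - 2" "b + 2 \<le> \<eta> (k + 1)"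
      by (auto simp: shift_indices_def)
    then have "\<eta> (k + 1) \<le> Q + 1" using eta_eq[of "k + 1"] s_ge_2 by simp
    then show "x \<in> {..s} \<times> {..Q + 1}" using x by auto
  qed
qed simp

lemma B_subset_W: "B \<subseteq> W"
  using rs_relation by (auto simp: B_def)

lemma B_span_subset_W: "comp_vs.span B \<subseteq> W"
  using B_subset_W subspace_W by (rule comp_vs.span_minimal)

text \<open>For the largest shift \<open>b0\<close> with a nonzero coefficient, the coefficient of
  \<open>t ^ (b0 + 1)\<close> in component \<open>r + k0 + 1\<close> sees the single vector
  \<open>rs k0 b0\<close>.\<close>

lemma B_independent: "comp_vs.independent B"
  unfolding B_def
proof (rule comp_vs.independent_family(2)[OF finite_shift_indices], rule ccontr)
  fix c :: "nat \<times> nat \<Rightarrow> real"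
  assume zero: "(\<Sum>x\<in>shift_indices. comp_scale (c x) (case x of (k, b) \<Rightarrow> rs k b)) = 0"
    and nz: "\<not> (\<forall>x\<in>shift_indices. c x = 0)"
  let ?A = "{x \<in> shift_indices. c x \<noteq> 0}"
  define b0 where "b0 = Max (snd ` ?A)"
  have "b0 \<in> snd ` ?A" unfolding b0_def using nz finite_shift_indices by (intro Max_in) auto
  then obtain k0 where k0: "(k0, b0) \<in> shift_indices" "c (k0, b0) \<noteq> 0" by auto
  have le: "b \<le> b0" if "(k, b) \<in> shift_indices" "c (k, b) \<noteq> 0" for k b
    unfolding b0_def using that finite_shift_indices by (intro Max_ge) force+
  have "0 = coeff ((\<Sum>x\<in>shift_indices. comp_scale (c x) (case x of (k, b) \<Rightarrow> rs k b)) (r + k0 + 1)) (b0 + 1)"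
    unfolding zero by simp
  also have "\<dots> = (\<Sum>x\<in>shift_indices. c x * coeff ((case x of (k, b) \<Rightarrow> rs k b) (r + k0 + 1)) (b0 + 1))"
    by (simp add: fun_sum_apply comp_scale_def coeff_sum)
  also have "\<dots> = (\<Sum>x\<in>shift_indices. if x = (k0, b0) then 2 * c (k0, b0) else 0)"
  proof (rule sum.cong)
    fix x assume x: "x \<in> shift_indices"
    obtain k b where kb: "x = (k, b)" by (cases x)
    have k: "k + 1 \<le> s" using x kb s_ge_2 by (auto simp: shift_indices_def)
    show "c x * coeff ((case x of (k, b) \<Rightarrow> rs k b) (r + k0 + 1)) (b0 + 1)
      = (if x = (k0, b0) then 2 * c (k0, b0) else 0)"
    proof (cases "c x = 0")
      case False
      then have "b + 1 \<le> b0 + 1" using le[of k b] x kb by simp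
      from coeff_rs[OF k this] show ?thesis by (auto simp: kb)
    qed (use k0 in auto)
  qed simp
  also have "\<dots> = 2 * c (k0, b0)" using k0(1) finite_shift_indices by (simp add: sum.delta)
  finally show False using k0(2) by simp
qed

text \<open>One step lowers the degree bound of all components \<open>r + l\<close> with
  \<open>l < s\<close> at once: in degrees above \<open>e\<close> the shift
  \<open>rs (l - 1) e\<close> touches no component but \<open>r + l\<close>.\<close>

lemma reduction:
  assumes "V \<in> comp_space" "\<And>l. l \<in> {1..<s} \<Longrightarrow> degree (V (r + l)) \<le> e"
  shows "\<exists>b\<in>comp_vs.span B. V - b \<in> reduced_space"
  using assms
proof (induction e arbitrary: V)
  case 0
  then have "V - 0 \<in> reduced_space" by (auto simp: reduced_space_def)
  then show ?case using comp_vs.span_zero by blast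
next
  case (Suc e)
  \<comment> \<open>The division by 2 compensates the leading coefficient 2 of
    \<open>rs (l - 1) e\<close> in component \<open>r + l\<close>.\<close>
  define c where "c l = coeff (V (r + l)) (e + 1) / 2" for l
  define b where "b = (\<Sum>l\<in>{1..<s}. comp_scale (c l) (rs (l - 1) e))"
  have b: "b \<in> comp_vs.span B"
    unfolding b_def
  proof (rule comp_vs.span_sum)
    fix l assume l: "l \<in> {1..<s}"
    show "comp_scale (c l) (rs (l - 1) e) \<in> comp_vs.span B"
    \<comment> \<open>The vector \<open>rs (l - 1) e\<close> may lie outside \<open>B\<close>, but
      only where the coefficient to be removed is already zero.\<close>
    proof (cases "c l = 0")
      case True
      then have 0: "comp_scale (c l) (rs (l - 1) e) = 0" by simp
      show ?thesis unfolding 0 by (rule comp_vs.span_zero)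
    next
      case False
      then have "\<not> lm (r + l) \<le> e + 1" using comp_space_coeff[OF Suc.prems(1)] by (auto simp: c_def)
      moreover have "lm (r + l) = \<eta> l" using l by (intro lm_high) auto
      ultimately have "(l - 1, e) \<in> shift_indices" using l by (auto simp: shift_indices_def)
      then have "rs (l - 1) e \<in> B" by (force simp: B_def)
      then show ?thesis by (intro comp_vs.span_scale comp_vs.span_base)
    qed
  qed
  have Vb: "V - b \<in> comp_space"
    using comp_vs.subspace_diff[OF subspace_comp_space Suc.prems(1)] b B_span_subset_W
    by (auto simp: relation_space_eq)
  have "degree ((V - b) (r + l)) \<le> e" if l: "l \<in> {1..<s}" for l
  proof (rule degree_le, intro allI impI)
    fix i assume i: "e < i"
    have "coeff (b (r + l)) i = (\<Sum>l'\<in>{1..<s}. c l' * coeff (rs (l' - 1) e (r + l)) i)"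
      by (simp add: b_def fun_sum_apply comp_scale_def coeff_sum)
    also have "\<dots> = (\<Sum>l'\<in>{1..<s}. if l' = l then (if i = e + 1 then 2 * c l else 0) else 0)"
    proof (rule sum.cong)
      fix l' assume l': "l' \<in> {1..<s}"
      show "c l' * coeff (rs (l' - 1) e (r + l)) i = (if l' = l then (if i = e + 1 then 2 * c l else 0) else 0)"
        using coeff_rs[of "l' - 1" e i "r + l"] l' l i by auto
    qed simp
    also have "\<dots> = (if i = e + 1 then 2 * c l else 0)" using l by (simp add: sum.delta)
    finally have bi: "coeff (b (r + l)) i = (if i = e + 1 then 2 * c l else 0)" .
    show "coeff ((V - b) (r + l)) i = 0"
    proof (cases "i = e + 1")
      case True
      then show ?thesis using bi by (simp add: c_def)
    next
      case False
      then have "coeff (V (r + l)) i = 0" using Suc.prems(2)[OF l] i by (intro coeff_eq_0) auto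
      then show ?thesis using bi False by simp
    qed
  qed
  from Suc.IH[OF Vb this] obtain b' where b': "b' \<in> comp_vs.span B" "V - b - b' \<in> reduced_space" by blast
  have "V - (b + b') \<in> reduced_space" using b'(2) by (simp add: diff_diff_eq)
  moreover have "b + b' \<in> comp_vs.span B" using b b'(1) by (rule comp_vs.span_add)
  ultimately show ?case by blast
qed

lemma lap_map_kernel:
  assumes V: "V \<in> comp_space" and T: "lap_map V = 0"
  shows "V \<in> comp_vs.span B"
proof -
  have "degree (V (r + l)) \<le> (\<Sum>l\<in>{1..<s}. degree (V (r + l)))" if "l \<in> {1..<s}" for l
    using that by (intro member_le_sum) auto
  from reduction[OF V this] obtain b where b: "b \<in> comp_vs.span B" "V - b \<in> reduced_space" by blast
  have "lap_map b = 0" using b(1) B_span_subset_W by (intro lap_map_eq_0) auto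
  then have "lap_map (V - b) = 0" by (simp add: lap_map_diff T)
  from lap_map_inj_reduced[OF b(2) this] show ?thesis using b(1) by simp
qed

lemma W_eq_span_B: "W = comp_vs.span B"
proof
  show "W \<subseteq> comp_vs.span B"
    using lap_map_kernel lap_map_eq_0 by (auto simp: relation_space_eq)
qed (rule B_span_subset_W)

lemma W_eq_kernel: "W = {V \<in> comp_space. lap_map V = 0}"
  using lap_map_kernel lap_map_eq_0 B_span_subset_W by (auto simp: relation_space_eq)

section \<open>The span of the polynomials\<close>

abbreviation \<Phi> where "\<Phi> \<equiv> Phi r \<rho> d a n"

text \<open>The description in \<open>Phi\<close> has exactly one solution, because two polynomials
  that agree on \<open>S\<close> are equal.\<close>

lemma Phi_eq:
  assumes j: "j \<in> {1..r+s}" and k: "k < lm j"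
  shows "\<Phi> j k = (\<Sum>i\<le>k. Polynomial.smult (coeff (monic_hermite k) i) (Psi j i))" (is "_ = ?p")
proof -
  have p: "poly ?p z = D_poly r \<rho> n z / L z * diff_op (monic_hermite k) (\<Lambda> j) z" if z: "z \<in> S" for z
    using k by (simp add: poly_sum diff_op_def degree_monic_hermite sum_distrib_left poly_Psi[OF j _ z] mult_ac)
  show ?thesis
    unfolding Phi_def
  proof (rule the_equality)
    show "\<forall>z. (\<forall>h\<in>{1..r}. 0 < \<rho> h + z) \<longrightarrow>
        poly ?p z = D_poly r \<rho> n z / L z * diff_op (monic_hermite k) (\<Lambda> j) z"
      using p by (simp add: rate_half_line_def)
    show "q = ?p" if "\<forall>z. (\<forall>h\<in>{1..r}. 0 < \<rho> h + z) \<longrightarrow>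
        poly q z = D_poly r \<rho> n z / L z * diff_op (monic_hermite k) (\<Lambda> j) z" for q
    proof (rule poly_eq_on_S)
      fix z assume z: "z \<in> S"
      then have "poly q z = D_poly r \<rho> n z / L z * diff_op (monic_hermite k) (\<Lambda> j) z"
        using that by (simp add: rate_half_line_def)
      then show "poly q z = poly ?p z" using p[OF z] by simp
    qed
  qed
qed

text \<open>The free coefficients of a vector in \<open>reduced_space\<close>; the last component
  has \<open>\<eta> s = Q\<close> of them.\<close>

definition reduced_indices :: "(nat \<times> nat) set" where
  "reduced_indices = (SIGMA j:{1..r}. {..<n j}) \<union> (\<lambda>l. (r + l, 0)) ` {1..<s} \<union> Pair (r + s) ` {..<Q}"

text \<open>The number of reduced indices, which turns out to be the rank
  \<open>N - \<kappa>\<close>.\<close>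

definition image_dim :: nat where
  "image_dim = n_total + Q + s - 1"

lemma eta_s: "\<eta> s = Q" using eta_eq[of s] R0_less s_ge_2 by simp

lemma lm_high_bounds: "l \<in> {1..s} \<Longrightarrow> Q \<le> lm (r + l) \<and> lm (r + l) \<le> Q + 1"
  using lm_high[of l] eta_eq[of l] by simp

lemma reduced_indices_subset: "reduced_indices \<subseteq> Sigma {1..r+s} (\<lambda>j. {..<lm j})"
proof -
  have "0 < lm (r + l)" if "l \<in> {1..<s}" for l using lm_high_bounds[of l] Q_pos that by auto
  moreover have "lm (r + s) = Q" using lm_high[of s] eta_s s_ge_2 by simp
  ultimately show ?thesis using lm_low s_ge_2 by (auto simp: reduced_indices_def)
qed

lemma card_reduced_indices: "finite reduced_indices \<and> card reduced_indices = image_dim"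
proof -
  let ?A = "SIGMA j:{1..r}. {..<n j}" and ?B = "(\<lambda>l. (r + l, 0::nat)) ` {1..<s}" and ?C = "Pair (r + s) ` {..<Q}"
  have A: "finite ?A" "card ?A = n_total" by (simp_all add: n_total_def)
  have B: "finite ?B" "card ?B = s - 1" by (simp_all add: card_image inj_on_def)
  have C: "finite ?C" "card ?C = Q" by (simp_all add: card_image inj_on_def)
  have "card (?A \<union> ?B) = n_total + (s - 1)"
    using A B by (subst card_Un_disjoint) auto
  then have "card (?A \<union> ?B \<union> ?C) = n_total + (s - 1) + Q"
    using A B C s_ge_2 by (subst card_Un_disjoint) auto
  then show ?thesis using A(1) B(1) C(1) s_ge_2 by (simp add: reduced_indices_def image_dim_def)
qed

text \<open>The bound matches the count of reduced indices. For \<open>l \<le> R0 < s\<close> an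
  additional power of \<open>t\<close> is allowed, but \<open>l\<close> is smaller by at least one,
  so \<open>k + l \<le> Q + s - 1\<close> in either case.\<close>

lemma Psi_degree:
  assumes j: "j \<in> {1..r+s}" and k: "k < lm j" shows "degree (Psi j k) < image_dim"
proof (cases "j \<le> r")
  case True
  have nt: "1 \<le> n_total" using n_total_split[OF j k] True by simp
  have "lm j \<le> lm (r + s) + 1" using j s_ge_2 by (intro near) auto
  then have "k \<le> Q" using k lm_high[of s] eta_s s_ge_2 by simp
  moreover have "degree (Psi j k) \<le> n_total + k - 1"
    using nt True by (intro Psi_top(1)[OF j k]) (simp add: row_order_def)
  ultimately show ?thesis using s_ge_2 nt by (simp add: image_dim_def)
next
  case False
  define l where "l = j - r"
  have l: "j = r + l" "l \<in> {1..s}" using False j by (auto simp: l_def)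
  have "k + l < Q + s"
    using k lm_high[OF l(2)] eta_eq[OF l(2)] l R0_less by (auto split: if_splits)
  moreover have "degree (Psi j k) \<le> n_total + k + (l - 1)"
    using False by (intro Psi_top(1)[OF j k]) (simp add: row_order_def l_def)
  ultimately show ?thesis using l(2) by (auto simp: image_dim_def)
qed

text \<open>A vanishing combination is \<open>lap_map\<close> of the reduced vector with these
  coefficients, so injectivity applies.\<close>

lemma Psi_independent:
  "inj_on (\<lambda>(j, k). Psi j k) reduced_indices"
  "poly_vs.independent ((\<lambda>(j, k). Psi j k) ` reduced_indices)"
proof -
  have fin: "finite reduced_indices" using card_reduced_indices by simp
  have "\<forall>x\<in>reduced_indices. c x = 0"
    if zero: "(\<Sum>x\<in>reduced_indices. Polynomial.smult (c x) (case x of (j, k) \<Rightarrow> Psi j k)) = 0" for c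
  proof -
    define V where "V j = (\<Sum>x\<in>reduced_indices. if fst x = j then monom (c x) (snd x) else 0)" for j
    have cV: "coeff (V j) k = (if (j, k) \<in> reduced_indices then c (j, k) else 0)" for j k
    proof -
      have "coeff (V j) k = (\<Sum>x\<in>reduced_indices. if x = (j, k) then c (j, k) else 0)"
        unfolding V_def coeff_sum by (intro sum.cong) auto
      then show ?thesis using fin by (simp add: sum.delta)
    qed
    have out: "(j, k) \<notin> reduced_indices" if "j \<notin> {1..r+s} \<or> lm j \<le> k" for j k
      using that reduced_indices_subset by auto
    have "V \<in> comp_space"
    proof (rule comp_spaceI)
      show "V j = 0" if "j \<notin> {1..r+s}" for j using out that by (simp add: poly_eq_iff cV)
      show "coeff (V j) k = 0" if "lm j \<le> k" for j k using out that by (simp add: cV)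
    qed
    moreover have "degree (V (r + l)) = 0" if "l \<in> {1..<s}" for l
    proof -
      have "coeff (V (r + l)) k = 0" if "0 < k" for k
        using \<open>l \<in> {1..<s}\<close> that by (auto simp: cV reduced_indices_def)
      then have "degree (V (r + l)) \<le> 0" by (intro degree_le) auto
      then show ?thesis by simp
    qed
    ultimately have red: "V \<in> reduced_space" by (simp add: reduced_space_def)
    have "lap_map V = (\<Sum>x\<in>reduced_indices. Polynomial.smult (c x) (case x of (j, k) \<Rightarrow> Psi j k))"
      unfolding lap_map_def using reduced_indices_subset
      by (intro sum.mono_neutral_cong_right) (auto simp: cV)
    with zero have "lap_map V = 0" by simp
    from lap_map_inj_reduced[OF red this] have "coeff (V j) k = 0" for j k by simp
    then show ?thesis using cV by (metis surj_pair)
  qed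
  note * = poly_vs.independent_family[OF fin this]
  show "inj_on (\<lambda>(j, k). Psi j k) reduced_indices" by (rule *(1))
  show "poly_vs.independent ((\<lambda>(j, k). Psi j k) ` reduced_indices)" by (rule *(2))
qed

definition Phi_set where
  "Phi_set = {\<Phi> j k | j k. j \<in> {1..r+s} \<and> k < lm j}"

text \<open>The passage from \<open>Psi\<close> to \<open>\<Phi>\<close> is unitriangular in
  \<open>k\<close>, since the Hermite polynomials are monic.\<close>

lemma Psi_in_span_Phi:
  assumes j: "j \<in> {1..r+s}" and k: "k < lm j" shows "Psi j k \<in> poly_vs.span Phi_set"
  using k
proof (induction k rule: less_induct)
  case (less k)
  have "\<Phi> j k = (\<Sum>i<k. Polynomial.smult (coeff (monic_hermite k) i) (Psi j i)) + Psi j k"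
    unfolding Phi_eq[OF j less.prems] by (simp add: lessThan_Suc_atMost[symmetric] coeff_monic_hermite)
  then have "Psi j k = \<Phi> j k - (\<Sum>i<k. Polynomial.smult (coeff (monic_hermite k) i) (Psi j i))" by simp
  moreover have "\<Phi> j k \<in> poly_vs.span Phi_set"
    using j less.prems by (intro poly_vs.span_base) (auto simp: Phi_set_def)
  moreover have "(\<Sum>i<k. Polynomial.smult (coeff (monic_hermite k) i) (Psi j i)) \<in> poly_vs.span Phi_set"
    using less by (intro poly_vs.span_sum poly_vs.span_scale) auto
  ultimately show ?case by (simp add: poly_vs.span_diff)
qed

lemma image_dim_pos: "0 < image_dim" using s_ge_2 by (simp add: image_dim_def)

lemma subspace_degree_less: "poly_vs.subspace {p :: real poly. degree p \<le> m}"
  by (rule poly_vs.subspaceI) (auto intro: degree_add_le order_trans[OF degree_smult_le])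

lemma span_Phi: "poly_vs.span Phi_set = {p. degree p \<le> image_dim - 1}"
proof
  have "Phi_set \<subseteq> {p. degree p \<le> image_dim - 1}"
  proof
    fix p assume "p \<in> Phi_set"
    then obtain j k where p: "p = \<Phi> j k" "j \<in> {1..r+s}" "k < lm j" by (auto simp: Phi_set_def)
    have "degree (Psi j i) \<le> image_dim - 1" if "i \<le> k" for i
      using Psi_degree[OF p(2), of i] p(3) that by simp
    then show "p \<in> {p. degree p \<le> image_dim - 1}"
      unfolding p(1) Phi_eq[OF p(2,3)]
      by (auto intro!: degree_sum_le order_trans[OF degree_smult_le])
  qed
  then show "poly_vs.span Phi_set \<subseteq> {p. degree p \<le> image_dim - 1}"
    using subspace_degree_less by (rule poly_vs.span_minimal)
  let ?T = "(\<lambda>i. monom (1::real) i) ` {..<image_dim}" and ?A = "(\<lambda>(j, k). Psi j k) ` reduced_indices"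
  have monoms: "{p. degree p \<le> image_dim - 1} \<subseteq> poly_vs.span ?T"
  proof
    fix p :: "real poly" assume "p \<in> {p. degree p \<le> image_dim - 1}"
    then have "degree p \<le> image_dim - 1" by simp
    then have "p = (\<Sum>i\<le>image_dim - 1. monom (coeff p i) i)" by (rule poly_as_sum_of_monoms'[symmetric])
    also have "\<dots> = (\<Sum>i\<le>image_dim - 1. Polynomial.smult (coeff p i) (monom 1 i))" by (simp add: smult_monom)
    also have "\<dots> \<in> poly_vs.span ?T"
      using image_dim_pos by (intro poly_vs.span_sum poly_vs.span_scale poly_vs.span_base) auto
    finally show "p \<in> poly_vs.span ?T" .
  qed
  have "?A \<subseteq> {p. degree p \<le> image_dim - 1}" using Psi_degree reduced_indices_subset by fastforce
  then have "?A \<subseteq> poly_vs.span ?T" using monoms by blast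
  moreover have "card ?T \<le> card ?A"
    using card_image[OF Psi_independent(1)] card_reduced_indices card_image_le[of "{..<image_dim}" "\<lambda>i. monom (1::real) i"]
    by simp
  \<comment> \<open>There are \<open>image_dim\<close> independent polynomials inside a space
    spanned by at most \<open>image_dim\<close> monomials.\<close>
  ultimately have "poly_vs.span ?T \<subseteq> poly_vs.span ?A"
    by (intro poly_vs.independent_spans Psi_independent(2)) simp_all
  moreover have "poly_vs.span ?A \<subseteq> poly_vs.span Phi_set"
    using Psi_in_span_Phi reduced_indices_subset by (intro poly_vs.span_minimal) auto
  ultimately show "{p. degree p \<le> image_dim - 1} \<subseteq> poly_vs.span Phi_set" using monoms by blast
qed

end

section \<open>Rank and kernel of a matrix\<close>

lemma rank_kernel_dim:
  fixes A :: "real mat"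
  assumes A: "A \<in> carrier_mat nr nc"
  shows "vec_space.rank nr A + kernel_dim A = nc"
proof -
  interpret V: vec_space "TYPE(real)" nc .
  interpret W: vec_space "TYPE(real)" nr .
  interpret linear_map class_ring V.V W.V "(*\<^sub>v) A"
    using A
    by unfold_locales
      (auto simp: module_hom_def mult_add_distrib_mat_vec mult_mat_vec module_vec_simps)
  interpret K: kernel nr nc A by unfold_locales (rule A)
  have "W.col_space A = imT"
    using A by (auto simp: W.col_space_eq[OF A] im_def)
  moreover have "kerT = mat_kernel A"
    using A by (auto simp: ker_def mat_kernel_def)
  ultimately show ?thesis
    using rank_nullity[OF V.fin_dim] V.dim_is_n
    by (simp add: W.rank_def W.col_space_def kernel_dim_def carrier_matD(2)[OF A])
qed

text \<open>The comparison matrix \<open>M\<close> has the first \<open>m\<close> unit vectors as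
  columns: the same column space, and visibly full column rank.\<close>

lemma rank_of_image:
  fixes A :: "real mat"
  assumes A: "A \<in> carrier_mat n nc" and m: "m \<le> n"
    and im: "{A *\<^sub>v x |x. x \<in> carrier_vec nc} = {y \<in> carrier_vec n. \<forall>i. m \<le> i \<and> i < n \<longrightarrow> y $ i = 0}"
  shows "vec_space.rank n A = m"
proof -
  interpret W: vec_space "TYPE(real)" n .
  define M :: "real mat" where "M = mat n m (\<lambda>(i, j). if i = j then 1 else 0)"
  have M: "M \<in> carrier_mat n m" by (simp add: M_def)
  have cols: "cols M = map (unit_vec n) [0..<m]"
    using m by (auto simp: cols_def M_def unit_vec_def intro!: eq_vecI)
  have dist: "distinct (cols M)"
    unfolding cols distinct_map using m by (auto simp: inj_on_def)
  have "set (cols M) \<subseteq> set (unit_vecs n)" using m by (auto simp: cols unit_vecs_def)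
  then have "W.lin_indpt (set (cols M))"
    using W.unit_vecs_basis W.subset_li_is_li by (auto simp: W.basis_def)
  then have "W.rank M = m" using W.lin_indpt_full_rank[OF M dist] by simp
  have Mx: "M *\<^sub>v x = vec n (\<lambda>i. if i < m then x $ i else 0)" if x: "x \<in> carrier_vec m" for x
  proof (rule eq_vecI)
    fix i assume "i < dim_vec (vec n (\<lambda>i. if i < m then x $ i else 0))"
    then have i: "i < n" by simp
    have "(M *\<^sub>v x) $ i = (\<Sum>j=0..<m. (if i = j then 1 else 0) * x $ j)"
      using i x by (simp add: M_def scalar_prod_def)
    also have "\<dots> = (\<Sum>j=0..<m. if j = i then x $ i else 0)" by (intro sum.cong) auto
    finally show "(M *\<^sub>v x) $ i = vec n (\<lambda>i. if i < m then x $ i else 0) $ i"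
      using i by (simp add: sum.delta)
  qed (simp add: M_def)
  have "W.col_space M = {y \<in> carrier_vec n. \<exists>x\<in>carrier_vec m. M *\<^sub>v x = y}"
    using W.col_space_eq[OF M] M by simp
  also have "\<dots> = {y \<in> carrier_vec n. \<forall>i. m \<le> i \<and> i < n \<longrightarrow> y $ i = 0}"
  proof (intro Collect_cong conj_cong refl iffI)
    fix y assume y: "y \<in> carrier_vec n" "\<forall>i. m \<le> i \<and> i < n \<longrightarrow> y $ i = (0::real)"
    show "\<exists>x\<in>carrier_vec m. M *\<^sub>v x = y"
      using y m by (intro bexI[of _ "vec m (\<lambda>i. y $ i)"], subst Mx) (auto intro!: eq_vecI)
  qed (auto simp: Mx)
  also have "\<dots> = W.col_space A"
    unfolding im[symmetric] using W.col_space_eq[OF A] A by auto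
  finally have "W.rank M = W.rank A" by (simp add: W.rank_def W.col_space_def)
  with \<open>W.rank M = m\<close> show ?thesis by simp
qed

lemma sum_step_line:
  fixes \<eta> :: "nat \<Rightarrow> nat"
  assumes "\<And>l. l \<in> {1..s} \<Longrightarrow> \<eta> l = (if l \<le> R0 then Q + 1 else Q)" "R0 < s"
  shows "(\<Sum>l=1..s. \<eta> l) = s * Q + R0"
proof -
  have "(\<Sum>l=1..s. \<eta> l) = (\<Sum>l=1..s. Q + (if l \<le> R0 then 1 else 0))"
    using assms(1) by (intro sum.cong refl) simp
  also have "\<dots> = s * Q + (\<Sum>l=1..s. if l \<le> R0 then 1 else 0)" by (simp add: sum.distrib)
  also have "(\<Sum>l=1..s. if l \<le> R0 then 1 else 0) = (\<Sum>l=1..R0. 1 :: nat)"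
    by (rule sum.mono_neutral_cong_right) (use assms(2) in auto)
  finally show ?thesis by simp
qed

context admissible_weight
begin

section \<open>Hermite coordinates\<close>

abbreviation N where "N \<equiv> lam_total r s n \<eta>"
abbreviation C where "C \<equiv> C_mat r s \<rho> d a n \<eta>"
abbreviation E where "E \<equiv> hermite_coords r s n \<eta>"
abbreviation idx where "idx c \<equiv> lam_indices r s n \<eta> ! c"

lemma N_eq: "N = n_total + (\<Sum>l=1..s. \<eta> l)"
proof -
  have "N = (\<Sum>j=1..r. lm j) + (\<Sum>j=r+1..r+s. lm j)"
    unfolding lam_total_def by (rule sum.ub_add_nat) simp
  moreover have "(\<Sum>j=1..r. lm j) = n_total" unfolding n_total_def by (intro sum.cong) (auto simp: lm_low)
  moreover have "(\<Sum>j=r+1..r+s. lm j) = (\<Sum>l=1..s. \<eta> l)"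
    by (rule sum.reindex_bij_witness[of _ "\<lambda>l. l + r" "\<lambda>j. j - r"]) (auto simp: lam_def)
  ultimately show ?thesis by simp
qed

lemma sum_eta: "(\<Sum>l=1..s. \<eta> l) = s * Q + R0"
  by (rule sum_step_line[OF eta_eq R0_less])

text \<open>The origin of \<open>\<kappa>\<close> is the identity
  \<open>s Q - (Q + s - 1) = (s - 1)(Q - 1)\<close>.\<close>

lemma image_dim_eq: "N = image_dim + ((s - 1) * (Q - 1) + R0)"
proof -
  have "s * Q = Q + s - 1 + (s - 1) * (Q - 1)"
  proof -
    obtain s' where "s = Suc s'" using s_ge_2 by (cases s) auto
    moreover obtain Q' where "Q = Suc Q'" using Q_pos by (cases Q) auto
    ultimately show ?thesis by simp
  qed
  then show ?thesis unfolding N_eq sum_eta image_dim_def using s_ge_2 by simp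
qed

lemma bij_idx: "bij_betw (\<lambda>c. idx c) {..<N} (Sigma {1..r+s} (\<lambda>j. {..<lm j}))"
proof -
  let ?L = "lam_indices r s n \<eta>"
  have set: "set ?L = Sigma {1..r+s} (\<lambda>j. {..<lm j})" by (auto simp: set_lam_indices)
  have "card (set ?L) = length ?L"
    unfolding set length_lam_indices by (simp add: lam_total_def)
  \<comment> \<open>The list is as long as its set is large, so it has no repetitions.\<close>
  then have "distinct ?L" by (rule card_distinct)
  from bij_betw_nth[OF this] show ?thesis by (simp add: set length_lam_indices)
qed

lemma sum_idx: "(\<Sum>c<N. f (idx c)) = (\<Sum>j=1..r+s. \<Sum>k<lm j. f (j, k))"
proof -
  have "(\<Sum>c<N. f (idx c)) = sum f (Sigma {1..r+s} (\<lambda>j. {..<lm j}))"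
    by (rule sum.reindex_bij_betw[OF bij_idx])
  then show ?thesis by (simp add: sum.Sigma)
qed

lemma E_carrier: "E V \<in> carrier_vec N"
  by (simp add: hermite_coords_def)

lemma E_index: "c < N \<Longrightarrow> E V $ c = (case idx c of (j, k) \<Rightarrow> hermite_coeff (V j) k)"
  by (simp add: hermite_coords_def hermite_coeff_def)

lemma E_add: "E (V + V') = E V + E V'"
  by (rule eq_vecI) (simp_all add: E_index carrier_vecD[OF E_carrier] hermite_coeff_add split: prod.split)

lemma E_scale: "E (comp_scale c V) = c \<cdot>\<^sub>v E V"
  by (rule eq_vecI)
    (simp_all add: E_index carrier_vecD[OF E_carrier] hermite_coeff_smult comp_scale_def split: prod.split)

lemma bij_E: "bij_betw E comp_space (carrier_vec N)"
  unfolding bij_betw_def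
proof
  show "inj_on E comp_space"
  proof (rule inj_onI, rule ext)
    fix V V' j assume V: "V \<in> comp_space" "V' \<in> comp_space" "E V = E V'"
    have h: "hermite_coeff (V j) k = hermite_coeff (V' j) k" if "j \<in> {1..r+s}" "k < lm j" for k
    proof -
      have "(j, k) \<in> (\<lambda>c. idx c) ` {..<N}" using bij_idx that by (auto simp: bij_betw_def)
      then obtain c where "c < N" "idx c = (j, k)" by auto
      then show ?thesis using arg_cong[OF V(3), of "\<lambda>v. v $ c"] by (simp add: E_index)
    qed
    show "V j = V' j"
    proof (cases "j \<in> {1..r+s}")
      case True
      have "V j = (\<Sum>k<lm j. Polynomial.smult (hermite_coeff (V j) k) (monic_hermite k))"
        by (rule hermite_expansion) (rule comp_space_coeff[OF V(1)])
      also have "\<dots> = (\<Sum>k<lm j. Polynomial.smult (hermite_coeff (V' j) k) (monic_hermite k))"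
        using h[OF True] by (intro sum.cong) auto
      also have "\<dots> = V' j"
        by (rule hermite_expansion[symmetric]) (rule comp_space_coeff[OF V(2)])
      finally show ?thesis .
    next
      case False
      then show ?thesis using V(1,2) by (simp add: comp_space_def)
    qed
  qed
  have "v \<in> E ` comp_space" if v: "v \<in> carrier_vec N" for v
  proof
    define pos where "pos = inv_into {..<N} (\<lambda>c. idx c)"
    define V where "V j = (if j \<in> {1..r+s}
      then \<Sum>k<lm j. Polynomial.smult (v $ pos (j, k)) (monic_hermite k) else 0)" for j
    show "V \<in> comp_space"
    proof (rule comp_spaceI)
      show "coeff (V j) i = 0" if "j \<in> {1..r+s}" "lm j \<le> i" for j i
        using that by (auto simp: V_def coeff_sum coeff_eq_0 degree_monic_hermite intro!: sum.neutral)
    qed (auto simp: V_def)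
    show "v = E V"
    proof (rule eq_vecI)
      fix c assume "c < dim_vec (E V)"
      then have c: "c < N" by (simp add: carrier_vecD[OF E_carrier])
      obtain j k where jk: "idx c = (j, k)" by (cases "idx c")
      have "(j, k) \<in> Sigma {1..r+s} (\<lambda>j. {..<lm j})"
        using bij_idx c jk by (metis bij_betwE lessThan_iff)
      moreover have "pos (j, k) = c"
        unfolding pos_def jk[symmetric] using bij_idx c by (intro inv_into_f_f) (auto simp: bij_betw_def)
      ultimately show "v $ c = E V $ c"
        using c jk by (simp add: E_index V_def hermite_coeff_sum)
    qed (use v in \<open>simp add: carrier_vecD[OF E_carrier]\<close>)
  qed
  then show "E ` comp_space = carrier_vec N" using E_carrier by blast
qed

definition vec_poly :: "real vec \<Rightarrow> real poly" where
  "vec_poly v = (\<Sum>c<N. Polynomial.smult (v $ c) (case idx c of (j, k) \<Rightarrow> \<Phi> j k))"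

lemma C_carrier: "C \<in> carrier_mat N N"
  by (simp add: C_mat_def)

lemma C_mult: "v \<in> carrier_vec N \<Longrightarrow> C *\<^sub>v v = vec N (coeff (vec_poly v))"
  by (rule eq_vecI)
    (auto simp: C_mat_def vec_poly_def scalar_prod_def coeff_sum case_prod_unfold mult.commute
      atLeast0LessThan intro!: sum.cong)

text \<open>\<open>\<Phi> j k\<close> arises from the \<open>Psi j i\<close> with the same
  coefficients as the Hermite polynomial from the powers of \<open>t\<close>, so the change of basis
  cancels.\<close>

lemma vec_poly_E:
  assumes V: "V \<in> comp_space" shows "vec_poly (E V) = lap_map V"
proof -
  have "vec_poly (E V) = (\<Sum>c<N. case idx c of (j, k) \<Rightarrow> Polynomial.smult (hermite_coeff (V j) k) (\<Phi> j k))"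
    unfolding vec_poly_def by (intro sum.cong refl) (auto simp: E_index split: prod.split)
  also have "\<dots> = (\<Sum>j=1..r+s. \<Sum>k<lm j. Polynomial.smult (hermite_coeff (V j) k) (\<Phi> j k))"
    by (subst sum_idx) simp
  also have "\<dots> = (\<Sum>j=1..r+s. \<Sum>i<lm j. Polynomial.smult (coeff (V j) i) (Psi j i))"
  proof (rule sum.cong[OF refl])
    fix j assume j: "j \<in> {1..r+s}"
    have "(\<Sum>k<lm j. Polynomial.smult (hermite_coeff (V j) k) (\<Phi> j k))
        = (\<Sum>k<lm j. \<Sum>i<lm j. Polynomial.smult (hermite_coeff (V j) k * coeff (monic_hermite k) i) (Psi j i))"
    proof (rule sum.cong[OF refl])
      fix k assume k: "k \<in> {..<lm j}"
      have "\<Phi> j k = (\<Sum>i<lm j. Polynomial.smult (coeff (monic_hermite k) i) (Psi j i))"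
        unfolding Phi_eq[OF j k[unfolded lessThan_iff]]
      proof (rule sum.mono_neutral_left)
        show "\<forall>i\<in>{..<lm j} - {..k}. Polynomial.smult (coeff (monic_hermite k) i) (Psi j i) = 0"
          by (simp add: coeff_eq_0 degree_monic_hermite)
      qed (use k in auto)
      then show "Polynomial.smult (hermite_coeff (V j) k) (\<Phi> j k)
          = (\<Sum>i<lm j. Polynomial.smult (hermite_coeff (V j) k * coeff (monic_hermite k) i) (Psi j i))"
        by (simp add: poly_vs.scale_sum_right)
    qed
    also have "\<dots> = (\<Sum>i<lm j. \<Sum>k<lm j. Polynomial.smult (hermite_coeff (V j) k * coeff (monic_hermite k) i) (Psi j i))"
      by (rule sum.swap)
    also have "\<dots> = (\<Sum>i<lm j. Polynomial.smult (coeff (V j) i) (Psi j i))"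
    proof (rule sum.cong[OF refl])
      fix i
      have "V j = (\<Sum>k<lm j. Polynomial.smult (hermite_coeff (V j) k) (monic_hermite k))"
        by (rule hermite_expansion) (rule comp_space_coeff[OF V])
      then have "coeff (V j) i = (\<Sum>k<lm j. hermite_coeff (V j) k * coeff (monic_hermite k) i)"
        by (metis (no_types, lifting) coeff_smult coeff_sum sum.cong)
      then show "(\<Sum>k<lm j. Polynomial.smult (hermite_coeff (V j) k * coeff (monic_hermite k) i) (Psi j i))
          = Polynomial.smult (coeff (V j) i) (Psi j i)"
        by (simp add: poly_vs.scale_sum_left)
    qed
    finally show "(\<Sum>k<lm j. Polynomial.smult (hermite_coeff (V j) k) (\<Phi> j k))
        = (\<Sum>i<lm j. Polynomial.smult (coeff (V j) i) (Psi j i))" .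
  qed
  also have "\<dots> = lap_map V" unfolding lap_map_def by (rule sum.Sigma) simp_all
  finally show ?thesis .
qed

lemma lap_map_in_span: "lap_map V \<in> poly_vs.span Phi_set"
  unfolding lap_map_def using Psi_in_span_Phi
  by (intro poly_vs.span_sum) (auto intro!: poly_vs.span_scale)

lemma vec_poly_degree:
  assumes "v \<in> carrier_vec N" shows "degree (vec_poly v) \<le> image_dim - 1"
proof -
  obtain V where "V \<in> comp_space" "v = E V" using assms bij_E by (auto simp: bij_betw_def)
  then show ?thesis using lap_map_in_span[of V] span_Phi by (simp add: vec_poly_E)
qed

lemma vec_poly_surj:
  assumes "degree p \<le> image_dim - 1" shows "\<exists>v\<in>carrier_vec N. vec_poly v = p"
proof -
  have zero: "vec_poly (0\<^sub>v N) = 0" by (simp add: vec_poly_def)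
  have add: "vec_poly (v + w) = vec_poly v + vec_poly w"
    if "v \<in> carrier_vec N" "w \<in> carrier_vec N" for v w
    using that by (simp add: vec_poly_def smult_add_left sum.distrib)
  have scale: "vec_poly (x \<cdot>\<^sub>v v) = Polynomial.smult x (vec_poly v)" if "v \<in> carrier_vec N" for x v
    using that by (simp add: vec_poly_def poly_vs.scale_sum_right)
  have "poly_vs.subspace (vec_poly ` carrier_vec N)"
    by (rule poly_vs.subspaceI)
      (auto simp flip: zero add scale intro!: imageI)
  moreover have "Phi_set \<subseteq> vec_poly ` carrier_vec N"
  proof
    fix q assume "q \<in> Phi_set"
    then obtain j k where q: "q = \<Phi> j k" "j \<in> {1..r+s}" "k < lm j" by (auto simp: Phi_set_def)
    have "(j, k) \<in> (\<lambda>c. idx c) ` {..<N}" using bij_idx q by (auto simp: bij_betw_def)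
    then obtain c where c: "c < N" "idx c = (j, k)" by auto
    have "vec_poly (unit_vec N c) = (\<Sum>c'<N. if c' = c then \<Phi> j k else 0)"
      unfolding vec_poly_def using c by (intro sum.cong) auto
    also have "\<dots> = q" using c(1) q(1) by (simp add: sum.delta)
    finally show "q \<in> vec_poly ` carrier_vec N" by (intro image_eqI[of _ _ "unit_vec N c"]) auto
  qed
  ultimately have "poly_vs.span Phi_set \<subseteq> vec_poly ` carrier_vec N" by (intro poly_vs.span_minimal)
  then show ?thesis using assms span_Phi by (auto simp: image_iff)
qed

lemma rank_C: "vec_space.rank N C = image_dim"
proof (rule rank_of_image[OF C_carrier])
  show le: "image_dim \<le> N" using image_dim_eq by simp
  show "{C *\<^sub>v x |x. x \<in> carrier_vec N} = {y \<in> carrier_vec N. \<forall>i. image_dim \<le> i \<and> i < N \<longrightarrow> y $ i = 0}"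
  proof (intro equalityI subsetI)
    fix y assume "y \<in> {C *\<^sub>v x |x. x \<in> carrier_vec N}"
    then obtain x where x: "x \<in> carrier_vec N" "y = C *\<^sub>v x" by blast
    have "coeff (vec_poly x) i = 0" if "image_dim \<le> i" for i
      using vec_poly_degree[OF x(1)] image_dim_pos that by (intro coeff_eq_0) auto
    then show "y \<in> {y \<in> carrier_vec N. \<forall>i. image_dim \<le> i \<and> i < N \<longrightarrow> y $ i = 0}"
      using x by (simp add: C_mult)
  next
    fix y :: "real vec" assume y: "y \<in> {y \<in> carrier_vec N. \<forall>i. image_dim \<le> i \<and> i < N \<longrightarrow> y $ i = 0}"
    define p where "p = (\<Sum>i<image_dim. monom (y $ i) i)"
    have cp: "coeff p i = (if i < image_dim then y $ i else 0)" for i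
      by (simp add: p_def coeff_sum)
    have "degree p \<le> image_dim - 1" using image_dim_pos by (intro degree_le) (auto simp: cp)
    from vec_poly_surj[OF this] obtain v where v: "v \<in> carrier_vec N" "vec_poly v = p" by blast
    have "C *\<^sub>v v = y"
      unfolding C_mult[OF v(1)] v(2) using y by (intro eq_vecI) (auto simp: cp)
    then show "y \<in> {C *\<^sub>v x |x. x \<in> carrier_vec N}" using v(1) by blast
  qed
qed

text \<open>Every \<open>vec_poly v\<close> has degree below \<open>N\<close>, so the
  \<open>N\<close> rows of \<open>C\<close> see all its coefficients.\<close>

lemma mat_kernel_C: "mat_kernel C = {v \<in> carrier_vec N. vec_poly v = 0}"
proof -
  have "C *\<^sub>v v = 0\<^sub>v N \<longleftrightarrow> vec_poly v = 0" if v: "v \<in> carrier_vec N" for v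
  proof
    assume eq: "C *\<^sub>v v = 0\<^sub>v N"
    have "coeff (vec_poly v) i = 0" if "i < N" for i
    proof -
      have "coeff (vec_poly v) i = (C *\<^sub>v v) $ i" using that v by (simp add: C_mult)
      then show ?thesis using eq that by simp
    qed
    moreover have "coeff (vec_poly v) i = 0" if "N \<le> i" for i
      using vec_poly_degree[OF v] image_dim_pos image_dim_eq that by (intro coeff_eq_0) auto
    ultimately show "vec_poly v = 0" by (metis not_less poly_eqI coeff_0)
  qed (use v in \<open>auto simp: C_mult intro!: eq_vecI\<close>)
  then show ?thesis unfolding mat_kernel[OF C_carrier] by blast
qed

lemma bij_E_kernel: "bij_betw E W (mat_kernel C)"
proof -
  have "E ` W = mat_kernel C"
    unfolding W_eq_kernel mat_kernel_C using bij_E vec_poly_E by (force simp: bij_betw_def)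
  moreover have "inj_on E W"
    using bij_E W_eq_kernel by (auto simp: bij_betw_def intro: inj_on_subset)
  ultimately show ?thesis by (simp add: bij_betw_def)
qed

end

theorem theoremA4:
  fixes r s Q R0 :: nat and \<rho> d :: "nat \<Rightarrow> real" and a :: real and n \<eta> :: "nat \<Rightarrow> nat"
  defines "R \<equiv> (\<Sum>l=1..s. \<eta> l)"
    and "N \<equiv> lam_total r s n \<eta>"
    and "\<kappa> \<equiv> (s - 1) * (Q - 1) + R0"
    and "C \<equiv> C_mat r s \<rho> d a n \<eta>"
    and "W \<equiv> relation_space r s \<rho> d a n \<eta>"
    and "B \<equiv> {r_shift r s \<rho> d a k b | k b. k \<le> s - 2 \<and> b + 2 \<le> \<eta> (k + 1)}"
    and "E \<equiv> hermite_coords r s n \<eta>"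
  assumes "s \<ge> 2"
    and "\<And>h. h \<in> {1..r} \<Longrightarrow> \<rho> h > 0"
    and "\<And>h. h \<in> {1..r} \<Longrightarrow> d h \<ge> 0"
    and "Laguerre_admissible r s n \<eta>"
    and "R > s"
    and "inj_on \<rho> {h \<in> {1..r}. n h > 0}"
    and "R = s * Q + R0" and "R0 < s"
  shows "\<kappa> > 0 \<and>
    poly_vs.span {Phi r \<rho> d a n j k | j k. j \<in> {1..r+s} \<and> k < lam r n \<eta> j}
      = {p. degree p \<le> N - \<kappa> - 1} \<and>
    vec_space.rank N C = N - \<kappa> \<and>
    kernel_dim C = \<kappa> \<and>
    B \<subseteq> W \<and> comp_vs.independent B \<and> comp_vs.span B = W \<and>
    bij_betw E W (mat_kernel C) \<and>
    (\<forall>V\<in>W. \<forall>V'\<in>W. E (V + V') = E V + E V') \<and>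
    (\<forall>c. \<forall>V\<in>W. E (comp_scale c V) = c \<cdot>\<^sub>v E V)"
proof -
  note s = \<open>s \<ge> 2\<close> and adm = \<open>Laguerre_admissible r s n \<eta>\<close>
  \<comment> \<open>The step-line supplies its own parameters; uniqueness of division of
    \<open>R\<close> by \<open>s\<close> identifies them with \<open>Q\<close> and
    \<open>R0\<close>.\<close>
  obtain Q' R0' where R0': "R0' < s" and eta': "\<forall>l\<in>{1..s}. \<eta> l = (if l \<le> R0' then Q' + 1 else Q')"
    using adm unfolding Laguerre_admissible_def on_step_line_def by blast
  have "(\<Sum>l=1..s. \<eta> l) = s * Q' + R0'" using eta' R0' by (intro sum_step_line) auto
  then have eq: "s * Q' + R0' = s * Q + R0" using \<open>R = s * Q + R0\<close> unfolding R_def by simp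
  have "Q' = (s * Q' + R0') div s" using R0' by simp
  also have "\<dots> = Q" unfolding eq using \<open>R0 < s\<close> by simp
  finally have "Q' = Q" .
  with eq have "R0' = R0" by simp
  with \<open>Q' = Q\<close> have eta: "\<eta> l = (if l \<le> R0 then Q + 1 else Q)" if "l \<in> {1..s}" for l
    using eta' that by blast
  have big: "s < s * Q + R0" using \<open>R > s\<close> \<open>R = s * Q + R0\<close> by simp
  have "Q \<noteq> 0" using big \<open>R0 < s\<close> by (intro notI) simp
  then have Q: "1 \<le> Q" by simp
  have "0 < R0" if "Q = 1" using big that by simp
  then have QR: "2 \<le> Q \<or> 0 < R0" using Q by linarith
  have near: "lam r n \<eta> i \<le> lam r n \<eta> j + 1" if "i \<in> {1..r+s}" "j \<in> {1..r+s}" for i j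
    using adm that unfolding Laguerre_admissible_def by blast
  \<comment> \<open>Since \<open>\<eta> 1 \<ge> 2\<close> and entries differ by at most one, the
    distinctness assumption covers all rates.\<close>
  have "n h > 0" if h: "h \<in> {1..r}" for h
  proof -
    have "lam r n \<eta> (r + 1) \<le> lam r n \<eta> h + 1" using h s by (intro near) auto
    moreover have "2 \<le> \<eta> 1" using eta[of 1] QR Q s by auto
    ultimately show ?thesis using h by (simp add: lam_def)
  qed
  then have "{h \<in> {1..r}. n h > 0} = {1..r}" by blast
  with \<open>inj_on \<rho> {h \<in> {1..r}. n h > 0}\<close> have "inj_on \<rho> {1..r}" by simp
  then interpret A: admissible_weight r \<rho> d a s Q R0 n \<eta>
    using s Q \<open>R0 < s\<close> eta near assms by unfold_locales auto
  have \<kappa>: "N = A.image_dim + \<kappa>" unfolding N_def \<kappa>_def by (rule A.image_dim_eq)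
  have B: "B = A.B" unfolding B_def A.B_def A.shift_indices_def by auto
  have "\<kappa> > 0" unfolding \<kappa>_def using QR s by auto
  moreover have "poly_vs.span {Phi r \<rho> d a n j k | j k. j \<in> {1..r+s} \<and> k < lam r n \<eta> j}
      = {p. degree p \<le> N - \<kappa> - 1}"
    using A.span_Phi \<kappa> unfolding A.Phi_set_def by simp
  moreover have rank: "vec_space.rank N C = N - \<kappa>" using A.rank_C \<kappa> unfolding N_def C_def by simp
  moreover have "kernel_dim C = \<kappa>"
    using rank_kernel_dim[OF A.C_carrier] A.rank_C \<kappa> unfolding N_def C_def by simp
  moreover have "B \<subseteq> W" unfolding B W_def by (rule A.B_subset_W)
  moreover have "comp_vs.independent B" unfolding B by (rule A.B_independent)
  moreover have "comp_vs.span B = W" unfolding B W_def by (rule A.W_eq_span_B[symmetric])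
  moreover have "bij_betw E W (mat_kernel C)" unfolding E_def W_def C_def by (rule A.bij_E_kernel)
  moreover have "E (V + V') = E V + E V'" for V V' unfolding E_def by (rule A.E_add)
  moreover have "E (comp_scale c V) = c \<cdot>\<^sub>v E V" for c V unfolding E_def by (rule A.E_scale)
  ultimately show ?thesis by blast
qed

end
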